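(* Let $Y_n$ be the protection number of a random internal vertex in a random non-plane binary tree of size $n$. Let $T(z)$ be the generating function of non-plane binary trees, $\rho$ its dominant singularity, $a>0$ the constant in the expansion $T(z)\sim\frac1\rho-a\sqrt{1-z/\rho}$ as $z\to\rho$, $T_k(z)$ the generating function of non-plane binary trees with protection number at least $k$, and, for $k\ge 1$, $S_k(z)$ the generating function whose $n$-th coefficient is the total number of $k$-protected vertices in all non-plane binary trees of size $n$. Then $$\lim_{n\to\infty}\mathbb{E}Y_n=\frac{2}{a^2\rho}\sum_{k\ge 1}\left(\rho\,S_k(\rho^2)+T_k(\rho)\right)\approx 1.3124128299$$ and $$\lim_{n\to\infty}\mathbb{V}Y_n\approx 0.2676338724.$$
   Context: A non-plane binary tree is an unlabelled non-plane rooted tree (an isomorphism class of finite rooted trees) in which every vertex has either $0$ children (a leaf) or exactly $2$ children (an internal vertex). Its size is its number of internal vertices (so the single leaf has size $0$). A random non-plane binary tree of size $n$ is chosen uniformly among all non-plane binary trees of size $n$, and then (for $n\ge 1$) the random internal vertex is chosen uniformly among its $n$ internal vertices. The protection number of a rooted tree is the length (number of edges) of the shortest path from the root to a leaf; the single-vertex tree has protection number $0$. The protection number of a vertex $v$ is the protection number of the maximal subtree rooted at $v$ (consisting of $v$ and all its descendants). A vertex is $k$-protected if $k$ does not exceed its protection number. The generating function $T(z)$, with $z$ marking internal vertices, satisfies $T(z)=1+z\left(\frac12T(z)^2+\frac12T(z^2)\right)$. One has $T_0(z)=T(z)$ and $T_k(z)=z\left(\frac12T_{k-1}(z)^2+\frac12T_{k-1}(z^2)\right)$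 for $k\ge 1$. The series $S_k(z)$ satisfies $zT(z)S_k(z)+zS_k(z^2)=S_k(z)-T_k(z)$. The dominant singularity $\rho\approx 0.4026975036714$ is the (positive) radius of convergence of $T(z)$, where $T$ has a square root singularity, and $a\approx 2.8061602222420$. $\mathbb{E}$ and $\mathbb{V}$ denote expectation and variance.
   Formalization: The printed decimals 1.3124128299 (mean) and 0.2676338724 (variance) contradict the closed form, whose first three terms already exceed 1.33; they are replaced by 1.3371485381 and 0.2853544429, each with error at most 5·10^(-11). *)

theory Defs
  imports
    "HOL-Probability.Probability_Mass_Function"
    "HOL-Analysis.FPS_Convergence"
    "HOL-Library.Landau_Symbols"
begin

text \<open>
  Isomorphism classes of finite rooted trees: an unlabelled non-plane tree is determined by the
  multiset of the unlabelled non-plane trees hanging from its root.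
\<close>

datatype rtree = RNode (children: "rtree multiset")

text \<open>
  An isomorphism class has no canonical vertex set. A vertex is represented by the maximal subtree
  rooted at it, and \<open>vertex_subtrees t\<close> has exactly one entry for every vertex of \<open>t\<close>; vertices
  that are exchanged by an automorphism give equal entries, counted with multiplicity.
\<close>

primrec vertex_subtrees :: "rtree \<Rightarrow> rtree multiset" where
  "vertex_subtrees (RNode M) = add_mset (RNode M) (\<Sum>\<^sub># (image_mset vertex_subtrees M))"

definition internal_subtrees :: "rtree \<Rightarrow> rtree multiset" where
  "internal_subtrees t = filter_mset (\<lambda>s. children s \<noteq> {#}) (vertex_subtrees t)"

definition binary :: "rtree \<Rightarrow> bool" where
  "binary t \<longleftrightarrow> (\<forall>s \<in># vertex_subtrees t. size (children s) = 0 \<or> size (children s) = 2)"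

definition binary_trees :: "nat \<Rightarrow> rtree set" where
  "binary_trees n = {t. binary t \<and> size (internal_subtrees t) = n}"

inductive root_leaf_path :: "rtree \<Rightarrow> nat \<Rightarrow> bool" where
  leaf: "root_leaf_path (RNode {#}) 0"
| step: "s \<in># M \<Longrightarrow> root_leaf_path s l \<Longrightarrow> root_leaf_path (RNode M) (Suc l)"

definition protection_number :: "rtree \<Rightarrow> nat" where
  "protection_number t = (LEAST l. root_leaf_path t l)"

definition num_protected :: "nat \<Rightarrow> rtree \<Rightarrow> nat" where
  "num_protected k t = size (filter_mset (\<lambda>s. k \<le> protection_number s) (vertex_subtrees t))"

text \<open>The generating functions are needed both at real points and near a complex singularity.\<close>

definition gf_T :: "'a :: semiring_1 fps" where
  "gf_T = Abs_fps (\<lambda>n. of_nat (card (binary_trees n)))"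

definition gf_Tk :: "nat \<Rightarrow> 'a :: semiring_1 fps" where
  "gf_Tk k = Abs_fps (\<lambda>n. of_nat (card {t \<in> binary_trees n. k \<le> protection_number t}))"

definition gf_Sk :: "nat \<Rightarrow> 'a :: semiring_1 fps" where
  "gf_Sk k = Abs_fps (\<lambda>n. of_nat (\<Sum>t \<in> binary_trees n. num_protected k t))"

definition rho :: real where
  "rho = real_of_ereal (fps_conv_radius (gf_T :: complex fps))"

text \<open>
  The expansion \<open>T(z) = 1/\<rho> - a sqrt (1 - z/\<rho>) + o(sqrt (1 - z/\<rho>))\<close>, for complex \<open>z\<close> tending to
  \<open>\<rho>\<close> inside the disc of convergence. There \<open>1 - z/\<rho>\<close> has positive real part, so the principal
  branch of the square root is meant. Plain asymptotic equivalence would not determine \<open>a\<close>.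
\<close>

definition square_root_expansion :: "real \<Rightarrow> bool" where
  "square_root_expansion a \<longleftrightarrow>
     (\<lambda>z. eval_fps gf_T z - (1 / of_real rho - of_real a * csqrt (1 - z / of_real rho)))
       \<in> o[at (of_real rho) within ball 0 rho](\<lambda>z. csqrt (1 - z / of_real rho))"

text \<open>
  The distribution of the protection number of a random internal vertex of a random tree of
  size \<open>n\<close>; it is meaningful for \<open>n \<ge> 1\<close> only, since a leaf has no internal vertex.
\<close>

definition Y_pmf :: "nat \<Rightarrow> nat pmf" where
  "Y_pmf n =
     bind_pmf (pmf_of_set (binary_trees n)) (\<lambda>t.
       map_pmf protection_number (pmf_of_multiset (internal_subtrees t)))"

text \<open>
  Caution: the decimals that the literature gives for the limits of mean and variance,
  1.3124128299 and 0.2676338724, do not agree with the closed form and the generating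
  functions they are attached to. These yield 1.33714853808886... and 0.28535444286691...,
  so 1.3371485381 and 0.2853544429 are the values to use at ten decimals.
\<close>

lemma binary_RNode:
  "binary (RNode {#})"
  "binary (RNode {#l, r#}) \<longleftrightarrow> binary l \<and> binary r"
  by (auto simp: binary_def)

lemma binary_iff:
  "binary t \<longleftrightarrow> t = RNode {#} \<or> (\<exists>l r. t = RNode {#l, r#} \<and> binary l \<and> binary r)"
proof
  assume t: "binary t"
  obtain M where M: "t = RNode M" by (cases t)
  with t consider "M = {#}" | "size M = 2"
    by (auto simp: binary_def)
  then show "t = RNode {#} \<or> (\<exists>l r. t = RNode {#l, r#} \<and> binary l \<and> binary r)"
  proof cases
    case 2
    then obtain l r where "M = {#l, r#}"
      by (metis One_nat_def Suc_1 size_1_singleton_mset size_eq_Suc_imp_eq_union size_add_mset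
          old.nat.inject)
    then show ?thesis using t M by (auto simp: binary_RNode)
  qed (simp add: M)
qed (auto simp: binary_RNode)

lemma size_internal_subtrees:
  "size (internal_subtrees (RNode {#})) = 0"
  "size (internal_subtrees (RNode {#l, r#})) =
     Suc (size (internal_subtrees l) + size (internal_subtrees r))"
  by (simp_all add: internal_subtrees_def)

lemma finite_binary_trees: "finite (binary_trees n)"
proof (induction n rule: less_induct)
  case (less n)
  let ?B = "\<Union>i<n. binary_trees i"
  have "binary_trees n \<subseteq> insert (RNode {#}) ((\<lambda>(l, r). RNode {#l, r#}) ` (?B \<times> ?B))"
  proof
    fix t assume "t \<in> binary_trees n"
    then have t: "binary t" "size (internal_subtrees t) = n"
      by (auto simp: binary_trees_def)
    from t(1) consider "t = RNode {#}" | l r where "t = RNode {#l, r#}" "binary l" "binary r"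
      by (subst (asm) binary_iff) blast
    then show "t \<in> insert (RNode {#}) ((\<lambda>(l, r). RNode {#l, r#}) ` (?B \<times> ?B))"
    proof cases
      case 2
      then have "l \<in> ?B" "r \<in> ?B"
        using t(2) by (auto simp: binary_trees_def size_internal_subtrees)
      then show ?thesis using 2 by auto
    qed simp
  qed
  then show ?case
    by (rule finite_subset) (use less in auto)
qed

lemma binary_trees_nonempty: "binary_trees n \<noteq> {}"
proof (induction n)
  case 0
  have "RNode {#} \<in> binary_trees 0"
    by (simp add: binary_trees_def internal_subtrees_def binary_def)
  then show ?case by blast
next
  case (Suc n)
  then obtain t where t: "t \<in> binary_trees n" by blast
  then have "RNode {#t, RNode {#}#} \<in> binary_trees (Suc n)"
    by (auto simp: binary_trees_def size_internal_subtrees binary_RNode)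
  then show ?case by blast
qed

end

theory Submission
  imports
    Defs
    "HOL-Probability.Probability"
    "HOL-Complex_Analysis.Complex_Analysis"
    "HOL-Real_Asymp.Real_Asymp"
begin

unbundle no vec_syntax

text \<open>
  The argument is an exact formula for additive functionals, followed by a comparison of coefficients.
  
  Let a toll \<open>\<phi>\<close> be summed over all vertices of a tree, and let \<open>F\<close> and \<open>P\<close> be the generating functions
  of the totals of this sum and of \<open>\<phi>\<close> over all trees of given size. A tree with an internal root is
  an unordered pair of trees, so \<open>F = P + z (T F + F(z\<^sup>2))\<close> (lemma \<open>tree_gf_additive\<close>). Hence
  \<open>F = (P + z F(z\<^sup>2)) D\<close> with \<open>D = 1 / (1 - z T)\<close>: every additive functional is the product of its own
  "toll series" and one fixed series \<open>D\<close>. Take for \<open>\<phi>\<close> the indicator of an internal vertex, the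
  protection number, and its square. The first total is \<open>n t\<^sub>n\<close>, the number of ways to choose a tree of
  size \<open>n\<close> and an internal vertex of it, and the other two divided by it are the first two moments of
  \<open>Y\<^sub>n\<close>. If the coefficients of \<open>D\<close> behave like \<open>c n\<^bsup>-1/2\<^esup> \<rho>\<^bsup>-n\<^esup>\<close> with \<open>c \<noteq> 0\<close>, and those of the toll
  series are \<open>O(n\<^bsup>-5/4\<^esup> \<rho>\<^bsup>-n\<^esup>)\<close>, then the constant \<open>c\<close> cancels and each moment tends to a quotient of two
  toll series at \<open>\<rho>\<close> (lemmas \<open>convolution_asymptotics\<close> and \<open>additive_mean_limit\<close>).
  
  The behaviour of \<open>D\<close> comes from the discriminant of the quadratic equation for \<open>T\<close>: one has
  \<open>(1 - z T(z))\<^sup>2 = Q(z)\<close> with \<open>Q(z) = 1 - 2 z - z\<^sup>2 T(z\<^sup>2)\<close>, which is analytic in the larger disc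
  \<open>|z| < sqrt \<rho>\<close>. Real arguments give \<open>Q(\<rho>) = 0\<close>, that is \<open>\<rho> T(\<rho>) = 1\<close>; because all coefficients of \<open>T\<close> are
  positive there is no other zero in the closed disc of radius \<open>\<rho>\<close>, and the zero is simple. So
  \<open>Q = (1 - z/\<rho>) R\<close> with \<open>R\<close> free of zeros on a larger disc, and \<open>D = (1 - z/\<rho>)\<^bsup>-1/2\<^esup> R\<^bsup>-1/2\<^esup>\<close>, where the
  second factor has exponentially smaller coefficients. The same factorization gives the square root
  expansion with \<open>a = sqrt (R(\<rho>)) / \<rho>\<close>, and \<open>Q(\<rho>) = 0\<close> turns \<open>a\<^sup>2 \<rho> / 2\<close> into the toll series of the
  internal vertices at \<open>\<rho>\<close> (lemma \<open>protected_weight_1\<close>). A toll that depends on the protection number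
  only is a sum over the levels \<open>k\<close> of indicators of \<open>k\<close>-protection, and the toll series of such an
  indicator at \<open>\<rho>\<close> is \<open>T\<^sub>k(\<rho>) + \<rho> S\<^sub>k(\<rho>\<^sup>2)\<close>; this yields the closed form.
  
  For the decimals, the functional equations express the values of \<open>T\<close>, \<open>T\<^sub>k\<close> and \<open>S\<^sub>k\<close> at \<open>x\<close> by those at
  \<open>x\<^sup>2\<close>. Starting from crude bounds at a high power \<open>\<rho>^(2^i)\<close>, where all these series almost equal their
  constant terms,
  rational enclosures are carried up to \<open>\<rho>\<close>. The levels \<open>k \<ge> 6\<close> contribute almost nothing, since
  \<open>T\<^bsub>k+1\<^esub>(\<rho>) \<le> T\<^sub>k(\<rho>)\<^sup>2\<close>.
\<close>

abbreviation tree_size :: "rtree \<Rightarrow> nat" where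
  "tree_size t \<equiv> size (internal_subtrees t)"

section \<open>Protection numbers of binary trees\<close>

lemma binary_induct [consumes 1, case_names leaf node]:
  assumes "binary t"
    and "P (RNode {#})"
    and "\<And>l r. binary l \<Longrightarrow> binary r \<Longrightarrow> P l \<Longrightarrow> P r \<Longrightarrow> P (RNode {#l, r#})"
  shows "P t"
  using assms(1)
proof (induction "tree_size t" arbitrary: t rule: less_induct)
  case less
  from less.prems consider "t = RNode {#}" | l r where "t = RNode {#l, r#}" "binary l" "binary r"
    by (subst (asm) binary_iff) blast
  then show ?case
    by cases (use assms less.hyps in \<open>auto simp: size_internal_subtrees\<close>)
qed

lemma root_leaf_path_leaf_iff [simp]: "root_leaf_path (RNode {#}) n \<longleftrightarrow> n = 0"
  by (subst root_leaf_path.simps) auto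

lemma root_leaf_path_node_iff [simp]:
  "root_leaf_path (RNode {#l, r#}) n \<longleftrightarrow>
     (\<exists>m. n = Suc m \<and> (root_leaf_path l m \<or> root_leaf_path r m))"
  by (subst root_leaf_path.simps) auto

lemma protection_number_leaf [simp]: "protection_number (RNode {#}) = 0"
  by (simp add: protection_number_def)

lemma root_leaf_path_exists: "\<exists>n. root_leaf_path t n"
proof (induction t)
  case (RNode M)
  show ?case
  proof (cases "M = {#}")
    case True
    then show ?thesis by (auto intro: root_leaf_path.leaf)
  next
    case False
    then obtain s where "s \<in># M" by auto
    with RNode show ?thesis by (blast intro: root_leaf_path.step)
  qed
qed

lemma protection_number_node [simp]:
  "protection_number (RNode {#l, r#}) = Suc (min (protection_number l) (protection_number r))"
  unfolding protection_number_def[of "RNode {#l, r#}"]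
proof (rule Least_equality)
  have "root_leaf_path t (protection_number t)" for t
    unfolding protection_number_def using root_leaf_path_exists by (rule LeastI_ex)
  then show "root_leaf_path (RNode {#l, r#})
      (Suc (min (protection_number l) (protection_number r)))"
    by (auto simp: min_def)
  have "protection_number t \<le> m" if "root_leaf_path t m" for t m
    unfolding protection_number_def using that by (rule Least_le)
  then show "Suc (min (protection_number l) (protection_number r)) \<le> n"
    if "root_leaf_path (RNode {#l, r#}) n" for n
    using that by (fastforce simp: min_le_iff_disj)
qed

text \<open>
  A tree whose leaves all have depth at least \<open>k\<close> contains the complete binary tree of height \<open>k\<close>.
  This logarithmic bound is what makes the protection number and its square admissible tolls.
\<close>

lemma two_power_protection_number_le:
  "binary t \<Longrightarrow> 2 ^ protection_number t \<le> Suc (tree_size t)"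
proof (induction t rule: binary_induct)
  case (node l r)
  have "(2::nat) ^ min a b \<le> 2 ^ a" "(2::nat) ^ min a b \<le> 2 ^ b" for a b
    by (intro power_increasing; simp)+
  from this[of "protection_number l" "protection_number r"] node.IH show ?case
    unfolding protection_number_node size_internal_subtrees power_Suc by linarith
qed simp

definition additive :: "(rtree \<Rightarrow> 'a) \<Rightarrow> rtree \<Rightarrow> 'a :: comm_monoid_add" where
  "additive \<phi> t = (\<Sum>s\<in>#vertex_subtrees t. \<phi> s)"

lemma additive_leaf: "additive \<phi> (RNode {#}) = \<phi> (RNode {#})"
  and additive_node: "additive \<phi> (RNode {#l, r#}) = \<phi> (RNode {#l, r#}) + (additive \<phi> l + additive \<phi> r)"
  by (simp_all add: additive_def)

lemma of_nat_size_filter_mset: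
  "(of_nat (size (filter_mset P M)) :: 'a :: semiring_1) = (\<Sum>s\<in>#M. of_bool (P s))"
  by (induction M) auto

lemma binary_vertex_subtrees: "binary t \<Longrightarrow> s \<in># vertex_subtrees t \<Longrightarrow> binary s"
  by (induction t rule: binary_induct) (auto simp: binary_RNode)

text \<open>
  Choosing an internal vertex is the same as choosing a 1-protected one, so the normalization of
  the random vertex is itself an additive functional of the kind studied here.
\<close>

lemma children_nonempty_iff: "binary s \<Longrightarrow> children s \<noteq> {#} \<longleftrightarrow> 1 \<le> protection_number s"
  by (subst (asm) binary_iff) auto

lemma of_nat_num_protected:
  "of_nat (num_protected k t) = additive (\<lambda>s. of_bool (k \<le> protection_number s)) t"
  unfolding num_protected_def additive_def by (rule of_nat_size_filter_mset)

lemma num_protected_1: "binary t \<Longrightarrow> num_protected 1 t = tree_size t"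
  unfolding num_protected_def internal_subtrees_def
  by (rule arg_cong[where f = size], rule filter_mset_cong)
     (auto simp: children_nonempty_iff binary_vertex_subtrees)

lemma binary_trees_0: "binary_trees 0 = {RNode {#}}"
proof -
  have "t = RNode {#}" if "binary t" "tree_size t = 0" for t
  proof -
    from that(1) have "t = RNode {#} \<or> (\<exists>l r. t = RNode {#l, r#} \<and> binary l \<and> binary r)"
      by (subst (asm) binary_iff)
    with that(2) show ?thesis by (metis size_internal_subtrees(2) old.nat.distinct(2))
  qed
  then show ?thesis
    unfolding binary_trees_def using binary_RNode(1) size_internal_subtrees(1) by blast
qed

section \<open>Generating functions of tolls and their totals\<close>

lemma pair_mset_eq_iff: "{#a, b#} = {#c, d#} \<longleftrightarrow> a = c \<and> b = d \<or> a = d \<and> b = c"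
  by (auto simp: add_eq_conv_ex)

text \<open>
  An unordered pair of trees comes from two ordered pairs if the trees differ and from one if they
  agree. Counting ordered pairs and adding the pairs of twins therefore counts everything twice.
\<close>

lemma sum_binary_trees_Suc:
  fixes g :: "rtree \<Rightarrow> 'a :: comm_ring_1"
  shows "2 * (\<Sum>t\<in>binary_trees (Suc n). g t) =
    (\<Sum>i\<le>n. \<Sum>l\<in>binary_trees i. \<Sum>r\<in>binary_trees (n - i). g (RNode {#l, r#})) +
    (if even n then \<Sum>l\<in>binary_trees (n div 2). g (RNode {#l, l#}) else 0)"
proof -
  define pairs where "pairs = (\<Union>i\<le>n. binary_trees i \<times> binary_trees (n - i))"
  define join where "join = (\<lambda>(l, r). RNode {#l, r#})"
  define twins where "twins = (if even n then (\<lambda>l. RNode {#l, l#}) ` binary_trees (n div 2) else {})"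
  have fin: "finite pairs" unfolding pairs_def by (auto simp: finite_binary_trees)
  have pairs_iff: "(l, r) \<in> pairs \<longleftrightarrow> binary l \<and> binary r \<and> tree_size l + tree_size r = n" for l r
    unfolding pairs_def binary_trees_def by auto
  have twins_iff: "RNode {#l, r#} \<in> twins \<longleftrightarrow> l = r \<and> (l, r) \<in> pairs" for l r
    unfolding twins_def pairs_iff by (auto simp: binary_trees_def pair_mset_eq_iff elim!: evenE)
  have image: "join ` pairs = binary_trees (Suc n)"
  proof (intro equalityI subsetI)
    fix t assume "t \<in> join ` pairs"
    then show "t \<in> binary_trees (Suc n)"
      by (auto simp: join_def pairs_iff binary_trees_def size_internal_subtrees binary_RNode)
  next
    fix t assume "t \<in> binary_trees (Suc n)"
    then have t: "binary t" "tree_size t = Suc n" by (auto simp: binary_trees_def)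
    from t(1) have "t = RNode {#} \<or> (\<exists>l r. t = RNode {#l, r#} \<and> binary l \<and> binary r)"
      by (subst (asm) binary_iff)
    then obtain l r where lr: "t = RNode {#l, r#}" "binary l" "binary r"
      using t(2) by (auto simp: size_internal_subtrees)
    then have "(l, r) \<in> pairs" using t(2) by (simp add: pairs_iff size_internal_subtrees)
    then show "t \<in> join ` pairs" using lr(1) by (force simp: join_def)
  qed
  (* a fibre of the joining map and its twin together always count 2 *)
  have fibre: "of_nat (card {p \<in> pairs. join p = t}) + of_bool (t \<in> twins) = (2 :: 'a)"
    if "t \<in> binary_trees (Suc n)" for t
  proof -
    from that have "t \<in> join ` pairs" by (simp only: image)
    then obtain p where "p \<in> pairs" "t = join p" by blast
    then obtain l r where lr: "(l, r) \<in> pairs" "t = RNode {#l, r#}"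
      by (cases p) (simp add: join_def)
    then have "{p \<in> pairs. join p = t} = {(l, r), (r, l)}"
      by (auto simp: join_def pairs_iff pair_mset_eq_iff)
    then show ?thesis using lr by (auto simp: twins_iff)
  qed
  have "(\<Sum>i\<le>n. \<Sum>l\<in>binary_trees i. \<Sum>r\<in>binary_trees (n - i). g (RNode {#l, r#})) =
        (\<Sum>p\<in>pairs. g (join p))"
  proof -
    have "(\<Sum>p\<in>pairs. g (join p)) =
        (\<Sum>i\<le>n. \<Sum>p\<in>binary_trees i \<times> binary_trees (n - i). g (join p))"
      unfolding pairs_def
    proof (rule sum.UNION_disjoint)
      show "\<forall>i\<in>{..n}. \<forall>j\<in>{..n}. i \<noteq> j \<longrightarrow>
          binary_trees i \<times> binary_trees (n - i) \<inter> binary_trees j \<times> binary_trees (n - j) = {}"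
        by (auto simp: binary_trees_def)
    qed (simp_all add: finite_binary_trees)
    then show ?thesis by (simp add: join_def sum.cartesian_product case_prod_unfold)
  qed
  also have "\<dots> = (\<Sum>t\<in>binary_trees (Suc n). \<Sum>p\<in>{p \<in> pairs. join p = t}. g (join p))"
    using sum.image_gen[OF fin, of "\<lambda>p. g (join p)" join] unfolding image .
  also have "\<dots> = (\<Sum>t\<in>binary_trees (Suc n). of_nat (card {p \<in> pairs. join p = t}) * g t)"
    by (intro sum.cong refl) simp
  finally have 1: "(\<Sum>i\<le>n. \<Sum>l\<in>binary_trees i. \<Sum>r\<in>binary_trees (n - i). g (RNode {#l, r#})) =
      (\<Sum>t\<in>binary_trees (Suc n). of_nat (card {p \<in> pairs. join p = t}) * g t)" .
  have "(if even n then \<Sum>l\<in>binary_trees (n div 2). g (RNode {#l, l#}) else 0) = (\<Sum>t\<in>twins. g t)"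
    unfolding twins_def by (auto simp: sum.reindex inj_on_def pair_mset_eq_iff)
  also have "\<dots> = (\<Sum>t\<in>binary_trees (Suc n). of_bool (t \<in> twins) * g t)"
  proof -
    have "twins \<subseteq> binary_trees (Suc n)"
      by (auto simp: twins_def binary_trees_def size_internal_subtrees binary_RNode)
    then show ?thesis
      by (intro sum.mono_neutral_cong_left) (auto simp: finite_binary_trees)
  qed
  finally have 2: "(if even n then \<Sum>l\<in>binary_trees (n div 2). g (RNode {#l, l#}) else 0) =
      (\<Sum>t\<in>binary_trees (Suc n). of_bool (t \<in> twins) * g t)" .
  show ?thesis
    unfolding 1 2 sum.distrib[symmetric] distrib_right[symmetric] sum_distrib_left
    by (intro sum.cong refl) (simp add: fibre)
qed

definition tree_gf :: "(rtree \<Rightarrow> 'a :: comm_ring_1) \<Rightarrow> 'a fps" where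
  "tree_gf g = Abs_fps (\<lambda>n. \<Sum>t\<in>binary_trees n. g t)"

lemma tree_gf_nth: "tree_gf g $ n = (\<Sum>t\<in>binary_trees n. g t)"
  by (simp add: tree_gf_def)

lemma gf_T_eq: "gf_T = tree_gf (\<lambda>_. 1 :: 'a :: comm_ring_1)"
  by (simp add: gf_T_def tree_gf_def)

lemma gf_Tk_eq: "gf_Tk k = tree_gf (\<lambda>t. of_bool (k \<le> protection_number t) :: 'a :: comm_ring_1)"
  by (simp add: gf_Tk_def tree_gf_def fps_eq_iff finite_binary_trees of_bool_def flip: sum.inter_filter)

lemma gf_Sk_eq:
  "gf_Sk k = tree_gf (additive (\<lambda>t. of_bool (k \<le> protection_number t) :: 'a :: comm_ring_1))"
  unfolding gf_Sk_def tree_gf_def of_nat_sum of_nat_num_protected ..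

lemma tree_gf_mult_nth:
  "(tree_gf f * tree_gf g) $ n =
     (\<Sum>i\<le>n. \<Sum>l\<in>binary_trees i. \<Sum>r\<in>binary_trees (n - i). f l * g r)"
  by (simp add: fps_mult_nth tree_gf_nth sum_product atLeast0AtMost)

text \<open>
  The symbolic form of the preceding count: the first series collects the ordered pairs of subtrees
  of the root, and substituting \<open>z\<^sup>2\<close> into the second one collects the pairs of twins.
\<close>

lemma tree_gf_eqI:
  assumes "\<And>n. h $ n = (\<Sum>i\<le>n. \<Sum>l\<in>binary_trees i. \<Sum>r\<in>binary_trees (n - i). g (RNode {#l, r#}))"
    and "\<And>n. d $ n = (\<Sum>l\<in>binary_trees n. g (RNode {#l, l#}))"
  shows "2 * tree_gf g = 2 * fps_const (g (RNode {#})) + fps_X * (h + (d oo fps_X ^ 2))"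
proof (rule fps_ext)
  fix n
  show "(2 * tree_gf g) $ n = (2 * fps_const (g (RNode {#})) + fps_X * (h + (d oo fps_X ^ 2))) $ n"
  proof (cases n)
    case (Suc m)
    have "(2 * tree_gf g) $ n = 2 * (\<Sum>t\<in>binary_trees (Suc m). g t)"
      by (simp add: Suc tree_gf_nth numeral_fps_const)
    also have "\<dots> = h $ m + (if even m then d $ (m div 2) else 0)"
      unfolding sum_binary_trees_Suc assms ..
    finally show ?thesis by (simp add: Suc fps_nth_compose_X_power numeral_fps_const)
  qed (simp add: tree_gf_nth binary_trees_0 numeral_fps_const)
qed

lemma gf_T_rec: "2 * gf_T = 2 + fps_X * (gf_T ^ 2 + (gf_T oo fps_X ^ 2) :: 'a :: comm_ring_1 fps)"
proof -
  have "2 * tree_gf (\<lambda>_. 1 :: 'a) =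
    2 * fps_const 1 + fps_X * (gf_T ^ 2 + (gf_T oo fps_X ^ 2))"
    unfolding gf_T_eq
    by (rule tree_gf_eqI) (simp_all only: power2_eq_square tree_gf_mult_nth tree_gf_nth mult_1)
  then show ?thesis by (simp add: gf_T_eq)
qed

lemma gf_Tk_0: "gf_Tk 0 = gf_T"
  by (simp add: gf_Tk_def gf_T_def)

text \<open>
  The root is \<open>k + 1\<close>-protected if and only if both subtrees have a \<open>k\<close>-protected root, so the
  indicator is multiplicative over the pair.
\<close>

lemma gf_Tk_Suc:
  "2 * gf_Tk (Suc k) = fps_X * (gf_Tk k ^ 2 + (gf_Tk k oo fps_X ^ 2) :: 'a :: comm_ring_1 fps)"
proof -
  have "2 * tree_gf (\<lambda>t. of_bool (Suc k \<le> protection_number t) :: 'a) =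
    2 * fps_const 0 + fps_X * (gf_Tk k ^ 2 + (gf_Tk k oo fps_X ^ 2))"
    unfolding gf_Tk_eq
    using tree_gf_eqI[where g = "\<lambda>t. of_bool (Suc k \<le> protection_number t) :: 'a"
        and h = "tree_gf (\<lambda>t. of_bool (k \<le> protection_number t)) ^ 2"
        and d = "tree_gf (\<lambda>t. of_bool (k \<le> protection_number t))"]
    by (simp add: power2_eq_square tree_gf_mult_nth tree_gf_nth of_bool_conj)
  then show ?thesis by (simp add: gf_Tk_eq)
qed

text \<open>
  An additive functional minus its toll at the root is the sum of its values at the two subtrees of
  the root. Summed over ordered pairs this gives \<open>2 T F\<close>, and over twins \<open>2 F(z\<^sup>2)\<close>.
\<close>

lemma tree_gf_additive:
  fixes \<phi> :: "rtree \<Rightarrow> 'a :: field_char_0"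
  defines "F \<equiv> tree_gf (additive \<phi>)"
  shows "F = tree_gf \<phi> + fps_X * (gf_T * F + (F oo fps_X ^ 2))"
proof -
  have "2 * tree_gf (\<lambda>t. additive \<phi> t - \<phi> t) =
    2 * fps_const (additive \<phi> (RNode {#}) - \<phi> (RNode {#})) +
    fps_X * (2 * (gf_T * F) + (fps_const 2 * F oo fps_X ^ 2))"
  proof (rule tree_gf_eqI)
    fix n
    show "(2 * (gf_T * F)) $ n = (\<Sum>i\<le>n. \<Sum>l\<in>binary_trees i. \<Sum>r\<in>binary_trees (n - i).
        additive \<phi> (RNode {#l, r#}) - \<phi> (RNode {#l, r#}))"
    proof -
      have "(2 * (gf_T * F)) $ n = (tree_gf (\<lambda>_. 1) * tree_gf (additive \<phi>)) $ n +
          (tree_gf (additive \<phi>) * tree_gf (\<lambda>_. 1)) $ n"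
        by (simp only: gf_T_eq F_def mult_2 fps_add_nth mult.commute)
      also have "\<dots> = (\<Sum>i\<le>n. \<Sum>l\<in>binary_trees i. \<Sum>r\<in>binary_trees (n - i).
          1 * additive \<phi> r + additive \<phi> l * 1)"
        by (simp only: tree_gf_mult_nth sum.distrib)
      also have "\<dots> = (\<Sum>i\<le>n. \<Sum>l\<in>binary_trees i. \<Sum>r\<in>binary_trees (n - i).
          additive \<phi> (RNode {#l, r#}) - \<phi> (RNode {#l, r#}))"
        by (intro sum.cong refl) (simp add: additive_node)
      finally show ?thesis .
    qed
  qed (simp add: F_def tree_gf_nth additive_node sum_distrib_left)
  also have "fps_const 2 * F oo fps_X ^ 2 = 2 * (F oo fps_X ^ 2)"
    by (simp add: fps_eq_iff fps_nth_compose_X_power numeral_fps_const)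
  finally have "2 * tree_gf (\<lambda>t. additive \<phi> t - \<phi> t) =
      2 * (fps_X * (gf_T * F + (F oo fps_X ^ 2)))"
    by (simp add: additive_leaf algebra_simps)
  moreover have "tree_gf (\<lambda>t. additive \<phi> t - \<phi> t) = F - tree_gf \<phi>"
    by (simp add: F_def tree_gf_def fps_eq_iff sum_subtractf)
  ultimately have "2 * (F - tree_gf \<phi>) = 2 * (fps_X * (gf_T * F + (F oo fps_X ^ 2)))"
    by simp
  then have "F - tree_gf \<phi> = fps_X * (gf_T * F + (F oo fps_X ^ 2))"
    by (subst (asm) mult_cancel_left) (simp add: numeral_fps_const)
  then show ?thesis by (simp add: diff_eq_eq add.commute)
qed

section \<open>Power series at points of absolute convergence\<close>

lemma fps_mult_nth_power:
  fixes f g :: "'a :: comm_ring_1 fps"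
  shows "(f * g) $ n * x ^ n = (\<Sum>i\<le>n. (f $ i * x ^ i) * (g $ (n - i) * x ^ (n - i)))"
  unfolding fps_mult_nth sum_distrib_right atLeast0AtMost
proof (intro sum.cong refl)
  fix i assume "i \<in> {..n}"
  then have "x ^ n = x ^ i * x ^ (n - i)" by (simp flip: power_add)
  then show "f $ i * g $ (n - i) * x ^ n = (f $ i * x ^ i) * (g $ (n - i) * x ^ (n - i))"
    by (simp add: mult_ac)
qed
text \<open>
  The product rule below is needed at \<open>\<rho>\<close> itself, on the boundary of the disc of convergence. Absolute
  convergence at the point replaces the usual condition on the radius.
\<close>

definition abs_conv :: "'a :: {banach, real_normed_field} fps \<Rightarrow> 'a \<Rightarrow> bool" where
  "abs_conv f z \<longleftrightarrow> summable (\<lambda>n. norm (f $ n * z ^ n))"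

lemma abs_conv_sums: "abs_conv f z \<Longrightarrow> (\<lambda>n. f $ n * z ^ n) sums eval_fps f z"
  unfolding abs_conv_def eval_fps_def by (rule summable_sums, rule summable_norm_cancel)

lemma abs_convI: "ereal (norm z) < fps_conv_radius f \<Longrightarrow> abs_conv f z"
  unfolding abs_conv_def by (rule norm_summable_fps)

lemma abs_conv_mono:
  assumes "abs_conv f z" "norm w \<le> norm z"
  shows "abs_conv f w"
  unfolding abs_conv_def
  by (rule summable_comparison_test'[OF assms(1)[unfolded abs_conv_def], of 0])
     (use assms(2) in \<open>auto simp: norm_mult norm_power intro!: mult_left_mono power_mono\<close>)

lemma abs_conv_add: "abs_conv f z \<Longrightarrow> abs_conv g z \<Longrightarrow> abs_conv (f + g) z"
  unfolding abs_conv_def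
  by (rule summable_comparison_test'[of "\<lambda>n. norm (f $ n * z ^ n) + norm (g $ n * z ^ n)" 0])
     (auto intro: summable_add simp: distrib_right norm_triangle_ineq)

lemma eval_fps_add':
  assumes "abs_conv f z" "abs_conv g z"
  shows "eval_fps (f + g) z = eval_fps f z + eval_fps g z"
  using sums_unique[OF sums_add[OF assms[THEN abs_conv_sums]]]
  by (simp add: eval_fps_def distrib_right)

lemma abs_conv_mult: "abs_conv f z \<Longrightarrow> abs_conv g z \<Longrightarrow> abs_conv (f * g) z"
  and eval_fps_mult':
    "abs_conv f z \<Longrightarrow> abs_conv g z \<Longrightarrow> eval_fps (f * g) z = eval_fps f z * eval_fps g z"
proof -
  assume *: "abs_conv f z" "abs_conv g z"
  note ** = *[unfolded abs_conv_def]
  note coeff = fps_mult_nth_power[of f g _ z]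
  have "summable (\<lambda>n. \<Sum>i\<le>n. norm (f $ i * z ^ i) * norm (g $ (n - i) * z ^ (n - i)))"
    using summable_Cauchy_product[of "\<lambda>n. norm (f $ n * z ^ n)" "\<lambda>n. norm (g $ n * z ^ n)"] ** by simp
  then show "abs_conv (f * g) z"
    unfolding abs_conv_def coeff
    by (rule summable_comparison_test'[of _ 0])
       (auto simp flip: norm_mult intro!: norm_sum order.trans[OF norm_sum] sum_mono)
  show "eval_fps (f * g) z = eval_fps f z * eval_fps g z"
    using Cauchy_product[OF **] unfolding eval_fps_def coeff ..
qed

lemma abs_conv_const [simp]: "abs_conv (fps_const c) z"
  by (rule abs_convI) simp

lemma abs_conv_X [simp]: "abs_conv fps_X z"
  by (rule abs_convI) simp

lemma abs_conv_numeral [simp]: "abs_conv (numeral n) z"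
  by (simp add: numeral_fps_const)

lemma abs_conv_1 [simp]: "abs_conv 1 z"
  by (rule abs_convI) simp

lemma abs_conv_compose_square: "abs_conv f (z ^ 2) \<Longrightarrow> abs_conv (f oo fps_X ^ 2) z"
  and eval_fps_compose_square:
    "abs_conv f (z ^ 2) \<Longrightarrow> eval_fps (f oo fps_X ^ 2) z = eval_fps f (z ^ 2)"
proof -
  assume *: "abs_conv f (z ^ 2)"
  let ?g = "\<lambda>n. (f oo fps_X ^ 2) $ n * z ^ n"
  have mono: "strict_mono (\<lambda>n::nat. 2 * n)" by (auto intro: strict_monoI)
  have zero: "?g n = 0" if "n \<notin> range ((*) 2)" for n
    using that by (auto simp: fps_nth_compose_X_power)
  have even: "?g (2 * n) = f $ n * (z ^ 2) ^ n" for n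
    by (simp add: fps_nth_compose_X_power power_mult)
  show "abs_conv (f oo fps_X ^ 2) z"
    using * unfolding abs_conv_def
    by (subst summable_mono_reindex[OF mono, symmetric])
       (simp_all only: even zero norm_zero not_False_eq_True)
  have "?g sums eval_fps f (z ^ 2)"
    using abs_conv_sums[OF *]
    by (subst sums_mono_reindex[OF mono, symmetric]) (simp_all only: even zero not_False_eq_True)
  then show "eval_fps (f oo fps_X ^ 2) z = eval_fps f (z ^ 2)"
    unfolding eval_fps_def by (rule sums_unique[symmetric])
qed

lemma eval_fps_of_real:
  fixes g :: "complex fps"
  assumes "\<And>n. g $ n = of_real (f $ n)" "abs_conv f x"
  shows "abs_conv g (of_real x)" "eval_fps g (of_real x) = of_real (eval_fps f x)"
proof -
  have *: "g $ n * of_real x ^ n = of_real (f $ n * x ^ n)" for n by (simp add: assms(1))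
  show "abs_conv g (of_real x)"
    using assms(2) unfolding abs_conv_def * norm_of_real real_norm_def .
  show "eval_fps g (of_real x) = of_real (eval_fps f x)"
    unfolding eval_fps_def *
    by (rule suminf_of_real[symmetric])
       (use abs_conv_sums[OF assms(2)] in \<open>auto simp: sums_iff\<close>)
qed

section \<open>Convolutions with sequences of order \<open>n\<^bsup>-1/2\<^esup>\<close>\<close>

lemma sum_inverse_sqrt_le: "(\<Sum>i\<le>n. 1 / sqrt (real i + 1)) \<le> 2 * sqrt (real n + 1)"
proof (induction n)
  case (Suc n)
  define s t where "s = sqrt (real n + 1)" and "t = sqrt (real n + 2)"
  have st: "0 < s" "s \<le> t" "t\<^sup>2 - s\<^sup>2 = 1" by (auto simp: s_def t_def)
  then have "1 = (t - s) * (t + s)" by (simp add: power2_eq_square algebra_simps)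
  also have "\<dots> \<le> (t - s) * (2 * t)" using st by (intro mult_left_mono) auto
  finally have "1 / t \<le> 2 * (t - s)" using st by (simp add: field_simps)
  then show ?case using Suc.IH by (simp add: s_def t_def add_ac)
qed simp

text \<open>
  The two halves of a convolution are treated separately: for the large indices only the size of
  \<open>v\<close> matters, because the sum of \<open>n\<^bsup>-1/2\<^esup>\<close> is of order \<open>n\<^bsup>1/2\<^esup>\<close>; for the small ones \<open>u (n - i)\<close> is
  comparable with \<open>u n\<close>.
\<close>

lemma convolution_upper_half_bound:
  fixes u v :: "nat \<Rightarrow> 'a :: real_normed_field"
  assumes u: "\<And>n. norm (u n) \<le> K / sqrt (real n + 1)"
    and v: "\<And>i. i \<le> n \<Longrightarrow> n < 2 * i \<Longrightarrow> norm (v i) \<le> B" and B: "0 \<le> B"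
  shows "norm (\<Sum>i\<in>{i. i \<le> n \<and> n < 2 * i}. v i * u (n - i)) \<le> 2 * B * K * sqrt (real n + 1)"
proof -
  have K: "0 \<le> K" using order.trans[OF norm_ge_zero u[of 0]] by simp
  have "norm (\<Sum>i\<in>{i. i \<le> n \<and> n < 2 * i}. v i * u (n - i)) \<le>
      (\<Sum>i\<in>{i. i \<le> n \<and> n < 2 * i}. B * (K / sqrt (real (n - i) + 1)))"
  proof (rule order.trans[OF norm_sum], rule sum_mono)
    fix i assume "i \<in> {i. i \<le> n \<and> n < 2 * i}"
    then show "norm (v i * u (n - i)) \<le> B * (K / sqrt (real (n - i) + 1))"
      unfolding norm_mult by (intro mult_mono v u B) auto
  qed
  also have "\<dots> \<le> (\<Sum>i\<le>n. B * (K / sqrt (real (n - i) + 1)))"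
    by (rule sum_mono2) (auto simp: B K)
  also have "\<dots> = (\<Sum>i\<le>n. B * (K / sqrt (real i + 1)))"
    by (rule sum.reindex_bij_witness[of _ "\<lambda>i. n - i" "\<lambda>i. n - i"]) auto
  also have "\<dots> = B * K * (\<Sum>i\<le>n. 1 / sqrt (real i + 1))"
    by (simp add: sum_distrib_left)
  also have "\<dots> \<le> B * K * (2 * sqrt (real n + 1))"
    by (intro mult_left_mono sum_inverse_sqrt_le) (auto simp: B K)
  finally show ?thesis by (simp add: mult_ac)
qed

lemma convolution_lower_half_bound:
  fixes u :: "nat \<Rightarrow> 'a :: real_normed_field"
  assumes u: "\<And>n. norm (u n) \<le> K / sqrt (real n + 1)" and "2 * i \<le> n"
  shows "norm (u (n - i)) \<le> 2 * K / sqrt (real n + 1)"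
proof -
  have K: "0 \<le> K" using order.trans[OF norm_ge_zero u[of 0]] by simp
  have "real n + 1 \<le> 4 * (real (n - i) + 1)" using assms(2) by (simp add: of_nat_diff)
  then have "sqrt (real n + 1) \<le> sqrt (4 * (real (n - i) + 1))" by (rule real_sqrt_le_mono)
  then have "sqrt (real n + 1) \<le> 2 * sqrt (real (n - i) + 1)" unfolding real_sqrt_mult by simp
  from mult_left_mono[OF this K] have "K / sqrt (real (n - i) + 1) \<le> 2 * K / sqrt (real n + 1)"
    by (simp add: field_simps)
  then show ?thesis using u[of "n - i"] by simp
qed

text \<open>
  A bound \<open>O(1/n)\<close> on one factor still suffices for the order \<open>n\<^bsup>-1/2\<^esup>\<close> of the convolution. This
  weaker version serves to bootstrap the decay of the coefficients of \<open>T\<close>.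
\<close>

lemma convolution_bound:
  fixes u v :: "nat \<Rightarrow> 'a :: real_normed_field"
  assumes u: "\<And>n. norm (u n) \<le> K / sqrt (real n + 1)"
    and v: "\<And>n. norm (v n) \<le> C / (real n + 1)" and sm: "summable (\<lambda>n. norm (v n))"
  obtains M where "\<And>n. norm (\<Sum>i\<le>n. v i * u (n - i)) \<le> M / sqrt (real n + 1)"
proof
  fix n
  have K: "0 \<le> K" using order.trans[OF norm_ge_zero u[of 0]] by simp
  have C: "0 \<le> C" using order.trans[OF norm_ge_zero v[of 0]] by simp
  let ?s = "sqrt (real n + 1)"
  have "(\<Sum>i\<le>n. v i * u (n - i)) =
      (\<Sum>i\<in>{i. i \<le> n \<and> 2 * i \<le> n}. v i * u (n - i)) + (\<Sum>i\<in>{i. i \<le> n \<and> n < 2 * i}. v i * u (n - i))"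
    by (subst sum.union_disjoint[symmetric]) (auto intro!: sum.cong)
  also have "norm \<dots> \<le> (\<Sum>n. norm (v n)) * (2 * K / ?s) + 2 * (2 * C / (real n + 1)) * K * ?s"
  proof (rule norm_triangle_le, rule add_mono)
    have "norm (\<Sum>i\<in>{i. i \<le> n \<and> 2 * i \<le> n}. v i * u (n - i)) \<le>
        (\<Sum>i\<in>{i. i \<le> n \<and> 2 * i \<le> n}. norm (v i) * (2 * K / ?s))"
    proof (rule order.trans[OF norm_sum], rule sum_mono)
      fix i assume "i \<in> {i. i \<le> n \<and> 2 * i \<le> n}"
      then show "norm (v i * u (n - i)) \<le> norm (v i) * (2 * K / ?s)"
        unfolding norm_mult by (intro mult_left_mono convolution_lower_half_bound[OF u]) auto
    qed
    also have "\<dots> = (\<Sum>i\<in>{i. i \<le> n \<and> 2 * i \<le> n}. norm (v i)) * (2 * K / ?s)"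
      by (rule sum_distrib_right[symmetric])
    also have "\<dots> \<le> (\<Sum>n. norm (v n)) * (2 * K / ?s)"
      using K by (intro mult_right_mono sum_le_suminf sm) auto
    finally show "norm (\<Sum>i\<in>{i. i \<le> n \<and> 2 * i \<le> n}. v i * u (n - i)) \<le>
        (\<Sum>n. norm (v n)) * (2 * K / ?s)" .
    show "norm (\<Sum>i\<in>{i. i \<le> n \<and> n < 2 * i}. v i * u (n - i)) \<le> 2 * (2 * C / (real n + 1)) * K * ?s"
    proof (rule convolution_upper_half_bound[OF u])
      fix i assume i: "i \<le> n" "n < 2 * i"
      have "C / (real i + 1) \<le> 2 * C / (real n + 1)"
        using C i mult_left_mono[of "real n + 1" "2 * (real i + 1)" C] by (simp add: field_simps)
      then show "norm (v i) \<le> 2 * C / (real n + 1)" using v[of i] by simp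
    qed (use C in auto)
  qed
  also have "2 * (2 * C / (real n + 1)) * K * ?s = 4 * C * K / ?s"
    by (simp add: field_simps)
  finally show "norm (\<Sum>i\<le>n. v i * u (n - i)) \<le> ((\<Sum>n. norm (v n)) * 2 * K + 4 * C * K) / ?s"
    by (simp add: add_divide_distrib mult_ac)
qed

text \<open>
  The sequence \<open>u\<close> varies regularly with exponent \<open>-1/2\<close>, so \<open>u (n - i)\<close> is asymptotic to \<open>u n\<close> for
  fixed \<open>i\<close>, and dominated convergence applies to the lower half of the convolution. The upper half is
  negligible, because \<open>n\<^bsup>1/2\<^esup> n\<^bsup>-5/4\<^esup> n\<^bsup>1/2\<^esup>\<close> tends to zero. Any exponent below \<open>-1\<close> would do in place of
  \<open>-5/4\<close>; this one leaves room for tolls of size \<open>n\<^bsup>1/4\<^esup>\<close> on top of \<open>n\<^bsup>-3/2\<^esup>\<close>.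
\<close>

lemma convolution_asymptotics:
  fixes u v :: "nat \<Rightarrow> 'a :: {banach, real_normed_field}"
  assumes u: "(\<lambda>n. of_real (sqrt (real n + 1)) * u n) \<longlonglongrightarrow> c"
    and v: "\<And>n. norm (v n) \<le> C * (real n + 1) powr -(5/4)"
  shows "(\<lambda>n. of_real (sqrt (real n + 1)) * (\<Sum>i\<le>n. v i * u (n - i))) \<longlonglongrightarrow> c * suminf v"
    and "summable (\<lambda>n. norm (v n))"
proof -
  define s where "s = (\<lambda>n::nat. sqrt (real n + 1))"
  have s: "s n > 0" for n by (simp add: s_def)
  have C: "0 \<le> C" using order.trans[OF norm_ge_zero v[of 0]] by simp
  obtain K where K: "norm (of_real (s n) * u n) \<le> K" for n
    using Bseq_iff2 convergent_imp_Bseq[OF convergentI[OF u]] unfolding s_def Bseq_def by blast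
  have u': "norm (u n) \<le> K / sqrt (real n + 1)" for n
    using K[of n] s[of n] by (simp add: norm_mult s_def field_simps)
  have K0: "0 \<le> K" using order.trans[OF norm_ge_zero u'[of 0]] by simp
  have "summable (\<lambda>n. C * real (Suc n) powr -(5/4))"
    by (intro summable_mult, subst summable_Suc_iff, subst summable_real_powr_iff) simp
  then show sv: "summable (\<lambda>n. norm (v n))"
    by (rule summable_comparison_test'[of _ 0]) (use v in \<open>auto simp: add_ac\<close>)
  (* the terms of the lower half, extended by zero to all indices *)
  define a where "a = (\<lambda>i n. if 2 * i \<le> n then of_real (s n) * (v i * u (n - i)) else 0)"
  have "(\<lambda>n. \<Sum>i. a i n) \<longlonglongrightarrow> (\<Sum>i. c * v i)"
  proof (rule tannerys_theorem[where M = "\<lambda>i. 2 * K * norm (v i)", THEN conjunct2, THEN conjunct2])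
    fix i
    have "(\<lambda>n. of_real (s (n + i) / s n) * (of_real (s n) * u n) * v i) \<longlonglongrightarrow> of_real 1 * c * v i"
    proof (intro tendsto_intros)
      show "(\<lambda>n. s (n + i) / s n) \<longlonglongrightarrow> 1" unfolding s_def by real_asymp
      show "(\<lambda>n. of_real (s n) * u n) \<longlonglongrightarrow> c" using u by (simp add: s_def)
    qed
    moreover have "\<forall>\<^sub>F n in sequentially. of_real (s (n + i) / s n) * (of_real (s n) * u n) * v i = a i (n + i)"
      using eventually_ge_at_top[of i] by eventually_elim (use s in \<open>auto simp: a_def less_imp_neq[symmetric]\<close>)
    ultimately have "(\<lambda>n. a i (n + i)) \<longlonglongrightarrow> c * v i"
      by (simp add: tendsto_cong)
    then show "(\<lambda>n. a i n) \<longlonglongrightarrow> c * v i" by (rule LIMSEQ_offset)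
  next
    have "norm (a i n) \<le> 2 * K * norm (v i)" for i n
    proof (cases "2 * i \<le> n")
      case True
      have "norm (a i n) = norm (v i) * (s n * norm (u (n - i)))"
        using True s[of n] by (simp add: a_def norm_mult)
      also have "\<dots> \<le> norm (v i) * (s n * (2 * K / s n))"
        using convolution_lower_half_bound[OF u' True] s[of n]
        by (intro mult_left_mono) (auto simp: s_def)
      finally show ?thesis using s[of n] by (simp add: mult_ac)
    qed (use K0 in \<open>simp add: a_def\<close>)
    then show "\<forall>\<^sub>F (i, n) in at_top \<times>\<^sub>F sequentially. norm (a i n) \<le> 2 * K * norm (v i)"
      by (intro always_eventually) auto
  qed (intro summable_mult sv, simp)
  moreover have "(\<Sum>i. a i n) = of_real (s n) * (\<Sum>i\<in>{i. i \<le> n \<and> 2 * i \<le> n}. v i * u (n - i))" for n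
    by (subst suminf_finite[of "{i. i \<le> n \<and> 2 * i \<le> n}"])
       (auto simp: a_def sum_distrib_left intro!: sum.cong)
  moreover have "(\<lambda>n. of_real (s n) * (\<Sum>i\<in>{i. i \<le> n \<and> n < 2 * i}. v i * u (n - i))) \<longlonglongrightarrow> 0"
  proof (rule Lim_null_comparison)
    show "\<forall>\<^sub>F n in sequentially. norm (of_real (s n) * (\<Sum>i\<in>{i. i \<le> n \<and> n < 2 * i}. v i * u (n - i))) \<le>
        s n * (2 * (C * ((real n + 1) / 2) powr -(5/4)) * K * s n)"
    proof (intro always_eventually allI)
      fix n
      have "norm (\<Sum>i\<in>{i. i \<le> n \<and> n < 2 * i}. v i * u (n - i)) \<le>
          2 * (C * ((real n + 1) / 2) powr -(5/4)) * K * sqrt (real n + 1)"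
      proof (rule convolution_upper_half_bound[OF u'])
        fix i assume i: "i \<le> n" "n < 2 * i"
        have "(real i + 1) powr -(5/4) \<le> ((real n + 1) / 2) powr -(5/4)"
          using i by (intro powr_mono2') auto
        then show "norm (v i) \<le> C * ((real n + 1) / 2) powr -(5/4)"
          using v[of i] mult_left_mono[OF _ C] by fastforce
      qed (use C in auto)
      then show "norm (of_real (s n) * (\<Sum>i\<in>{i. i \<le> n \<and> n < 2 * i}. v i * u (n - i))) \<le>
          s n * (2 * (C * ((real n + 1) / 2) powr -(5/4)) * K * s n)"
        using s[of n] unfolding norm_mult by (intro mult_mono) (auto simp: s_def)
    qed
    have "(\<lambda>n. 2 * C * K * (s n * (((real n + 1) / 2) powr -(5/4) * s n))) \<longlonglongrightarrow> 2 * C * K * 0"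
      unfolding s_def by (intro tendsto_mult_left) real_asymp
    then show "(\<lambda>n. s n * (2 * (C * ((real n + 1) / 2) powr -(5/4)) * K * s n)) \<longlonglongrightarrow> 0"
      by (simp add: mult_ac)
  qed
  ultimately have "(\<lambda>n. of_real (s n) * (\<Sum>i\<in>{i. i \<le> n \<and> 2 * i \<le> n}. v i * u (n - i)) +
      of_real (s n) * (\<Sum>i\<in>{i. i \<le> n \<and> n < 2 * i}. v i * u (n - i))) \<longlonglongrightarrow> (\<Sum>i. c * v i) + 0"
    by (intro tendsto_add) simp_all
  moreover have "(\<Sum>i\<in>{i. i \<le> n \<and> 2 * i \<le> n}. v i * u (n - i)) +
      (\<Sum>i\<in>{i. i \<le> n \<and> n < 2 * i}. v i * u (n - i)) = (\<Sum>i\<le>n. v i * u (n - i))" for n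
    by (subst sum.union_disjoint[symmetric]) (auto intro!: sum.cong)
  moreover have "(\<Sum>i. c * v i) = c * suminf v"
    using summable_norm_cancel[OF sv] by (rule suminf_mult)
  ultimately show "(\<lambda>n. of_real (sqrt (real n + 1)) * (\<Sum>i\<le>n. v i * u (n - i))) \<longlonglongrightarrow> c * suminf v"
    by (simp add: s_def flip: distrib_left)
qed

text \<open>
  Exponential decay beats every power; the target exponent is the one that
  \<open>convolution_asymptotics\<close> asks for.
\<close>

lemma geometric_decay:
  fixes q p :: real
  assumes "0 \<le> q" "q < 1"
  obtains C where "\<And>n. (real n + 1) powr p * q ^ n \<le> C * (real n + 1) powr -(5/4)"
proof -
  have "(\<lambda>n. (real n + 1) powr (p + 5/4) * q ^ n) \<longlonglongrightarrow> 0"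
  proof (cases "q = 0")
    case True
    then show ?thesis by (intro tendsto_eventually eventually_sequentiallyI[of 1]) auto
  next
    case False
    with assms have "0 < q" "q < 1" by auto
    then show ?thesis by real_asymp
  qed
  then have "Bseq (\<lambda>n. (real n + 1) powr (p + 5/4) * q ^ n)"
    by (intro convergent_imp_Bseq convergentI)
  then obtain C where C: "\<And>n. norm ((real n + 1) powr (p + 5/4) * q ^ n) \<le> C"
    by (auto simp: Bseq_def)
  show ?thesis
  proof
    fix n
    have "(real n + 1) powr p = (real n + 1) powr (p + 5/4) * (real n + 1) powr -(5/4)"
      by (simp flip: powr_add)
    then have "(real n + 1) powr p * q ^ n =
        ((real n + 1) powr (p + 5/4) * q ^ n) * (real n + 1) powr -(5/4)"
      by (simp only: mult_ac)
    also have "\<dots> \<le> C * (real n + 1) powr -(5/4)"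
      using C[of n] assms by (intro mult_right_mono) auto
    finally show "(real n + 1) powr p * q ^ n \<le> C * (real n + 1) powr -(5/4)" .
  qed
qed
text \<open>
  Tonelli for double series: the partial sums over the second index are dominated by the full row
  sums, so Tannery's theorem applies.
\<close>

lemma sums_exchange_nonneg:
  fixes a :: "nat \<Rightarrow> nat \<Rightarrow> real"
  assumes nonneg: "\<And>k n. 0 \<le> a k n"
    and row: "\<And>k. a k sums c k" and col: "\<And>n. (\<lambda>k. a k n) sums b n" and c: "summable c"
  shows "b sums suminf c"
proof -
  have "(\<lambda>N. \<Sum>k. \<Sum>n<N. a k n) \<longlonglongrightarrow> suminf c"
  proof (rule tannerys_theorem[where M = c, THEN conjunct2, THEN conjunct2])
    show "(\<lambda>N. \<Sum>n<N. a k n) \<longlonglongrightarrow> c k" for k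
      using row[of k] by (simp add: sums_def)
    have "norm (\<Sum>n<N. a k n) \<le> c k" for k N
      using sum_le_suminf[OF sums_summable[OF row[of k]], of "{..<N}"] nonneg sums_unique[OF row[of k]]
      by (simp add: sum_nonneg)
    then show "\<forall>\<^sub>F (k, N) in at_top \<times>\<^sub>F sequentially. norm (\<Sum>n<N. a k n) \<le> c k"
      by (intro always_eventually) auto
  qed (use c in auto)
  moreover have "(\<lambda>k. \<Sum>n<N. a k n) sums (\<Sum>n<N. b n)" for N
    by (intro sums_sum col)
  then have "(\<Sum>k. \<Sum>n<N. a k n) = (\<Sum>n<N. b n)" for N
    by (rule sums_unique[symmetric])
  ultimately show ?thesis by (simp add: sums_def)
qed

section \<open>The radius of convergence as a zero of the discriminant\<close>

lemma eval_gf_T_rec: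
  fixes z :: "'a :: {banach, real_normed_field}"
  assumes "abs_conv gf_T z" "abs_conv gf_T (z ^ 2)"
  shows "2 * eval_fps gf_T z = 2 + z * (eval_fps gf_T z ^ 2 + eval_fps gf_T (z ^ 2))"
proof -
  have "eval_fps (2 * gf_T) z = eval_fps (2 + fps_X * (gf_T ^ 2 + (gf_T oo fps_X ^ 2))) z"
    by (simp only: gf_T_rec)
  then show ?thesis
    by (simp add: assms eval_fps_mult' eval_fps_add' power2_eq_square abs_conv_mult abs_conv_add
        abs_conv_compose_square[unfolded power2_eq_square]
        eval_fps_compose_square[unfolded power2_eq_square] assms(2)[unfolded power2_eq_square])
qed

text \<open>
  Completing the square in the quadratic equation for \<open>T\<close>. The right-hand side involves \<open>T\<close> only at
  \<open>z\<^sup>2\<close> and therefore makes sense well beyond the radius of convergence.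
\<close>

lemma square_one_minus_zT:
  fixes z :: "'a :: {banach, real_normed_field}"
  assumes "abs_conv gf_T z" "abs_conv gf_T (z ^ 2)"
  shows "(1 - z * eval_fps gf_T z) ^ 2 = 1 - 2 * z - z ^ 2 * eval_fps gf_T (z ^ 2)"
proof -
  have "(1 - z * eval_fps gf_T z) ^ 2 =
      1 - z * (2 * eval_fps gf_T z) + z ^ 2 * eval_fps gf_T z ^ 2"
    by (simp add: power2_eq_square algebra_simps)
  then show ?thesis
    unfolding eval_gf_T_rec[OF assms] by (simp add: power2_eq_square algebra_simps)
qed

lemma card_binary_trees_pos: "0 < card (binary_trees n)"
  by (simp add: card_gt_0_iff finite_binary_trees binary_trees_nonempty)

lemma gf_T_nth: "gf_T $ n = of_nat (card (binary_trees n))"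
  by (simp add: gf_T_def)

lemma gf_T_nth_0 [simp]: "(gf_T :: 'a :: comm_ring_1 fps) $ 0 = 1"
  by (simp add: gf_T_nth binary_trees_0)

definition partial_T :: "nat \<Rightarrow> real \<Rightarrow> real" where
  "partial_T N x = (\<Sum>n<N. gf_T $ n * x ^ n)"

lemma partial_T_nonneg: "0 \<le> x \<Longrightarrow> 0 \<le> partial_T N x"
  by (auto simp: partial_T_def gf_T_nth intro!: sum_nonneg)

lemma partial_T_mono: "0 \<le> x \<Longrightarrow> x \<le> y \<Longrightarrow> partial_T N x \<le> partial_T N y"
  by (auto simp: partial_T_def gf_T_nth intro!: sum_mono mult_left_mono power_mono)

lemma partial_T_le_eval: "0 \<le> x \<Longrightarrow> abs_conv gf_T x \<Longrightarrow> partial_T N x \<le> eval_fps gf_T x"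
  using sum_le_suminf[OF sums_summable[OF abs_conv_sums[of gf_T x]], of "{..<N}"]
  by (simp add: partial_T_def eval_fps_def gf_T_nth)

lemma abs_conv_gf_T_if_bounded:
  assumes "0 \<le> x" "\<And>N. partial_T N x \<le> B"
  shows "abs_conv gf_T x" "eval_fps gf_T x \<le> B"
proof -
  show "abs_conv gf_T x"
    unfolding abs_conv_def
  proof (rule bounded_imp_summable[of _ B])
    fix N
    show "(\<Sum>n\<le>N. norm (gf_T $ n * x ^ n)) \<le> B"
      using assms(2)[of "Suc N"] assms(1)
      by (simp add: partial_T_def gf_T_nth abs_mult lessThan_Suc_atMost)
  qed simp
  from abs_conv_sums[OF this] show "eval_fps gf_T x \<le> B"
    by (intro LIMSEQ_le_const2[of "\<lambda>N. partial_T N x"])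
       (use assms in \<open>auto simp: sums_def partial_T_def\<close>)
qed

text \<open>
  Truncating the recursion only drops nonnegative terms. This monotone iteration bounds \<open>T\<close> by any
  number that the quadratic map does not increase, without knowing in advance that the series
  converges.
\<close>

lemma partial_T_Suc_le:
  assumes x: "0 \<le> x"
  shows "partial_T (Suc N) x \<le> 1 + x / 2 * (partial_T N x ^ 2 + partial_T N (x ^ 2))"
proof -
  let ?t = "\<lambda>n. (gf_T :: real fps) $ n"
  have t: "0 \<le> ?t n" for n by (simp add: gf_T_nth)
  have coeff: "?t (Suc n) = ((\<Sum>i\<le>n. ?t i * ?t (n - i)) + (if even n then ?t (n div 2) else 0)) / 2" for n
  proof -
    have "(2 * gf_T) $ Suc n = (2 + fps_X * (gf_T ^ 2 + (gf_T oo fps_X ^ 2)) :: real fps) $ Suc n"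
      by (simp only: gf_T_rec)
    then show ?thesis
      by (simp add: numeral_fps_const power2_eq_square fps_mult_nth[of gf_T gf_T] atLeast0AtMost
          fps_nth_compose_X_power[of _ 2, unfolded power2_eq_square])
  qed
  have "(\<Sum>n<N. (\<Sum>i\<le>n. ?t i * ?t (n - i)) * x ^ n) =
      (\<Sum>n<N. \<Sum>i\<le>n. (?t i * x ^ i) * (?t (n - i) * x ^ (n - i)))"
    unfolding sum_distrib_right
  proof (intro sum.cong refl)
    fix n i :: nat assume "i \<in> {..n}"
    then have "x ^ n = x ^ i * x ^ (n - i)" by (simp flip: power_add)
    then show "?t i * ?t (n - i) * x ^ n = (?t i * x ^ i) * (?t (n - i) * x ^ (n - i))"
      by (simp add: mult_ac)
  qed
  also have "\<dots> = (\<Sum>(i, j)\<in>{(i, j). i + j < N}. (?t i * x ^ i) * (?t j * x ^ j))"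
    by (rule sum.triangle_reindex[symmetric])
  also have "\<dots> \<le> (\<Sum>(i, j)\<in>{..<N} \<times> {..<N}. (?t i * x ^ i) * (?t j * x ^ j))"
    by (rule sum_mono2) (use x t in auto)
  also have "\<dots> = partial_T N x ^ 2"
    by (simp add: partial_T_def power2_eq_square sum_product sum.cartesian_product)
  finally have 1: "(\<Sum>n<N. (\<Sum>i\<le>n. ?t i * ?t (n - i)) * x ^ n) \<le> partial_T N x ^ 2" .
  have "(\<Sum>n<N. (if even n then ?t (n div 2) else 0) * x ^ n) =
      (\<Sum>n\<in>{n. n < N \<and> even n}. ?t (n div 2) * (x ^ 2) ^ (n div 2))"
    by (rule sum.mono_neutral_cong_right) (auto simp flip: power_mult)
  also have "\<dots> = (\<Sum>m\<in>{m. 2 * m < N}. ?t m * (x ^ 2) ^ m)"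
    by (rule sum.reindex_bij_witness[of _ "\<lambda>m. 2 * m" "\<lambda>n. n div 2"]) auto
  also have "\<dots> \<le> partial_T N (x ^ 2)"
    unfolding partial_T_def by (rule sum_mono2) (use x t in auto)
  finally have 2: "(\<Sum>n<N. (if even n then ?t (n div 2) else 0) * x ^ n) \<le> partial_T N (x ^ 2)" .
  have "partial_T (Suc N) x = 1 + (\<Sum>n<N. ?t (Suc n) * x ^ Suc n)"
    unfolding partial_T_def by (subst sum.lessThan_Suc_shift) simp
  also have "\<dots> = 1 + x / 2 * ((\<Sum>n<N. (\<Sum>i\<le>n. ?t i * ?t (n - i)) * x ^ n) +
      (\<Sum>n<N. (if even n then ?t (n div 2) else 0) * x ^ n))"
    unfolding coeff sum.distrib[symmetric] sum_distrib_left
    by (intro arg_cong2[where f = "(+)"] sum.cong refl) (simp add: algebra_simps add_divide_distrib)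
  also have "\<dots> \<le> 1 + x / 2 * (partial_T N x ^ 2 + partial_T N (x ^ 2))"
    using x by (intro add_left_mono mult_left_mono add_mono 1 2) auto
  finally show ?thesis .
qed

text \<open>
  A number \<open>M\<close> with \<open>1 + x/2 (M\<^sup>2 + B) \<le> M\<close> is a barrier for the iteration.
\<close>

lemma partial_T_le:
  assumes x: "0 \<le> x" and B: "\<And>N. partial_T N (x ^ 2) \<le> B"
    and M: "0 \<le> M" "1 + x / 2 * (M ^ 2 + B) \<le> M"
  shows "partial_T N x \<le> M"
proof (induction N)
  case (Suc N)
  have "partial_T (Suc N) x \<le> 1 + x / 2 * (partial_T N x ^ 2 + partial_T N (x ^ 2))"
    by (rule partial_T_Suc_le[OF x])
  also have "\<dots> \<le> 1 + x / 2 * (M ^ 2 + B)"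
    using x by (intro add_left_mono mult_left_mono add_mono power_mono Suc.IH B)
      (auto simp: partial_T_nonneg)
  finally show ?case using M(2) by simp
qed (use M in \<open>simp add: partial_T_def\<close>)

lemma conv_radius_gf_T_complex_real:
  "fps_conv_radius (gf_T :: complex fps) = fps_conv_radius (gf_T :: real fps)"
proof -
  have "conv_radius (\<lambda>n. norm ((gf_T :: complex fps) $ n)) = conv_radius (\<lambda>n. norm ((gf_T :: real fps) $ n))"
    by (simp only: gf_T_nth norm_of_nat)
  then show ?thesis by (simp only: fps_conv_radius_def conv_radius_norm)
qed
lemma conv_radius_gf_T: "ereal rho = fps_conv_radius (gf_T :: real fps)"
  and rho_bounds: "1/4 \<le> rho" "rho \<le> 1"
proof -
  let ?R = "fps_conv_radius (gf_T :: real fps)"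
  note same = conv_radius_gf_T_complex_real
  (* 2 is a barrier at 1/4, since 1 + 1/8 (4 + 2) < 2 *)
  have "partial_T N (1/4) \<le> 2" for N
  proof (induction N)
    case (Suc N)
    have "partial_T (Suc N) (1/4) \<le> 1 + 1/8 * (partial_T N (1/4) ^ 2 + partial_T N (1/16))"
      using partial_T_Suc_le[of "1/4" N] by (simp add: power2_eq_square)
    also have "\<dots> \<le> 1 + 1/8 * (2 ^ 2 + 2)"
      using Suc.IH partial_T_mono[of "1/16" "1/4" N]
      by (intro add_left_mono mult_left_mono add_mono power_mono) (auto simp: partial_T_nonneg)
    finally show ?case by simp
  qed (simp add: partial_T_def)
  then have "abs_conv (gf_T :: real fps) (1/4)" by (intro abs_conv_gf_T_if_bounded) auto
  then have lower: "ereal (1/4) \<le> ?R"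
    unfolding abs_conv_def fps_conv_radius_def
    using conv_radius_geI[of "fps_nth (gf_T :: real fps)" "1/4"] summable_norm_cancel by fastforce
  have upper: "?R \<le> ereal 1"
  proof (rule ccontr)
    assume "\<not> ?R \<le> ereal 1"
    then have "summable (\<lambda>n. (gf_T :: real fps) $ n * 1 ^ n)" by (intro summable_fps) auto
    then have "(\<lambda>n. (gf_T :: real fps) $ n) \<longlonglongrightarrow> 0" by (simp add: summable_LIMSEQ_zero)
    then have "\<forall>\<^sub>F n in sequentially. (gf_T :: real fps) $ n < 1"
      by (rule order_tendstoD) simp
    moreover have "1 \<le> (gf_T :: real fps) $ n" for n
      using card_binary_trees_pos[of n] by (simp add: gf_T_nth)
    ultimately show False by (auto simp: eventually_sequentially not_le[symmetric])
  qed
  show eq: "ereal rho = ?R"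
    unfolding rho_def same using lower upper by (cases ?R) auto
  show "1/4 \<le> rho" "rho \<le> 1" using lower upper unfolding eq[symmetric] by simp_all
qed

lemma rho_pos: "0 < rho" using rho_bounds by linarith

lemma abs_conv_gf_T_real: "\<bar>x\<bar> < rho \<Longrightarrow> abs_conv (gf_T :: real fps) x"
  by (rule abs_convI) (simp flip: conv_radius_gf_T)

lemma continuous_on_gf_T: "continuous_on {-rho<..<rho} (eval_fps (gf_T :: real fps))"
proof -
  have "continuous_on (eball 0 rho) (eval_fps (gf_T :: real fps))"
    unfolding conv_radius_gf_T by (rule continuous_on_eval_fps)
  then show ?thesis by (rule continuous_on_subset) auto
qed

lemma eval_gf_T_mono:
  assumes "0 \<le> x" "x \<le> y" "abs_conv (gf_T :: real fps) y"
  shows "eval_fps gf_T x \<le> eval_fps (gf_T :: real fps) y"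
proof -
  have "abs_conv gf_T x" using assms by (intro abs_conv_mono[OF assms(3)]) auto
  then show ?thesis
    using assms unfolding eval_fps_def
    by (intro suminf_le abs_conv_sums[THEN sums_summable])
       (auto simp: gf_T_nth intro!: mult_left_mono power_mono)
qed

lemma eval_gf_T_ge_1:
  assumes "0 \<le> x" "abs_conv (gf_T :: real fps) x"
  shows "1 \<le> eval_fps (gf_T :: real fps) x"
  using partial_T_le_eval[OF assms, of 1] by (simp add: partial_T_def)

text \<open>
  The discriminant of the quadratic equation \<open>1 - T + x/2 (T\<^sup>2 + T(x\<^sup>2)) = 0\<close> for \<open>T(x)\<close>.
\<close>

definition Q_real :: "real \<Rightarrow> real" where
  "Q_real x = 1 - 2 * x - x ^ 2 * eval_fps gf_T (x ^ 2)"

lemma Q_real_strict_antimono: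
  assumes "0 \<le> x" "x < y" "y ^ 2 < rho"
  shows "Q_real y < Q_real x"
proof -
  have "x ^ 2 \<le> y ^ 2" using assms by (intro power_mono) auto
  moreover have y: "abs_conv (gf_T :: real fps) (y ^ 2)"
    using assms by (intro abs_conv_gf_T_real) simp
  ultimately have "x ^ 2 * eval_fps gf_T (x ^ 2) \<le> y ^ 2 * eval_fps gf_T (y ^ 2)"
    using assms eval_gf_T_ge_1[of "x^2"] abs_conv_mono[OF y, of "x^2"]
    by (intro mult_mono eval_gf_T_mono) auto
  then show ?thesis using assms by (simp add: Q_real_def)
qed

text \<open>
  Below \<open>\<rho>\<close> the discriminant is a square and strictly decreasing, so it is positive there and \<open>x T(x)\<close>
  cannot reach 1. Hence the partial sums of \<open>T\<close> at \<open>\<rho>\<close> stay below \<open>1/\<rho>\<close>. If the discriminant were still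
  positive at \<open>\<rho>\<close>, it would be so slightly to the right of \<open>\<rho>\<close>; there the quadratic equation has a real
  root, which is a barrier for the iteration, and the series would converge beyond \<open>\<rho>\<close>.
\<close>

lemma abs_conv_gf_T_rho: "abs_conv (gf_T :: real fps) rho"
  and rho_gf_T_rho: "rho * eval_fps gf_T rho = 1"
  and rho_le_half: "rho \<le> 1/2"
proof -
  let ?T = "eval_fps (gf_T :: real fps)"
  have sq_less: "x ^ 2 < rho" if "0 \<le> x" "x < rho" for x
    using mult_left_le[of x x] rho_bounds that by (simp add: power2_eq_square)
  have Q_eq: "Q_real x = (1 - x * ?T x) ^ 2" if "0 \<le> x" "x < rho" for x
    using square_one_minus_zT[of x] abs_conv_gf_T_real[of x] abs_conv_gf_T_real[of "x^2"]
      sq_less[OF that] that by (simp add: Q_real_def)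
  have less_1: "x * ?T x < 1" if x: "0 \<le> x" "x < rho" for x
  proof (rule ccontr)
    assume "\<not> x * ?T x < 1"
    then have "\<exists>y\<ge>0. y \<le> x \<and> y * ?T y = 1"
      using x by (intro IVT' continuous_intros continuous_on_subset[OF continuous_on_gf_T]) auto
    then obtain y where y: "0 \<le> y" "y \<le> x" "y * ?T y = 1" by blast
    obtain w where w: "y < w" "w < rho" using dense[of y rho] y x by auto
    have "Q_real w < Q_real y" using y w sq_less[of w] by (intro Q_real_strict_antimono) auto
    moreover have "Q_real y = 0" using Q_eq[of y] y x by simp
    moreover have "0 \<le> Q_real w" using Q_eq[of w] y w by simp
    ultimately show False by simp
  qed
  have half: "x \<le> 1/2" if x: "0 \<le> x" "x < rho" for x
  proof -
    have "0 \<le> Q_real x" using Q_eq[OF x] by simp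
    moreover have "0 \<le> x ^ 2 * ?T (x ^ 2)"
      using eval_gf_T_ge_1[of "x^2"] abs_conv_gf_T_real[of "x^2"] sq_less[OF x] by simp
    ultimately show ?thesis by (simp add: Q_real_def)
  qed
  show rho_half: "rho \<le> 1/2"
    by (rule dense_le_bounded[of 0]) (use rho_pos half in auto)
  have "rho * partial_T N rho \<le> 1" for N
  proof (rule tendsto_upperbound)
    show "((\<lambda>x. x * partial_T N x) \<longlongrightarrow> rho * partial_T N rho) (at_left rho)"
      unfolding partial_T_def by (intro tendsto_intros)
    show "\<forall>\<^sub>F x in at_left rho. x * partial_T N x \<le> 1"
      using eventually_at_left_real[OF rho_pos]
    proof eventually_elim
      case (elim x)
      then have "x * partial_T N x \<le> x * ?T x"
        by (intro mult_left_mono partial_T_le_eval abs_conv_gf_T_real) auto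
      moreover have "x * ?T x < 1" using less_1[of x] elim by auto
      ultimately show ?case by linarith
    qed
  qed simp
  then have bound: "partial_T N rho \<le> 1 / rho" for N
    using rho_pos by (simp add: field_simps)
  show conv: "abs_conv (gf_T :: real fps) rho"
    using rho_pos bound by (intro abs_conv_gf_T_if_bounded(1)) auto
  have le: "rho * ?T rho \<le> 1"
    using abs_conv_gf_T_if_bounded(2)[of rho "1/rho"] rho_pos bound by (simp add: field_simps)
  show "rho * ?T rho = 1"
  proof (rule ccontr)
    assume "rho * ?T rho \<noteq> 1"
    have rho_sq: "rho ^ 2 < rho" using rho_half rho_pos by (simp add: power2_eq_square)
    have "Q_real rho = (1 - rho * ?T rho) ^ 2"
      using square_one_minus_zT[OF conv] abs_conv_gf_T_real[of "rho^2"] rho_sq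
      by (simp add: Q_real_def)
    with \<open>rho * ?T rho \<noteq> 1\<close> have "0 < Q_real rho" by simp
    have "isCont Q_real rho"
      unfolding Q_real_def
      by (intro continuous_intros isCont_o2[of _ "\<lambda>x. x^2" ?T]
          continuous_on_interior[OF continuous_on_gf_T])
         (use rho_sq rho_pos in \<open>auto simp: interior_open intro: less_trans[of _ 0]\<close>)
    then have "\<forall>\<^sub>F x in at_right rho. 0 < Q_real x"
      using \<open>0 < Q_real rho\<close> by (intro order_tendstoD) (auto simp: isCont_def filterlim_at_split)
    moreover have "\<forall>\<^sub>F x in at_right rho. x ^ 2 < rho"
      by (rule order_tendstoD[of _ "rho^2"]) (use rho_sq in \<open>auto intro!: tendsto_intros\<close>)
    ultimately have "\<forall>\<^sub>F x in at_right rho. 0 < Q_real x \<and> x ^ 2 < rho \<and> rho < x"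
      by (auto simp: eventually_conj_iff eventually_at_right_less)
    then obtain x where x: "0 < Q_real x" "x ^ 2 < rho" "rho < x"
      using eventually_happens'[of "at_right rho"] by auto
    have x0: "0 < x" using x rho_pos by linarith
    have conv2: "abs_conv (gf_T :: real fps) (x ^ 2)"
      using x by (intro abs_conv_gf_T_real) simp
    (* the smaller root of the quadratic equation at x *)
    define M where "M = (1 - sqrt (Q_real x)) / x"
    have "0 \<le> x ^ 2 * ?T (x ^ 2)"
      using eval_gf_T_ge_1[OF _ conv2] by simp
    then have "Q_real x \<le> 1" using x0 by (simp add: Q_real_def)
    then have M: "0 \<le> M" using x0 by (simp add: M_def)
    have "(1 - x * M) ^ 2 = Q_real x" using x x0 by (simp add: M_def)
    then have "2 * x * (1 + x / 2 * (M ^ 2 + ?T (x ^ 2))) = 2 * x * M"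
      by (simp add: Q_real_def power2_eq_square algebra_simps)
    then have fixpoint: "1 + x / 2 * (M ^ 2 + ?T (x ^ 2)) = M" using x0 by simp
    have "partial_T N x \<le> M" for N
      by (rule partial_T_le[where B = "?T (x ^ 2)"]) (use x0 M conv2 fixpoint in \<open>auto intro: partial_T_le_eval\<close>)
    then have "abs_conv (gf_T :: real fps) x"
      using x0 by (intro abs_conv_gf_T_if_bounded(1)) auto
    then have "ereal (norm x) \<le> fps_conv_radius (gf_T :: real fps)"
      unfolding abs_conv_def fps_conv_radius_def
      by (intro conv_radius_geI) (rule summable_norm_cancel)
    then show False using x x0 by (simp flip: conv_radius_gf_T)
  qed
qed

lemma rho_square_less: "rho ^ 2 < rho"
  using rho_le_half rho_pos by (simp add: power2_eq_square)

lemma abs_conv_gf_T: 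
  fixes z :: "'a :: {banach, real_normed_field}"
  assumes "norm z \<le> rho"
  shows "abs_conv gf_T z"
proof -
  have "summable (\<lambda>n. of_nat (card (binary_trees n)) * rho ^ n)"
    using abs_conv_gf_T_rho rho_pos by (simp add: abs_conv_def gf_T_nth abs_mult)
  then show ?thesis
    unfolding abs_conv_def
    by (rule summable_comparison_test'[of _ 0])
       (auto simp: gf_T_nth norm_mult norm_power intro!: mult_left_mono power_mono assms)
qed

lemma norm_power2_le_rho: "norm (z :: 'a :: real_normed_field) \<le> rho \<Longrightarrow> norm (z ^ 2) \<le> rho"
  using rho_square_less power_mono[of "norm z" rho 2] by (simp add: norm_power)

lemma Q_real_eq_square: "0 \<le> x \<Longrightarrow> x \<le> rho \<Longrightarrow> (1 - x * eval_fps gf_T x) ^ 2 = Q_real x"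
  using square_one_minus_zT[of x] abs_conv_gf_T[of x] abs_conv_gf_T[of "x^2"] norm_power2_le_rho[of x]
  by (simp add: Q_real_def)

lemma Q_real_rho: "Q_real rho = 0"
  using Q_real_eq_square[of rho] rho_pos rho_gf_T_rho by simp

lemma x_gf_T_le_1: "0 \<le> x \<Longrightarrow> x \<le> rho \<Longrightarrow> x * eval_fps gf_T x \<le> 1"
  using mult_mono[of x rho "eval_fps gf_T x" "eval_fps gf_T rho"] rho_gf_T_rho rho_pos
    eval_gf_T_mono[of x rho] eval_gf_T_ge_1[of x] abs_conv_gf_T[of x] abs_conv_gf_T_rho
  by simp

section \<open>The discriminant in the complex plane\<close>

lemma conv_radius_gf_T_complex: "fps_conv_radius (gf_T :: complex fps) = ereal rho"
  by (simp only: conv_radius_gf_T_complex_real conv_radius_gf_T)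
lemma gf_T_complex_of_real: "(gf_T :: complex fps) $ n = of_real (gf_T $ n)"
  by (simp add: gf_T_nth)

lemma norm_gf_T_le:
  assumes "norm z \<le> rho"
  shows "norm (z * eval_fps gf_T (z :: complex)) \<le> 1"
proof -
  have "norm (eval_fps gf_T z) \<le> eval_fps gf_T (norm z)"
    using abs_conv_gf_T[OF assms] unfolding abs_conv_def eval_fps_def
    by (intro order.trans[OF summable_norm]) (auto simp: gf_T_nth norm_mult norm_power)
  then have "norm (z * eval_fps gf_T z) \<le> norm z * eval_fps gf_T (norm z)"
    by (simp add: norm_mult mult_left_mono)
  also have "\<dots> \<le> 1" using assms by (intro x_gf_T_le_1) auto
  finally show ?thesis .
qed

definition Q :: "complex \<Rightarrow> complex" where
  "Q z = 1 - 2 * z - z ^ 2 * eval_fps gf_T (z ^ 2)"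

lemma Q_eq_square: "norm z \<le> rho \<Longrightarrow> (1 - z * eval_fps gf_T z) ^ 2 = Q z"
  using square_one_minus_zT[of z] abs_conv_gf_T[of z] abs_conv_gf_T[of "z^2"] norm_power2_le_rho[of z]
  by (simp add: Q_def)

text \<open>
  If \<open>z T(z) = 1\<close>, then the triangle inequality for \<open>\<Sum> t\<^sub>n z\<^bsup>n+1\<^esup>\<close> is sharp against \<open>\<Sum> t\<^sub>n \<rho>\<^bsup>n+1\<^esup> = 1\<close>.
  All terms must then agree in their real parts, and already the first one forces \<open>z = \<rho>\<close>.
\<close>

lemma Q_zero_imp_eq_rho:
  assumes z: "norm z \<le> rho" "Q z = 0"
  shows "z = of_real rho"
proof -
  have "z * eval_fps gf_T z = 1" using Q_eq_square[OF z(1)] z(2) by simp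
  then have "(\<lambda>n. z * (gf_T $ n * z ^ n)) sums 1"
    using sums_mult[OF abs_conv_sums[OF abs_conv_gf_T[OF z(1)]], of z] by simp
  from sums_Re[OF this] have "(\<lambda>n. gf_T $ n * Re (z ^ Suc n)) sums 1"
    by (simp add: gf_T_complex_of_real algebra_simps flip: of_real_mult)
  moreover have "(\<lambda>n. gf_T $ n * rho ^ Suc n) sums 1"
    using sums_mult[OF abs_conv_sums[OF abs_conv_gf_T_rho], of rho] rho_gf_T_rho
    by (simp add: mult_ac)
  ultimately have sums0: "(\<lambda>n. gf_T $ n * (rho ^ Suc n - Re (z ^ Suc n))) sums 0"
    using sums_diff by (fastforce simp: right_diff_distrib)
  have nonneg: "0 \<le> gf_T $ n * (rho ^ Suc n - Re (z ^ Suc n))" for n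
  proof -
    have "Re (z ^ Suc n) \<le> norm z ^ Suc n"
      by (metis complex_Re_le_cmod norm_power)
    also have "\<dots> \<le> rho ^ Suc n" using z(1) by (intro power_mono) auto
    finally show ?thesis by (simp add: gf_T_nth)
  qed
  have "\<forall>n. gf_T $ n * (rho ^ Suc n - Re (z ^ Suc n)) = 0"
    using suminf_eq_zero_iff[OF sums_summable[OF sums0] nonneg] sums_unique[OF sums0] by metis
  from spec[OF this, of 0] have Re: "Re z = rho" by simp
  moreover have "(Re z)\<^sup>2 + (Im z)\<^sup>2 \<le> rho\<^sup>2"
    using power_mono[OF z(1), of 2] by (simp add: cmod_power2)
  ultimately show ?thesis by (simp add: complex_eq_iff)
qed

lemma square_less_rho: "norm (z :: complex) < sqrt rho \<Longrightarrow> norm (z ^ 2) < rho"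
  using power_strict_mono[of "norm z" "sqrt rho" 2] rho_pos by (simp add: norm_power)

lemma rho_less_sqrt: "rho < sqrt rho"
  using rho_square_less rho_pos by (intro real_less_rsqrt) auto

lemma holomorphic_Q: "Q holomorphic_on ball 0 (sqrt rho)"
proof -
  have "eval_fps (gf_T :: complex fps) holomorphic_on ball 0 rho"
    by (rule holomorphic_on_eval_fps) (simp add: conv_radius_gf_T_complex)
  then have "eval_fps (gf_T :: complex fps) \<circ> (\<lambda>z. z ^ 2) holomorphic_on ball 0 (sqrt rho)"
    by (rule holomorphic_on_compose_gen[rotated])
       (auto simp: square_less_rho intro!: holomorphic_intros)
  then show ?thesis unfolding Q_def o_def by (intro holomorphic_intros)
qed

text \<open>
  The value \<open>- Q'(\<rho>)\<close>, as a sum of nonnegative terms.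
\<close>

definition Q_slope :: real where
  "Q_slope = 2 + 2 * rho * eval_fps gf_T (rho ^ 2) + 2 * rho ^ 3 * eval_fps (fps_deriv gf_T) (rho ^ 2)"

lemma abs_conv_fps_deriv_gf_T:
  assumes "\<bar>x\<bar> < rho" shows "abs_conv (fps_deriv gf_T :: real fps) x"
  using fps_conv_radius_deriv[of "gf_T :: real fps"] assms
  by (intro abs_convI) (simp add: conv_radius_gf_T[symmetric] less_le_trans[of "ereal _" "ereal rho"])

lemma Q_slope_pos: "0 < Q_slope"
proof -
  have "0 \<le> eval_fps (fps_deriv gf_T :: real fps) (rho ^ 2)"
    unfolding eval_fps_def using abs_conv_fps_deriv_gf_T[of "rho^2"] rho_square_less rho_pos
    by (intro suminf_nonneg abs_conv_sums[THEN sums_summable]) (auto simp: gf_T_nth)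
  moreover have "0 \<le> eval_fps (gf_T :: real fps) (rho ^ 2)"
    using eval_gf_T_ge_1[of "rho^2"] abs_conv_gf_T_real[of "rho^2"] rho_square_less by simp
  ultimately show ?thesis using rho_pos unfolding Q_slope_def by (intro add_pos_nonneg) auto
qed

lemma deriv_Q_rho: "deriv Q (of_real rho) = of_real (- Q_slope)"
proof (rule DERIV_imp_deriv)
  let ?r = "complex_of_real rho"
  have "norm (?r ^ 2) < fps_conv_radius (gf_T :: complex fps)"
    using rho_square_less rho_pos by (simp add: conv_radius_gf_T_complex norm_power)
  note 1 = has_field_derivative_eval_fps[OF this]
  have "((\<lambda>z. eval_fps gf_T (z ^ 2)) has_field_derivative
      eval_fps (fps_deriv gf_T) (?r ^ 2) * (2 * ?r)) (at ?r)"
    by (rule DERIV_chain2[where f = "eval_fps gf_T" and g = "\<lambda>z. z ^ 2", OF 1]) (auto intro!: derivative_eq_intros)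
  note 2 = this
  have 3: "((\<lambda>z. z ^ 2) has_field_derivative 2 * ?r) (at ?r)"
    by (auto intro!: derivative_eq_intros)
  have 4: "((\<lambda>z. 1 - 2 * z) has_field_derivative - 2) (at ?r)"
    by (auto intro!: derivative_eq_intros)
  have "(Q has_field_derivative - 2 - (2 * ?r * eval_fps gf_T (?r ^ 2) +
      eval_fps (fps_deriv gf_T) (?r ^ 2) * (2 * ?r) * ?r ^ 2)) (at ?r)"
    using DERIV_diff[OF 4 DERIV_mult[OF 3 2]] unfolding Q_def .
  also have "eval_fps gf_T (?r ^ 2) = of_real (eval_fps gf_T (rho ^ 2))"
    using eval_fps_of_real(2)[OF gf_T_complex_of_real, of "rho ^ 2"] abs_conv_gf_T_real[of "rho ^ 2"]
      rho_square_less by simp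
  also have "eval_fps (fps_deriv gf_T) (?r ^ 2) = of_real (eval_fps (fps_deriv gf_T) (rho ^ 2))"
    using eval_fps_of_real(2)[of "fps_deriv gf_T" "fps_deriv gf_T" "rho ^ 2"]
      abs_conv_fps_deriv_gf_T[of "rho ^ 2"] rho_square_less
    by (simp add: gf_T_complex_of_real)
  finally show "(Q has_field_derivative of_real (- Q_slope)) (at ?r)"
    by (simp add: Q_slope_def power2_eq_square power3_eq_cube algebra_simps)
qed

text \<open>
  The quotient of the discriminant by its linear factor \<open>1 - z/\<rho>\<close>, with the removable singularity
  filled in.
\<close>

definition R :: "complex \<Rightarrow> complex" where
  "R z = - of_real rho * (if z = of_real rho then deriv Q (of_real rho)
     else (Q z - Q (of_real rho)) / (z - of_real rho))"

lemma Q_rho: "Q (of_real rho) = 0"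
proof -
  have "Q (of_real rho) = of_real (Q_real rho)"
    using eval_fps_of_real(2)[OF gf_T_complex_of_real, of "rho ^ 2"] abs_conv_gf_T_real[of "rho ^ 2"]
      rho_square_less by (simp add: Q_def Q_real_def)
  then show ?thesis by (simp add: Q_real_rho)
qed

lemma holomorphic_R: "R holomorphic_on ball 0 (sqrt rho)"
  unfolding R_def by (intro holomorphic_on_mult holomorphic_on_const pole_lemma_open holomorphic_Q) auto

lemma Q_factor: "Q z = (1 - z / of_real rho) * R z"
proof (cases "z = of_real rho")
  case False
  then have "1 - z / of_real rho = (z - of_real rho) / (- of_real rho)"
    using rho_pos by (simp add: field_simps)
  then show ?thesis using False rho_pos by (simp add: R_def Q_rho)
qed (use rho_pos in \<open>simp add: Q_rho\<close>)

lemma R_rho: "R (of_real rho) = of_real (rho * Q_slope)"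
  by (simp add: R_def deriv_Q_rho)

lemma R_0: "R 0 = 1"
  using Q_factor[of 0] by (simp add: Q_def)

lemma R_nonzero: "norm z \<le> rho \<Longrightarrow> R z \<noteq> 0"
  using Q_zero_imp_eq_rho[of z] Q_factor[of z] R_rho rho_pos Q_slope_pos by auto

text \<open>
  Compactness of the closed disc gives a margin.
\<close>

lemma R_nonzero_larger_disc:
  obtains r where "rho < r" "r \<le> sqrt rho" "\<And>z. norm z < r \<Longrightarrow> R z \<noteq> 0"
proof -
  let ?U = "ball 0 (sqrt rho) \<inter> R -` (- {0})"
  have "open ?U"
    by (rule continuous_open_preimage[OF holomorphic_on_imp_continuous_on[OF holomorphic_R]]) auto
  moreover have "cball 0 rho \<subseteq> ?U" using R_nonzero rho_less_sqrt by auto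
  ultimately obtain e where e: "e > 0" "(\<Union>x\<in>cball 0 rho. ball x e) \<subseteq> ?U"
    using compact_subset_open_imp_ball_epsilon_subset[OF compact_cball] by metis
  have in_U: "z \<in> ?U" if z: "norm z < rho + e" for z :: complex
  proof -
    have "\<exists>x\<in>cball 0 rho. z \<in> ball x e"
    proof (cases "norm z \<le> rho")
      case False
      (* the radial projection of z to the circle of radius rho *)
      define x where "x = of_real (rho / norm z) * z"
      have norm_x: "norm x = rho" using False rho_pos unfolding x_def norm_mult norm_of_real by (auto simp: abs_divide)
      have "z - x = of_real (1 - rho / norm z) * z" by (simp add: x_def algebra_simps)
      then have "norm (z - x) = \<bar>1 - rho / norm z\<bar> * norm z" by (simp only: norm_mult norm_of_real)
      moreover have "z \<noteq> 0" using False rho_pos by auto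
      then have "\<bar>1 - rho / norm z\<bar> = 1 - rho / norm z"
        using False by (intro abs_of_nonneg) simp
      ultimately have "norm (z - x) = norm z - rho"
        using \<open>z \<noteq> 0\<close> by (simp add: left_diff_distrib)
      then show ?thesis
        using z norm_x by (intro bexI[of _ x]) (auto simp: dist_norm norm_minus_commute)
    qed (use e(1) in \<open>auto intro: bexI[of _ z]\<close>)
    then show ?thesis using e(2) by blast
  qed
  show ?thesis
    by (rule that[of "min (rho + e) (sqrt rho)"]) (use e(1) in_U rho_less_sqrt in auto)
qed

section \<open>Coefficient asymptotics of \<open>1 / (1 - z T(z))\<close>\<close>

text \<open>
  The power series of \<open>(1 - z/\<rho>)\<^bsup>-1/2\<^esup>\<close>.
\<close>

definition inv_sqrt_one_minus_z_over_rho :: "complex fps" where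
  "inv_sqrt_one_minus_z_over_rho = fps_binomial (-1/2) oo (fps_const (- 1 / of_real rho) * fps_X)"

lemma inv_sqrt_one_minus_z_over_rho_square: "inv_sqrt_one_minus_z_over_rho ^ 2 * (1 - fps_const (1 / of_real rho) * fps_X) = 1"
proof -
  let ?c = "fps_const (- 1 / of_real rho) * fps_X :: complex fps"
  have "(fps_binomial (-1/2) * fps_binomial (-1/2)) * (1 + fps_X) = (1 :: complex fps)"
    by (simp add: fps_binomial_add_mult[symmetric] fps_binomial_minus_one inverse_mult_eq_1)
  then have "((fps_binomial (-1/2) * fps_binomial (-1/2)) * (1 + fps_X)) oo ?c = 1 oo ?c"
    by simp
  then have "inv_sqrt_one_minus_z_over_rho ^ 2 * (1 + ?c) = 1"
    by (simp add: fps_compose_mult_distrib fps_compose_add_distrib inv_sqrt_one_minus_z_over_rho_def power2_eq_square)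
  moreover have "1 + ?c = 1 - fps_const (1 / of_real rho) * fps_X"
    by (simp add: fps_eq_iff)
  ultimately show ?thesis by (simp only:)
qed

lemma inv_sqrt_one_minus_z_over_rho_nth:
  "inv_sqrt_one_minus_z_over_rho $ n * of_real rho ^ n = ((- 1 / 2) gchoose n) * (- 1) ^ n"
proof -
  have "(- 1 / of_real rho) ^ n * of_real rho ^ n = (- 1 :: complex) ^ n"
    using rho_pos by (simp flip: power_mult_distrib)
  then show ?thesis
    unfolding inv_sqrt_one_minus_z_over_rho_def fps_nth_compose_linear fps_binomial_nth by (metis mult.assoc mult.commute)
qed

text \<open>
  A disc is convex, so the zero-free function \<open>R\<close> has a holomorphic logarithm there.
\<close>

lemma inverse_sqrt_R_exists:
  obtains r h where "rho < r" "h holomorphic_on ball 0 r" "h 0 = 1"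
    "\<And>z. norm z < r \<Longrightarrow> h z ^ 2 * R z = 1"
proof -
  obtain r where r: "rho < r" "r \<le> sqrt rho" "\<And>z. norm z < r \<Longrightarrow> R z \<noteq> 0"
    using R_nonzero_larger_disc by blast
  have "R holomorphic_on ball 0 r" using r by (intro holomorphic_on_subset[OF holomorphic_R]) auto
  note holo = this
  obtain g where g: "g holomorphic_on ball 0 r" "\<And>z. z \<in> ball 0 r \<Longrightarrow> exp (g z) = R z"
    by (rule holomorphic_logarithm_exists[of "ball 0 r" R 0]) (use r rho_pos holo in auto)
  define h where "h = (\<lambda>z. exp (g 0 / 2) * exp (- g z / 2))"
  have dbl: "exp (w / 2) ^ 2 = exp w" for w :: complex by (simp flip: exp_double)
  show ?thesis
  proof (rule that[of r h])
    show "h holomorphic_on ball 0 r" unfolding h_def by (intro holomorphic_intros g) auto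
    show "h 0 = 1" by (simp add: h_def flip: exp_add)
    have "exp (g 0) = 1" using g(2)[of 0] r rho_pos R_0 by simp
    moreover fix z :: complex assume "norm z < r"
    ultimately show "h z ^ 2 * R z = 1"
      using g(2)[of z, symmetric] unfolding h_def power_mult_distrib dbl by (simp add: exp_minus)
  qed fact
qed

lemma inv_sqrt_one_minus_z_over_rho_asymptotics:
  obtains c :: complex where "c \<noteq> 0"
    "(\<lambda>n. of_real (sqrt (real n + 1)) * (inv_sqrt_one_minus_z_over_rho $ n * of_real rho ^ n)) \<longlonglongrightarrow> c"
proof -
  let ?g = "\<lambda>n. ((- 1 / 2 :: complex) gchoose n) * (-1) ^ n"
  have "(\<lambda>n. ((- 1 / 2 :: complex) gchoose n) / ((-1) ^ n / exp ((- 1 / 2 + 1) * of_real (ln (real n)))))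
      \<longlonglongrightarrow> inverse (Gamma (- (- 1 / 2)))"
    by (rule gbinomial_asymptotic)
  moreover have "\<forall>\<^sub>F n in sequentially.
      ((- 1 / 2 :: complex) gchoose n) / ((-1) ^ n / exp ((- 1 / 2 + 1) * of_real (ln (real n)))) =
      of_real (sqrt (real n)) * ?g n"
    using eventually_gt_at_top[of 0]
  proof eventually_elim
    case (elim n)
    have "exp ((- 1 / 2 + 1) * of_real (ln (real n))) = complex_of_real (exp (ln (real n) / 2))"
      by (simp flip: exp_of_real)
    also have "exp (ln (real n) / 2) = sqrt (real n)"
      using elim by (simp add: powr_half_sqrt[symmetric] powr_def)
    finally show ?case by (simp add: power_minus1_even field_simps flip: power_mult_distrib)
  qed
  ultimately have 1: "(\<lambda>n. of_real (sqrt (real n)) * ?g n) \<longlonglongrightarrow> inverse (Gamma (1 / 2))"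
    by (simp add: tendsto_cong)
  have "(\<lambda>n. of_real (sqrt (real n + 1) / sqrt (real n)) * (of_real (sqrt (real n)) * ?g n))
      \<longlonglongrightarrow> of_real 1 * inverse (Gamma (1 / 2))"
    by (intro tendsto_mult tendsto_of_real 1) real_asymp
  moreover have "\<forall>\<^sub>F n in sequentially.
      of_real (sqrt (real n + 1) / sqrt (real n)) * (of_real (sqrt (real n)) * ?g n) =
      of_real (sqrt (real n + 1)) * (inv_sqrt_one_minus_z_over_rho $ n * of_real rho ^ n)"
    using eventually_gt_at_top[of 0]
  proof eventually_elim
    case (elim n)
    then show ?case by (simp add: inv_sqrt_one_minus_z_over_rho_nth)
  qed
  ultimately have "(\<lambda>n. of_real (sqrt (real n + 1)) * (inv_sqrt_one_minus_z_over_rho $ n * of_real rho ^ n))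
      \<longlonglongrightarrow> inverse (Gamma (1 / 2))"
    by (simp add: tendsto_cong)
  moreover have "inverse (Gamma (1 / 2 :: complex)) \<noteq> 0"
    by (simp add: Gamma_one_half_complex)
  ultimately show ?thesis using that by blast
qed

text \<open>
  Both sides are square roots of the same power series, so they agree up to a sign, which the
  constant coefficient decides.
\<close>

lemma renewal_factor:
  assumes "rho < r" "h holomorphic_on ball 0 r" "h 0 = 1" "\<And>z. norm z < r \<Longrightarrow> h z ^ 2 * R z = 1"
  shows "inverse (1 - fps_X * gf_T) = fps_expansion h 0 * inv_sqrt_one_minus_z_over_rho"
proof -
  let ?E = "1 - fps_X * gf_T :: complex fps" and ?W = "fps_expansion h 0"
  have "r > 0" using assms(1) rho_pos by simp
  then have W: "h has_fps_expansion ?W"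
    using assms(2) by (intro has_fps_expansion_fps_expansion[of "ball 0 r"]) auto
  have "0 < fps_conv_radius (gf_T :: complex fps)"
    using rho_pos by (simp add: conv_radius_gf_T_complex)
  then have "eval_fps gf_T has_fps_expansion (gf_T :: complex fps)"
    by (rule eval_fps_has_fps_expansion)
  then have "(\<lambda>z. (1 - z * eval_fps gf_T z) * (1 - z * eval_fps gf_T z) * (h z * h z)) has_fps_expansion
      ?E * ?E * (?W * ?W)"
    by (intro fps_expansion_intros W)
  moreover have "\<forall>\<^sub>F z in nhds 0. (1 - z * eval_fps gf_T z) * (1 - z * eval_fps gf_T z) * (h z * h z) =
      1 - (1 / of_real rho) * z"
  proof -
    have "\<forall>\<^sub>F z in nhds (0::complex). z \<in> ball 0 rho"
      using rho_pos by (intro eventually_nhds_in_open) auto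
    then show ?thesis
    proof eventually_elim
      case (elim z)
      have "(1 - z * eval_fps gf_T z) * (1 - z * eval_fps gf_T z) * (h z * h z) = Q z * h z ^ 2"
        using Q_eq_square[of z] elim by (simp add: power2_eq_square)
      also have "\<dots> = (1 - z / of_real rho) * (h z ^ 2 * R z)"
        by (simp add: Q_factor[of z])
      also have "h z ^ 2 * R z = 1" using elim assms by auto
      finally show ?case by simp
    qed
  qed
  moreover have "(\<lambda>z. 1 - (1 / of_real rho) * z) has_fps_expansion
      (1 - fps_const (1 / of_real rho :: complex) * fps_X)"
    by (intro fps_expansion_intros)
  ultimately have "?E * ?E * (?W * ?W) = 1 - fps_const (1 / of_real rho) * fps_X"
    by (intro fps_expansion_unique_complex) (simp_all only: has_fps_expansion_cong[OF _ refl])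
  then have "(?E * (?W * inv_sqrt_one_minus_z_over_rho)) ^ 2 = 1"
    using inv_sqrt_one_minus_z_over_rho_square by (simp add: power2_eq_square mult_ac)
  then have "?E * (?W * inv_sqrt_one_minus_z_over_rho) = 1 \<or> ?E * (?W * inv_sqrt_one_minus_z_over_rho) = -1"
    by (simp only: power2_eq_1_iff)
  moreover have "(?E * (?W * inv_sqrt_one_minus_z_over_rho)) $ 0 = 1"
    using assms(3) by (simp add: fps_expansion_def inv_sqrt_one_minus_z_over_rho_def)
  then have "?E * (?W * inv_sqrt_one_minus_z_over_rho) \<noteq> -1" by (metis fps_neg_nth fps_one_nth one_neq_neg_one)
  ultimately show ?thesis by (intro fps_inverse_unique) auto
qed

text \<open>
  Needed because the factorization lives over the complex numbers and the tolls over the reals.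
\<close>

lemma renewal_complex:
  "inverse (1 - fps_X * gf_T :: complex fps) $ n = of_real (inverse (1 - fps_X * gf_T) $ n)"
proof -
  let ?d = "inverse (1 - fps_X * gf_T :: real fps)"
  have "?d * (1 - fps_X * gf_T) = 1" by (rule inverse_mult_eq_1) simp
  moreover have e: "(1 - fps_X * gf_T :: complex fps) $ i = of_real ((1 - fps_X * gf_T) $ i)" for i
    by (cases i) (simp_all add: gf_T_nth)
  have "(Abs_fps (\<lambda>n. complex_of_real (?d $ n)) * (1 - fps_X * gf_T)) $ m =
      of_real ((?d * (1 - fps_X * gf_T)) $ m)" for m
    by (simp only: fps_mult_nth e fps_nth_Abs_fps of_real_sum of_real_mult)
  ultimately have "Abs_fps (\<lambda>n. complex_of_real (?d $ n)) * (1 - fps_X * gf_T) = 1"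
    by (simp only: fps_eq_iff) simp
  then have "inverse (1 - fps_X * gf_T) = Abs_fps (\<lambda>n. complex_of_real (?d $ n))"
    by (intro fps_inverse_unique) (simp add: mult.commute)
  then show ?thesis by simp
qed

text \<open>
  Since \<open>R\<^bsup>-1/2\<^esup>\<close> is analytic beyond \<open>\<rho>\<close>, its coefficients are absorbed by the binomial series: the
  limit is the limit for \<open>(1 - z/\<rho>)\<^bsup>-1/2\<^esup>\<close> times the nonzero value of \<open>R\<^bsup>-1/2\<^esup>\<close> at \<open>\<rho>\<close>.
\<close>

lemma renewal_asymptotics:
  obtains c where "c \<noteq> 0"
    "(\<lambda>n. sqrt (real n + 1) * (inverse (1 - fps_X * gf_T) $ n * rho ^ n)) \<longlonglongrightarrow> c"
proof -
  let ?d = "inverse (1 - fps_X * gf_T :: real fps)"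
  obtain r h where h: "rho < r" "h holomorphic_on ball 0 r" "h 0 = 1"
    "\<And>z. norm z < r \<Longrightarrow> h z ^ 2 * R z = 1" using inverse_sqrt_R_exists by blast
  define W where "W = fps_expansion h 0"
  obtain c where c: "c \<noteq> 0"
    "(\<lambda>n. of_real (sqrt (real n + 1)) * (inv_sqrt_one_minus_z_over_rho $ n * of_real rho ^ n)) \<longlonglongrightarrow> c"
    by (rule inv_sqrt_one_minus_z_over_rho_asymptotics)
  have holo: "h holomorphic_on eball 0 (ereal r)" using h(2) by simp
  obtain s where s: "rho < s" "s < r" using dense[OF h(1)] by blast
  have "summable (\<lambda>n. norm (W $ n * of_real s ^ n))"
    using s rho_pos conv_radius_fps_expansion[OF holo]
    by (intro norm_summable_fps) (auto simp: W_def intro: less_le_trans[of _ "ereal r"])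
  then have "Bseq (\<lambda>n. norm (W $ n * of_real s ^ n))"
    by (rule convergent_imp_Bseq[OF convergentI[OF summable_LIMSEQ_zero]])
  then obtain K where K: "\<And>n. norm (W $ n) * s ^ n \<le> K"
    using s rho_pos by (auto simp: Bseq_def norm_mult norm_power)
  obtain C where C: "\<And>n. (real n + 1) powr 0 * (rho / s) ^ n \<le> C * (real n + 1) powr -(5/4)"
    using geometric_decay[of "rho / s" 0] s rho_pos by auto
  have "norm (W $ 0) \<le> K" using K[of 0] by simp
  then have K0: "0 \<le> K" by (rule order.trans[OF norm_ge_zero])
  have bound: "norm (W $ n * of_real rho ^ n) \<le> (K * C) * (real n + 1) powr -(5/4)" for n
  proof -
    have "norm (W $ n * of_real rho ^ n) = (norm (W $ n) * s ^ n) * (rho / s) ^ n"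
      using s rho_pos by (simp add: norm_mult norm_power power_divide)
    also have "\<dots> \<le> K * (C * (real n + 1) powr -(5/4))"
      using C[of n] K[of n] s rho_pos K0 by (intro mult_mono) auto
    finally show ?thesis by (simp add: mult_ac)
  qed
  have "(\<lambda>n. of_real (sqrt (real n + 1)) * (\<Sum>i\<le>n. (W $ i * of_real rho ^ i) *
      (inv_sqrt_one_minus_z_over_rho $ (n - i) * of_real rho ^ (n - i)))) \<longlonglongrightarrow> c * (\<Sum>n. W $ n * of_real rho ^ n)"
    by (rule convolution_asymptotics(1)[OF c(2) bound])
  moreover have "(\<Sum>i\<le>n. (W $ i * of_real rho ^ i) * (inv_sqrt_one_minus_z_over_rho $ (n - i) * of_real rho ^ (n - i))) =
      of_real (?d $ n * rho ^ n)" for n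
  proof -
    have "inverse (1 - fps_X * gf_T) = W * inv_sqrt_one_minus_z_over_rho"
      unfolding W_def by (rule renewal_factor[OF h])
    then have "of_real (?d $ n * rho ^ n) = (W * inv_sqrt_one_minus_z_over_rho) $ n * of_real rho ^ n"
      using renewal_complex[of n] by simp
    also have "\<dots> = (\<Sum>i\<le>n. (W $ i * of_real rho ^ i) * (inv_sqrt_one_minus_z_over_rho $ (n - i) * of_real rho ^ (n - i)))"
      by (rule fps_mult_nth_power)
    finally show ?thesis by simp
  qed
  moreover have "(\<Sum>n. W $ n * of_real rho ^ n) = h (of_real rho)"
    using eval_fps_expansion'[OF holo, of "of_real rho"] h(1) rho_pos
    by (simp add: W_def eval_fps_def)
  ultimately have lim: "(\<lambda>n. complex_of_real (sqrt (real n + 1) * (?d $ n * rho ^ n))) \<longlonglongrightarrow> c * h (of_real rho)"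
    by simp
  from tendsto_Re[OF this] have re: "(\<lambda>n. sqrt (real n + 1) * (?d $ n * rho ^ n)) \<longlonglongrightarrow> Re (c * h (of_real rho))"
    by simp
  have "of_real (Re (c * h (of_real rho))) = c * h (of_real rho)"
    using LIMSEQ_unique[OF tendsto_of_real[OF re] lim] .
  moreover have "h (of_real rho) \<noteq> 0" using h(4)[of "of_real rho"] h(1) rho_pos by auto
  ultimately have "Re (c * h (of_real rho)) \<noteq> 0" using c(1) by (metis mult_eq_0_iff of_real_0)
  then show ?thesis using re that by blast
qed

section \<open>The square root expansion\<close>

text \<open>
  Two numbers with argument in \<open>(-\<pi>/4, \<pi>/4)\<close> have a product in the right half plane. This is what
  makes the product of two principal square roots again a principal one.
\<close>

lemma Re_mult_pos_of_squares:
  assumes "0 < Re p" "0 < Re q" "0 < Re (p ^ 2)" "0 < Re (q ^ 2)"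
  shows "0 < Re (p * q)"
proof -
  have "\<bar>Im p\<bar> < Re p" "\<bar>Im q\<bar> < Re q"
    using assms power2_less_imp_less[of "\<bar>Im p\<bar>" "Re p"] power2_less_imp_less[of "\<bar>Im q\<bar>" "Re q"]
    by (simp_all add: Re_power2)
  then have "\<bar>Im p * Im q\<bar> < Re p * Re q"
    unfolding abs_mult by (intro mult_strict_mono') auto
  then show ?thesis by simp
qed

text \<open>
  Near \<open>\<rho>\<close> one has \<open>1 - z T(z) = csqrt (1 - z/\<rho>) csqrt (R(z))\<close>: the squares agree, and both sides have
  nonnegative real part, the left one because \<open>|z T(z)| \<le> 1\<close>. With \<open>p = csqrt (1 - z/\<rho>)\<close> the error
  divided by \<open>p\<close> is \<open>p/z - csqrt (R(z))/z + a\<close>, which tends to zero for \<open>a = sqrt (R(\<rho>))/\<rho>\<close>.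
\<close>

lemma square_root_expansion_gf_T: "square_root_expansion (sqrt (rho * Q_slope) / rho)"
  unfolding square_root_expansion_def
proof (rule smalloI_tendsto)
  let ?r = "complex_of_real rho"
  let ?F = "at ?r within ball 0 rho"
  define a where "a = complex_of_real (sqrt (rho * Q_slope) / rho)"
  define p where "p = (\<lambda>z. csqrt (1 - z / ?r))"
  have u_pos: "0 < Re (1 - z / ?r)" if "norm z < rho" for z
    using that rho_pos complex_Re_le_cmod[of z] by (simp add: Re_divide_of_real field_simps)
  have csqrt_pos: "0 < Re (csqrt w)" if "0 < Re w" for w
    using that by (metis Re_power2 Re_csqrt csqrt_principal less_irrefl not_less power2_csqrt
        power_zero_numeral zero_le_power2 diff_0 neg_le_0_iff_le)
  have inball: "\<forall>\<^sub>F z in ?F. norm z < rho"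
    unfolding eventually_at_filter by (rule always_eventually) auto
  have p_nz: "p z \<noteq> 0" if "norm z < rho" for z
    using csqrt_pos[OF u_pos[OF that]] by (auto simp: p_def)
  show "\<forall>\<^sub>F z in ?F. csqrt (1 - z / ?r) \<noteq> 0"
    using inball by eventually_elim (use p_nz in \<open>simp add: p_def\<close>)
  have cont_R: "(R \<longlongrightarrow> R ?r) ?F"
  proof -
    have "continuous (at ?r) R"
      using holomorphic_R rho_less_sqrt rho_pos
      by (intro continuous_on_interior[OF holomorphic_on_imp_continuous_on[OF holomorphic_R]])
         (simp add: interior_open)
    then have "(R \<longlongrightarrow> R ?r) (at ?r)" by (simp add: isCont_def)
    then show ?thesis by (rule tendsto_within_subset) simp
  qed
  have R_pos: "0 < Re (R ?r)" using rho_pos Q_slope_pos by (simp add: R_rho)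
  have csqrt_R: "((\<lambda>z. csqrt (R z)) \<longlongrightarrow> csqrt (R ?r)) ?F"
    by (rule isCont_tendsto_compose[OF continuous_at_csqrt cont_R])
       (use R_pos in \<open>auto simp: complex_nonpos_Reals_iff\<close>)
  have R_pos_ev: "\<forall>\<^sub>F z in ?F. 0 < Re (R z)"
    by (rule order_tendstoD(1)[OF tendsto_Re[OF cont_R] R_pos])
  have main: "\<forall>\<^sub>F z in ?F. p z / z - csqrt (R z) / z + a =
      (eval_fps gf_T z - (1 / ?r - a * csqrt (1 - z / ?r))) / csqrt (1 - z / ?r)"
  proof -
    have "\<forall>\<^sub>F z in ?F. z \<noteq> 0"
      using tendsto_imp_eventually_ne[OF tendsto_ident_at, of ?r 0 "ball 0 rho"] rho_pos by simp
    with inball R_pos_ev show ?thesis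
    proof eventually_elim
      case (elim z)
      define q where "q = csqrt (R z)"
      have u: "p z ^ 2 = 1 - z / ?r" by (simp add: p_def)
      have sq: "(1 - z * eval_fps gf_T z) ^ 2 = (p z * q) ^ 2"
        using elim Q_eq_square[of z] Q_factor[of z] by (simp add: p_def q_def power_mult_distrib)
      have pq: "0 < Re (p z * q)"
      proof (rule Re_mult_pos_of_squares)
        show "0 < Re (p z)" unfolding p_def by (rule csqrt_pos[OF u_pos[OF elim(1)]])
        show "0 < Re q" unfolding q_def by (rule csqrt_pos[OF elim(2)])
        show "0 < Re (p z ^ 2)" unfolding u by (rule u_pos[OF elim(1)])
        show "0 < Re (q ^ 2)" using elim(2) by (simp add: q_def)
      qed
      have "Re (z * eval_fps gf_T z) \<le> 1"
        using norm_gf_T_le[of z] elim(1) complex_Re_le_cmod[of "z * eval_fps gf_T z"] by linarith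
      then have "0 \<le> Re (1 - z * eval_fps gf_T z)" by simp
      moreover have "1 - z * eval_fps gf_T z = p z * q \<or> 1 - z * eval_fps gf_T z = - (p z * q)"
        using sq by (simp only: power2_eq_iff)
      ultimately have "1 - z * eval_fps gf_T z = p z * q"
        using pq by (metis uminus_complex.sel(1) neg_0_le_iff_le not_le)
      then have T: "eval_fps gf_T z = (1 - p z * q) / z" using elim by (simp add: field_simps)
      have "1 / z - 1 / ?r = p z ^ 2 / z" unfolding u using elim rho_pos by (simp add: field_simps)
      moreover have "eval_fps gf_T z - (1 / ?r - a * p z) = (1 / z - 1 / ?r) - p z * q / z + a * p z"
        unfolding T by (simp add: diff_divide_distrib)
      ultimately have "eval_fps gf_T z - (1 / ?r - a * p z) = p z * (p z / z - q / z + a)"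
        by (simp add: power2_eq_square algebra_simps)
      then show ?case using p_nz[OF elim(1)] by (simp add: p_def q_def)
    qed
  qed
  have "((\<lambda>z. p z / z - csqrt (R z) / z + a) \<longlongrightarrow> 0 / ?r - csqrt (R ?r) / ?r + a) ?F"
  proof (intro tendsto_intros csqrt_R)
    show "(p \<longlongrightarrow> 0) ?F"
    proof -
      have "((\<lambda>z. norm (1 - z / ?r)) \<longlongrightarrow> norm (1 - ?r / ?r)) ?F"
        using rho_pos by (intro tendsto_intros) auto
      then have "((\<lambda>z. sqrt (norm (1 - z / ?r))) \<longlongrightarrow> sqrt 0) ?F"
        using rho_pos by (intro tendsto_real_sqrt) simp
      moreover have "norm (p z) = sqrt (norm (1 - z / ?r))" for z
        by (metis p_def power2_csqrt norm_power norm_ge_zero real_sqrt_abs abs_of_nonneg)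
      ultimately have "((\<lambda>z. norm (p z)) \<longlongrightarrow> 0) ?F" by simp
      then show ?thesis by (rule tendsto_norm_zero_cancel)
    qed
  qed (use rho_pos in auto)
  moreover have "csqrt (R ?r) = of_real (sqrt (rho * Q_slope))"
    unfolding R_rho by (rule of_real_sqrt[symmetric]) (use rho_pos Q_slope_pos in simp)
  ultimately have "((\<lambda>z. p z / z - csqrt (R z) / z + a) \<longlongrightarrow> 0) ?F"
    by (simp add: a_def)
  with main show "((\<lambda>z. (eval_fps gf_T z - (1 / ?r - complex_of_real (sqrt (rho * Q_slope) / rho) *
      csqrt (1 - z / ?r))) / csqrt (1 - z / ?r)) \<longlongrightarrow> 0) ?F"
    unfolding a_def by (subst tendsto_cong[OF main[unfolded a_def], symmetric])
qed

section \<open>Decay of the coefficients of \<open>T\<close>\<close>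

text \<open>
  The factor that is left of the generating function of an additive functional after the common
  factor \<open>1 / (1 - z T)\<close> is removed.
\<close>

definition toll_gf :: "(rtree \<Rightarrow> real) \<Rightarrow> real fps" where
  "toll_gf \<phi> = tree_gf \<phi> + fps_X * (tree_gf (additive \<phi>) oo fps_X ^ 2)"

text \<open>
  The coefficients of this series form, after scaling by \<open>\<rho>\<^sup>n\<close>, the renewal sequence of the probability
  distribution that gives \<open>n + 1\<close> the mass \<open>t\<^sub>n \<rho>\<^bsup>n+1\<^esup>\<close>.
\<close>

abbreviation renewal :: "real fps" where
  "renewal \<equiv> inverse (1 - fps_X * gf_T)"

lemma tree_gf_additive_eq_toll_gf_mult: "tree_gf (additive \<phi>) = toll_gf \<phi> * renewal"
proof -
  let ?F = "tree_gf (additive \<phi>)"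
  have "?F * (1 - fps_X * gf_T) = toll_gf \<phi>"
    using tree_gf_additive[of \<phi>] by (simp add: toll_gf_def algebra_simps)
  then have "toll_gf \<phi> * renewal = ?F * ((1 - fps_X * gf_T) * renewal)"
    by (simp add: mult.assoc)
  also have "(1 - fps_X * gf_T) * renewal = 1" by (rule inverse_mult_eq_1') simp
  finally show ?thesis by simp
qed

lemma toll_gf_nth:
  "toll_gf \<phi> $ n = (\<Sum>t\<in>binary_trees n. \<phi> t) +
     (if odd n then \<Sum>t\<in>binary_trees ((n - 1) div 2). additive \<phi> t else 0)"
  by (cases n) (simp_all add: toll_gf_def tree_gf_nth fps_nth_compose_X_power)

lemma additive_nonneg: "(\<And>t. 0 \<le> \<phi> t) \<Longrightarrow> (0 :: real) \<le> additive \<phi> t"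
proof -
  assume "\<And>t. 0 \<le> \<phi> t"
  then have "0 \<le> (\<Sum>s\<in>#M. \<phi> s)" for M by (induction M) auto
  then show ?thesis unfolding additive_def .
qed

lemma toll_gf_nonneg: "(\<And>t. 0 \<le> \<phi> t) \<Longrightarrow> 0 \<le> toll_gf \<phi> $ n"
  by (auto simp: toll_gf_nth intro!: add_nonneg_nonneg sum_nonneg additive_nonneg)

lemma renewal_bound:
  obtains K where "\<And>n. norm (renewal $ n * rho ^ n) \<le> K / sqrt (real n + 1)"
proof -
  obtain c where "(\<lambda>n. sqrt (real n + 1) * (renewal $ n * rho ^ n)) \<longlonglongrightarrow> c"
    using renewal_asymptotics by blast
  then have "Bseq (\<lambda>n. sqrt (real n + 1) * (renewal $ n * rho ^ n))"
    by (intro convergent_imp_Bseq convergentI)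
  then obtain K where K: "\<And>n. norm (sqrt (real n + 1) * (renewal $ n * rho ^ n)) \<le> K"
    by (auto simp: Bseq_def)
  show ?thesis
  proof
    fix n
    show "norm (renewal $ n * rho ^ n) \<le> K / sqrt (real n + 1)"
      using K[of n] unfolding norm_mult by (simp add: field_simps)
  qed
qed

lemma abs_conv_gf_Tk:
  assumes "abs_conv (gf_T :: real fps) x"
  shows "abs_conv (gf_Tk k :: real fps) x"
proof -
  have "norm (gf_Tk k $ n * x ^ n) \<le> norm (gf_T $ n * x ^ n)" for n
    by (auto simp: gf_Tk_def gf_T_nth abs_mult finite_binary_trees intro!: mult_right_mono card_mono)
  then show ?thesis
    unfolding abs_conv_def
    by (intro summable_comparison_test'[OF assms[unfolded abs_conv_def], of 0]) simp
qed

lemma eval_gf_T_eq_1_plus: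
  assumes "abs_conv (gf_T :: real fps) x"
  shows "eval_fps gf_T x = 1 + eval_fps (gf_Tk 1) x"
proof -
  have "2 * gf_T = 2 * (1 + gf_Tk 1 :: real fps)"
    unfolding gf_T_rec using gf_Tk_Suc[of 0, where 'a = real] by (simp add: gf_Tk_0 distrib_left)
  moreover have "(2 :: real fps) \<noteq> 0" by (simp add: numeral_fps_const)
  ultimately have "gf_T = (1 + gf_Tk 1 :: real fps)" using mult_left_cancel by blast
  then show ?thesis
    using eval_fps_add'[of 1 x "gf_Tk 1"] abs_conv_gf_Tk[OF assms] by simp
qed

abbreviation protected_at_least :: "nat \<Rightarrow> rtree \<Rightarrow> real" where
  "protected_at_least k t \<equiv> of_bool (k \<le> protection_number t)"

lemma additive_protected_1: "binary t \<Longrightarrow> additive (protected_at_least 1) t = real (tree_size t)"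
  using num_protected_1[of t] of_nat_num_protected[of 1 t, where 'a = real] by simp

lemma tree_gf_additive_protected_1_nth:
  "tree_gf (additive (protected_at_least 1)) $ n = real n * gf_T $ n"
proof -
  have "tree_gf (additive (protected_at_least 1)) $ n = (\<Sum>t\<in>binary_trees n. real n)"
    unfolding tree_gf_nth
    by (intro sum.cong refl) (auto simp: binary_trees_def additive_protected_1 simp del: One_nat_def)
  then show ?thesis by (simp add: gf_T_nth)
qed

text \<open>
  The series \<open>z F(z\<^sup>2)\<close> converges in a disc of radius \<open>sqrt \<rho> > \<rho>\<close>, so polynomial growth of the scaled
  coefficients of \<open>F\<close> costs nothing.
\<close>

lemma odd_part_bound:
  fixes f :: "real fps"
  assumes "\<And>m. \<bar>f $ m * rho ^ m\<bar> \<le> A * (real m + 1) powr p"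
  obtains C where "\<And>n. \<bar>(fps_X * (f oo fps_X ^ 2)) $ n * rho ^ n\<bar> \<le> C * (real n + 1) powr -(5/4)"
proof -
  have A: "0 \<le> A" using order.trans[OF abs_ge_zero assms[of 0]] by simp
  obtain C where C: "\<And>n. (real n + 1) powr p * rho ^ n \<le> C * (real n + 1) powr -(5/4)"
    using geometric_decay[of rho p] rho_pos rho_le_half by auto
  have C0: "0 \<le> C" using order.trans[OF _ C[of 0], of 0] by simp
  show ?thesis
  proof
    fix n
    show "\<bar>(fps_X * (f oo fps_X ^ 2)) $ n * rho ^ n\<bar> \<le> (A * C * 2 powr (5/4)) * (real n + 1) powr -(5/4)"
    proof (cases "odd n")
      case False
      then show ?thesis using A C0 by (cases n) (auto simp: fps_nth_compose_X_power)
    next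
      case True
      then obtain m where m: "n = 2 * m + 1" by (rule oddE)
      have "rho ^ n = rho ^ m * rho ^ m * rho" by (simp add: m power_add mult_2)
      then have "\<bar>(fps_X * (f oo fps_X ^ 2)) $ n * rho ^ n\<bar> = \<bar>f $ m * rho ^ m\<bar> * rho ^ m * rho"
        using rho_pos by (simp add: m fps_nth_compose_X_power abs_mult)
      also have "\<dots> \<le> (A * (real m + 1) powr p) * rho ^ m * 1"
        using rho_pos rho_le_half A by (intro mult_mono assms) auto
      also have "\<dots> = A * ((real m + 1) powr p * rho ^ m)" by simp
      also have "\<dots> \<le> A * (C * (real m + 1) powr -(5/4))" by (intro mult_left_mono C A)
      also have "real m + 1 = (real n + 1) / 2" by (simp add: m)
      also have "\<dots> powr -(5/4) = (real n + 1) powr -(5/4) * 2 powr (5/4)"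
        by (simp add: powr_divide powr_minus_divide)
      finally show ?thesis by (simp add: mult_ac)
    qed
  qed
qed

lemma gf_T_coeff_rho_bounded: obtains C where "\<And>n. gf_T $ n * rho ^ n \<le> C"
proof
  fix n
  show "gf_T $ n * rho ^ n \<le> (\<Sum>n. norm (gf_T $ n * rho ^ n))"
    using sum_le_suminf[of "\<lambda>n. norm (gf_T $ n * rho ^ n)" "{n}"] abs_conv_gf_T_rho rho_pos
    by (simp add: abs_conv_def gf_T_nth)
qed

text \<open>
  The number \<open>n t\<^sub>n\<close> is itself a coefficient of a total, namely for the toll that marks internal vertices.
  Boundedness of \<open>t\<^sub>n \<rho>\<^sup>n\<close> gives a summable toll series and thus \<open>t\<^sub>n \<rho>\<^sup>n = O(1/n)\<close>; feeding this bound into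
  the convolution once more gains the missing factor \<open>n\<^bsup>-1/2\<^esup>\<close>.
\<close>

lemma gf_T_coeff_decay:
  obtains C where "\<And>n. gf_T $ n * rho ^ n \<le> C * (real n + 1) powr -(3/2)"
proof -
  let ?v = "\<lambda>n. toll_gf (protected_at_least 1) $ n * rho ^ n" and ?u = "\<lambda>n. renewal $ n * rho ^ n"
  let ?F = "tree_gf (additive (protected_at_least 1))"
  define S where "S = (\<Sum>n. norm (?v n))"
  have t0: "0 \<le> gf_T $ n * rho ^ n" for n using rho_pos by (simp add: gf_T_nth)
  have F_eq: "?F = fps_X * fps_deriv gf_T"
    by (rule fps_ext) (use tree_gf_additive_protected_1_nth in \<open>simp split: nat_diff_split add: fps_eq_iff\<close>)
  have "abs_conv (gf_Tk 1) rho" by (rule abs_conv_gf_Tk[OF abs_conv_gf_T_rho])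
  moreover have "abs_conv ?F (rho ^ 2)"
    unfolding F_eq using rho_square_less by (intro abs_conv_mult abs_conv_X abs_conv_fps_deriv_gf_T) simp
  ultimately have sv: "summable (\<lambda>n. norm (?v n))"
    unfolding toll_gf_def gf_Tk_eq abs_conv_def[symmetric]
    by (intro abs_conv_add abs_conv_mult abs_conv_X abs_conv_compose_square)
  obtain K where K: "\<And>n. norm (?u n) \<le> K / sqrt (real n + 1)"
    using renewal_bound by blast
  have K0: "0 \<le> K" using order.trans[OF norm_ge_zero K[of 0]] by simp
  have conv: "real n * (gf_T $ n * rho ^ n) = (\<Sum>i\<le>n. ?v i * ?u (n - i))" for n
    using fps_mult_nth_power[of "toll_gf (protected_at_least 1)" renewal n rho]
    unfolding tree_gf_additive_eq_toll_gf_mult[symmetric] tree_gf_additive_protected_1_nth by simp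
  (* first round: the renewal coefficients are only used to be bounded *)
  have crude: "real n * (gf_T $ n * rho ^ n) \<le> K * S" for n
  proof -
    have "real n * (gf_T $ n * rho ^ n) \<le> norm (\<Sum>i\<le>n. ?v i * ?u (n - i))" unfolding conv by simp
    also have "\<dots> \<le> (\<Sum>i\<le>n. norm (?v i) * K)"
    proof (rule order.trans[OF norm_sum], rule sum_mono)
      fix i
      have "K / sqrt (real (n - i) + 1) \<le> K / 1" using K0 by (intro divide_left_mono) auto
      then have "norm (?u (n - i)) \<le> K" using K[of "n - i"] by linarith
      then show "norm (?v i * ?u (n - i)) \<le> norm (?v i) * K"
        unfolding norm_mult by (intro mult_left_mono) auto
    qed
    also have "\<dots> = (\<Sum>i\<le>n. norm (?v i)) * K" by (rule sum_distrib_right[symmetric])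
    also have "\<dots> \<le> S * K" unfolding S_def by (intro mult_right_mono sum_le_suminf sv K0) auto
    finally show ?thesis by (simp add: mult.commute)
  qed
  obtain C1 where C1: "\<And>n. gf_T $ n * rho ^ n \<le> C1"
    using gf_T_coeff_rho_bounded by blast
  have t_le: "gf_T $ n * rho ^ n \<le> (K * S + C1) / (real n + 1)" for n
    using crude[of n] C1[of n] by (simp add: field_simps)
  have F_le: "\<bar>?F $ m * rho ^ m\<bar> \<le> (K * S) * (real m + 1) powr 0" for m
    using crude[of m] t0[of m] unfolding tree_gf_additive_protected_1_nth mult.assoc by simp
  obtain C2 where C2: "\<And>n. \<bar>(fps_X * (?F oo fps_X ^ 2)) $ n * rho ^ n\<bar> \<le> C2 * (real n + 1) powr -(5/4)"
    using odd_part_bound[OF F_le] by blast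
  have C20: "0 \<le> C2" using order.trans[OF abs_ge_zero C2[of 0]] by simp
  have v_le: "norm (?v n) \<le> (K * S + C1 + C2) / (real n + 1)" for n
  proof -
    have "(real n + 1) powr -(5/4) \<le> (real n + 1) powr -1" by (intro powr_mono) auto
    then have "C2 * (real n + 1) powr -(5/4) \<le> C2 / (real n + 1)"
      using mult_left_mono[OF _ C20] by (fastforce simp: powr_minus field_simps)
    then have 1: "\<bar>(fps_X * (?F oo fps_X ^ 2)) $ n * rho ^ n\<bar> \<le> C2 / (real n + 1)" using C2[of n] by linarith
    have "0 \<le> gf_Tk 1 $ n * rho ^ n" "gf_Tk 1 $ n * rho ^ n \<le> gf_T $ n * rho ^ n"
      using rho_pos by (auto simp: gf_Tk_def gf_T_nth finite_binary_trees intro!: mult_right_mono card_mono)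
    then have 2: "\<bar>gf_Tk 1 $ n * rho ^ n\<bar> \<le> (K * S + C1) / (real n + 1)" using t_le[of n] by linarith
    have "?v n = gf_Tk 1 $ n * rho ^ n + (fps_X * (?F oo fps_X ^ 2)) $ n * rho ^ n"
      unfolding toll_gf_def gf_Tk_eq by (simp only: fps_add_nth distrib_right)
    then have "norm (?v n) \<le> \<bar>gf_Tk 1 $ n * rho ^ n\<bar> + \<bar>(fps_X * (?F oo fps_X ^ 2)) $ n * rho ^ n\<bar>"
      by simp
    also have "\<dots> \<le> (K * S + C1) / (real n + 1) + C2 / (real n + 1)" by (intro add_mono 1 2)
    finally show ?thesis by (simp add: add_divide_distrib)
  qed
  (* second round: the toll coefficients are now known to be O(1/n) *)
  obtain M where M: "\<And>n. norm (\<Sum>i\<le>n. ?v i * ?u (n - i)) \<le> M / sqrt (real n + 1)"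
    using convolution_bound[OF K v_le sv] by blast
  have M0: "0 \<le> M" using order.trans[OF norm_ge_zero M[of 0]] by simp
  have C10: "0 \<le> C1" using order.trans[OF t0 C1[of 0]] .
  show ?thesis
  proof
    fix n
    have powr: "(real n + 1) powr -(3/2) = 1 / (real n + 1) / sqrt (real n + 1)"
      using powr_add[of "real n + 1" 1 "1/2"] by (simp add: powr_minus_divide powr_half_sqrt)
    show "gf_T $ n * rho ^ n \<le> (2 * M + C1) * (real n + 1) powr -(3/2)"
    proof (cases "n = 0")
      case True
      then show ?thesis using C1[of 0] M0 by simp
    next
      case False
      have "real n * (gf_T $ n * rho ^ n) \<le> M / sqrt (real n + 1)"
        using M[of n] unfolding conv[symmetric] by simp
      then have "2 * real n * (gf_T $ n * rho ^ n) \<le> 2 * M / sqrt (real n + 1)" by simp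
      moreover have "(real n + 1) * (gf_T $ n * rho ^ n) \<le> 2 * real n * (gf_T $ n * rho ^ n)"
        using False t0[of n] by (intro mult_right_mono) auto
      ultimately have "(real n + 1) * (gf_T $ n * rho ^ n) \<le> 2 * M / sqrt (real n + 1)" by simp
      then have "gf_T $ n * rho ^ n \<le> 2 * M / sqrt (real n + 1) / (real n + 1)"
        by (subst pos_le_divide_eq) (simp_all only: mult.commute of_nat_0_le_iff add_nonneg_pos zero_less_one)
      also have "\<dots> = 2 * M * (real n + 1) powr -(3/2)" unfolding powr by simp
      also have "\<dots> \<le> (2 * M + C1) * (real n + 1) powr -(3/2)"
        using C10 by (intro mult_right_mono) auto
      finally show ?thesis .
    qed
  qed
qed

section \<open>Totals of slowly growing tolls\<close>

text \<open>
  Growth at most like the fourth root of the size keeps the toll series within the reach of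
  \<open>convolution_asymptotics\<close>, since \<open>-3/2 + 1/4 = -5/4\<close>.
\<close>

locale slow_toll =
  fixes \<phi> :: "rtree \<Rightarrow> real" and A :: real
  assumes nonneg: "\<And>t. 0 \<le> \<phi> t"
    and toll_leaf: "\<phi> (RNode {#}) = 0"
    and slow: "\<And>t. binary t \<Longrightarrow> \<phi> t \<le> A * (real (tree_size t) + 1) powr (1/4)"
begin

lemma A_nonneg: "0 \<le> A"
  using slow[of "RNode {#}"] toll_leaf by (simp add: binary_RNode internal_subtrees_def)

text \<open>
  A leaf contributes nothing, and a tree of size \<open>n\<close> has \<open>n\<close> internal vertices.
\<close>

lemma additive_le: "binary t \<Longrightarrow>
   additive \<phi> t \<le> A * real (tree_size t) * (real (tree_size t) + 1) powr (1/4)"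
proof (induction t rule: binary_induct)
  case leaf
  then show ?case by (simp add: additive_leaf toll_leaf size_internal_subtrees internal_subtrees_def)
next
  case (node l r)
  let ?t = "RNode {#l, r#}"
  let ?p = "(real (tree_size ?t) + 1) powr (1/4)"
  have size: "tree_size ?t = Suc (tree_size l + tree_size r)" by (rule size_internal_subtrees)
  have "additive \<phi> s \<le> A * real (tree_size s) * ?p" if "s \<in> {l, r}" for s
  proof -
    have "additive \<phi> s \<le> A * real (tree_size s) * (real (tree_size s) + 1) powr (1/4)"
      using node that by auto
    also have "\<dots> \<le> A * real (tree_size s) * ?p"
      using A_nonneg that unfolding size by (intro mult_left_mono powr_mono2) auto
    finally show ?thesis .
  qed
  then have "additive \<phi> l \<le> A * real (tree_size l) * ?p" "additive \<phi> r \<le> A * real (tree_size r) * ?p"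
    by blast+
  moreover have "\<phi> ?t \<le> A * ?p" using node by (intro slow) (simp add: binary_RNode)
  moreover have "A * real (tree_size ?t) * ?p =
      A * ?p + (A * real (tree_size l) * ?p + A * real (tree_size r) * ?p)"
    by (subst (1) size) (simp add: algebra_simps)
  ultimately show ?case unfolding additive_node by linarith
qed

lemma tree_gf_additive_bound:
  obtains C where "\<And>n. \<bar>tree_gf (additive \<phi>) $ n * rho ^ n\<bar> \<le> C * (real n + 1) powr (5/4)"
proof -
  obtain C where C: "\<And>n. gf_T $ n * rho ^ n \<le> C"
    using gf_T_coeff_rho_bounded by blast
  show ?thesis
  proof
    fix n
    have "tree_gf (additive \<phi>) $ n \<le> (\<Sum>t\<in>binary_trees n. A * (real n + 1) powr (5/4))"
      unfolding tree_gf_nth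
    proof (rule sum_mono)
      fix t assume t: "t \<in> binary_trees n"
      then have "additive \<phi> t \<le> A * real n * (real n + 1) powr (1/4)"
        using additive_le[of t] by (auto simp: binary_trees_def)
      also have "\<dots> \<le> A * (real n + 1) * (real n + 1) powr (1/4)"
        using A_nonneg by (intro mult_right_mono mult_left_mono) auto
      also have "\<dots> = A * ((real n + 1) powr 1 * (real n + 1) powr (1/4))" by simp
      also have "\<dots> = A * (real n + 1) powr (5/4)"
        using powr_add[of "real n + 1" 1 "1/4"] by simp
      finally show "additive \<phi> t \<le> A * (real n + 1) powr (5/4)" .
    qed
    also have "\<dots> = gf_T $ n * (A * (real n + 1) powr (5/4))" by (simp add: gf_T_nth)
    finally have "tree_gf (additive \<phi>) $ n * rho ^ n \<le> gf_T $ n * (A * (real n + 1) powr (5/4)) * rho ^ n"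
      using rho_pos by (intro mult_right_mono) auto
    also have "\<dots> = (A * (real n + 1) powr (5/4)) * (gf_T $ n * rho ^ n)" by simp
    also have "\<dots> \<le> (A * (real n + 1) powr (5/4)) * C"
      using A_nonneg by (intro mult_left_mono C) auto
    finally have "tree_gf (additive \<phi>) $ n * rho ^ n \<le> (A * C) * (real n + 1) powr (5/4)"
      by (simp add: mult_ac)
    moreover have "0 \<le> tree_gf (additive \<phi>) $ n * rho ^ n"
      using rho_pos nonneg by (auto simp: tree_gf_nth intro!: mult_nonneg_nonneg sum_nonneg additive_nonneg)
    ultimately show "\<bar>tree_gf (additive \<phi>) $ n * rho ^ n\<bar> \<le> (A * C) * (real n + 1) powr (5/4)" by simp
  qed
qed

lemma tree_gf_bound:
  obtains C where "\<And>n. \<bar>tree_gf \<phi> $ n * rho ^ n\<bar> \<le> C * (real n + 1) powr -(5/4)"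
proof -
  obtain C where C: "\<And>n. gf_T $ n * rho ^ n \<le> C * (real n + 1) powr -(3/2)"
    using gf_T_coeff_decay by blast
  show ?thesis
  proof
    fix n
    have "tree_gf \<phi> $ n \<le> (\<Sum>t\<in>binary_trees n. A * (real n + 1) powr (1/4))"
      unfolding tree_gf_nth by (rule sum_mono) (use slow in \<open>force simp: binary_trees_def\<close>)
    also have "\<dots> = gf_T $ n * (A * (real n + 1) powr (1/4))" by (simp add: gf_T_nth)
    finally have "tree_gf \<phi> $ n * rho ^ n \<le> gf_T $ n * (A * (real n + 1) powr (1/4)) * rho ^ n"
      using rho_pos by (intro mult_right_mono) auto
    also have "\<dots> = (A * (real n + 1) powr (1/4)) * (gf_T $ n * rho ^ n)" by simp
    also have "\<dots> \<le> (A * (real n + 1) powr (1/4)) * (C * (real n + 1) powr -(3/2))"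
      using A_nonneg by (intro mult_left_mono C) auto
    also have "\<dots> = (A * C) * ((real n + 1) powr (1/4) * (real n + 1) powr -(3/2))" by simp
    also have "\<dots> = (A * C) * (real n + 1) powr -(5/4)" by (simp flip: powr_add)
    finally have "tree_gf \<phi> $ n * rho ^ n \<le> (A * C) * (real n + 1) powr -(5/4)" .
    moreover have "0 \<le> tree_gf \<phi> $ n * rho ^ n"
      using rho_pos nonneg by (auto simp: tree_gf_nth intro!: mult_nonneg_nonneg sum_nonneg)
    ultimately show "\<bar>tree_gf \<phi> $ n * rho ^ n\<bar> \<le> (A * C) * (real n + 1) powr -(5/4)" by simp
  qed
qed

lemma toll_gf_bound:
  obtains C where "\<And>n. norm (toll_gf \<phi> $ n * rho ^ n) \<le> C * (real n + 1) powr -(5/4)"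
proof -
  obtain C1 where 1: "\<And>n. \<bar>tree_gf \<phi> $ n * rho ^ n\<bar> \<le> C1 * (real n + 1) powr -(5/4)"
    using tree_gf_bound by blast
  obtain C where "\<And>n. \<bar>tree_gf (additive \<phi>) $ n * rho ^ n\<bar> \<le> C * (real n + 1) powr (5/4)"
    using tree_gf_additive_bound by blast
  then obtain C2 where 2: "\<And>n. \<bar>(fps_X * (tree_gf (additive \<phi>) oo fps_X ^ 2)) $ n * rho ^ n\<bar> \<le>
      C2 * (real n + 1) powr -(5/4)"
    using odd_part_bound by blast
  show ?thesis
  proof
    fix n
    have "norm (toll_gf \<phi> $ n * rho ^ n) \<le> \<bar>tree_gf \<phi> $ n * rho ^ n\<bar> +
        \<bar>(fps_X * (tree_gf (additive \<phi>) oo fps_X ^ 2)) $ n * rho ^ n\<bar>"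
      unfolding toll_gf_def fps_add_nth distrib_right by simp
    also have "\<dots> \<le> (C1 + C2) * (real n + 1) powr -(5/4)"
      unfolding distrib_right by (intro add_mono 1 2)
    finally show "norm (toll_gf \<phi> $ n * rho ^ n) \<le> (C1 + C2) * (real n + 1) powr -(5/4)" .
  qed
qed

lemma abs_conv_toll_gf: "abs_conv (toll_gf \<phi>) rho"
  and tree_gf_additive_asymptotics:
    "(\<lambda>n. sqrt (real n + 1) * (renewal $ n * rho ^ n)) \<longlonglongrightarrow> c \<Longrightarrow>
     (\<lambda>n. sqrt (real n + 1) * (tree_gf (additive \<phi>) $ n * rho ^ n)) \<longlonglongrightarrow> c * eval_fps (toll_gf \<phi>) rho"
proof -
  obtain C where C: "\<And>n. norm (toll_gf \<phi> $ n * rho ^ n) \<le> C * (real n + 1) powr -(5/4)"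
    using toll_gf_bound by blast
  obtain c0 where c0: "(\<lambda>n. of_real (sqrt (real n + 1)) * (renewal $ n * rho ^ n)) \<longlonglongrightarrow> c0"
    using renewal_asymptotics by auto
  show "abs_conv (toll_gf \<phi>) rho"
    unfolding abs_conv_def by (rule convolution_asymptotics(2)[OF c0 C])
  assume "(\<lambda>n. sqrt (real n + 1) * (renewal $ n * rho ^ n)) \<longlonglongrightarrow> c"
  then have "(\<lambda>n. of_real (sqrt (real n + 1)) * (renewal $ n * rho ^ n)) \<longlonglongrightarrow> c" by simp
  from convolution_asymptotics(1)[OF this C]
  show "(\<lambda>n. sqrt (real n + 1) * (tree_gf (additive \<phi>) $ n * rho ^ n)) \<longlonglongrightarrow> c * eval_fps (toll_gf \<phi>) rho"
    unfolding tree_gf_additive_eq_toll_gf_mult fps_mult_nth_power eval_fps_def by simp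
qed

lemma abs_conv_tree_gf: "abs_conv (tree_gf \<phi>) rho"
proof -
  have "norm (tree_gf \<phi> $ n * rho ^ n) \<le> norm (toll_gf \<phi> $ n * rho ^ n)" for n
    using rho_pos nonneg
    by (auto simp: toll_gf_nth tree_gf_nth abs_mult additive_nonneg sum_nonneg intro!: mult_right_mono)
  then show ?thesis
    unfolding abs_conv_def
    by (intro summable_comparison_test'[OF abs_conv_toll_gf[unfolded abs_conv_def], of 0]) simp
qed

lemma abs_conv_tree_gf_additive:
  assumes "\<bar>x\<bar> \<le> rho ^ 2"
  shows "abs_conv (tree_gf (additive \<phi>)) x"
proof -
  obtain C where C: "\<And>n. \<bar>tree_gf (additive \<phi>) $ n * rho ^ n\<bar> \<le> C * (real n + 1) powr (5/4)"
    using tree_gf_additive_bound by blast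
  have C0: "0 \<le> C" using order.trans[OF abs_ge_zero C[of 0]] by simp
  obtain B where B: "\<And>n. (real n + 1) powr (5/4) * rho ^ n \<le> B * (real n + 1) powr -(5/4)"
    using geometric_decay[of rho "5/4"] rho_pos rho_le_half by auto
  have "summable (\<lambda>n. (C * B) * real (Suc n) powr -(5/4))"
    by (intro summable_mult, subst summable_Suc_iff, subst summable_real_powr_iff) simp
  then have "abs_conv (tree_gf (additive \<phi>)) (rho ^ 2)"
    unfolding abs_conv_def
  proof (rule summable_comparison_test'[of _ 0])
    fix n
    have "norm (tree_gf (additive \<phi>) $ n * (rho ^ 2) ^ n) = \<bar>tree_gf (additive \<phi>) $ n * rho ^ n\<bar> * rho ^ n"
      using rho_pos by (simp add: abs_mult power2_eq_square power_mult_distrib)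
    also have "\<dots> \<le> (C * (real n + 1) powr (5/4)) * rho ^ n"
      using rho_pos by (intro mult_right_mono C) auto
    also have "\<dots> = C * ((real n + 1) powr (5/4) * rho ^ n)" by simp
    also have "\<dots> \<le> C * (B * (real n + 1) powr -(5/4))" by (intro mult_left_mono B C0)
    finally show "norm (norm (tree_gf (additive \<phi>) $ n * (rho ^ 2) ^ n)) \<le> (C * B) * real (Suc n) powr -(5/4)"
      by (simp add: add_ac)
  qed
  then show ?thesis by (rule abs_conv_mono) (use assms in simp)
qed

lemma eval_toll_gf:
  "eval_fps (toll_gf \<phi>) rho = eval_fps (tree_gf \<phi>) rho + rho * eval_fps (tree_gf (additive \<phi>)) (rho ^ 2)"
proof -
  have 1: "abs_conv (tree_gf (additive \<phi>)) (rho ^ 2)" by (rule abs_conv_tree_gf_additive) simp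
  then show ?thesis
    unfolding toll_gf_def
    by (simp add: eval_fps_add' eval_fps_mult' eval_fps_compose_square abs_conv_mult
        abs_conv_compose_square abs_conv_tree_gf)
qed

end

lemma quarter_power_dominates_log:
  obtains A where "\<And>k n::nat. 2 ^ k \<le> n + 1 \<Longrightarrow> real k ^ 2 \<le> A * (real n + 1) powr (1/4)"
proof -
  have "(\<lambda>n. (log 2 (real n + 1)) ^ 2 / (real n + 1) powr (1/4)) \<longlonglongrightarrow> 0"
    unfolding log_def by real_asymp
  then have "Bseq (\<lambda>n. (log 2 (real n + 1)) ^ 2 / (real n + 1) powr (1/4))"
    by (intro convergent_imp_Bseq convergentI)
  then obtain A where A: "\<And>n. norm ((log 2 (real n + 1)) ^ 2 / (real n + 1) powr (1/4)) \<le> A"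
    by (auto simp: Bseq_def)
  show ?thesis
  proof
    fix k n :: nat assume "2 ^ k \<le> n + 1"
    then have "real (2 ^ k) \<le> real (n + 1)" by (simp only: of_nat_le_iff)
    then have "real k \<le> log 2 (real n + 1)" by (simp add: le_log_iff powr_realpow add_ac)
    then have "real k ^ 2 \<le> (log 2 (real n + 1)) ^ 2" by (intro power_mono) auto
    also have "\<dots> \<le> A * (real n + 1) powr (1/4)" using A[of n] by (simp add: field_simps)
    finally show "real k ^ 2 \<le> A * (real n + 1) powr (1/4)" .
  qed
qed

text \<open>
  One constant serves all tolls that are bounded by the square of the protection number; in
  particular the first two powers and the indicators of \<open>k\<close>-protection for \<open>k \<ge> 1\<close>.
\<close>

lemma slow_toll_protection_number:
  obtains A where "\<And>w. (\<And>k. 0 \<le> w k) \<Longrightarrow> (\<And>k. w k \<le> real k ^ 2) \<Longrightarrow>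
    slow_toll (\<lambda>t. w (protection_number t)) A"
proof -
  obtain A where A: "\<And>k n::nat. 2 ^ k \<le> n + 1 \<Longrightarrow> real k ^ 2 \<le> A * (real n + 1) powr (1/4)"
    using quarter_power_dominates_log by blast
  show ?thesis
  proof (rule that, unfold_locales)
    fix w :: "nat \<Rightarrow> real" and t
    assume w: "\<And>k. 0 \<le> w k" "\<And>k. w k \<le> real k ^ 2"
    show "0 \<le> w (protection_number t)" by (rule w)
    show "w (protection_number (RNode {#})) = 0" using w[of 0] by simp
    assume "binary t"
    then have "2 ^ protection_number t \<le> tree_size t + 1"
      using two_power_protection_number_le[of t] by simp
    from A[OF this] w(2)[of "protection_number t"]
    show "w (protection_number t) \<le> A * (real (tree_size t) + 1) powr (1/4)" by linarith
  qed
qed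

lemma slow_toll_protected_at_least: "\<exists>A. slow_toll (protected_at_least (Suc k)) A"
proof -
  have "of_bool (Suc k \<le> j) \<le> real j ^ 2" for j
    by (cases "Suc k \<le> j") (auto intro!: one_le_power)
  moreover obtain A where "\<And>w. (\<And>k. 0 \<le> w k) \<Longrightarrow> (\<And>k. w k \<le> real k ^ 2) \<Longrightarrow>
    slow_toll (\<lambda>t. w (protection_number t)) A"
    using slow_toll_protection_number by blast
  from this[of "\<lambda>j. of_bool (Suc k \<le> j)"] calculation show ?thesis by auto
qed

section \<open>Decomposition into protection levels\<close>

text \<open>
  The contribution of level \<open>k\<close> to the closed form of the mean. Divided by its value at 1, it is the
  limit of the probability that \<open>Y\<^sub>n\<close> is at least \<open>k\<close>, for \<open>k \<ge> 1\<close>.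
\<close>

definition protected_weight :: "nat \<Rightarrow> real" where
  "protected_weight k = eval_fps (gf_Tk k) rho + rho * eval_fps (gf_Sk k) (rho ^ 2)"

lemma protected_weight_Suc:
  "protected_weight (Suc k) = eval_fps (toll_gf (protected_at_least (Suc k))) rho"
proof -
  obtain A where "slow_toll (protected_at_least (Suc k)) A" using slow_toll_protected_at_least by blast
  from slow_toll.eval_toll_gf[OF this] show ?thesis
    by (simp add: protected_weight_def gf_Tk_eq gf_Sk_eq)
qed

lemma sums_additive:
  fixes f :: "nat \<Rightarrow> rtree \<Rightarrow> real"
  assumes "\<And>t. (\<lambda>k. f k t) sums g t"
  shows "(\<lambda>k. additive (f k) t) sums additive g t"
proof -
  have "(\<lambda>k. \<Sum>s\<in>#M. f k s) sums (\<Sum>s\<in>#M. g s)" for M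
    by (induction M) (auto intro: sums_add assms)
  then show ?thesis unfolding additive_def .
qed

lemma additive_cmult: "additive (\<lambda>t. c * f t) t = c * (additive f t :: real)"
  unfolding additive_def by (simp add: sum_mset_distrib_left)

text \<open>
  Abel summation: with increments \<open>c\<close>, the toll is \<open>\<Sum> c\<^sub>k [k + 1 \<le> protection number]\<close>, and all terms are
  nonnegative, so the sum over the levels may be taken outside.
\<close>

lemma eval_toll_gf_as_sum_over_levels:
  assumes w: "\<And>k. 0 \<le> c k" "\<And>k. (\<Sum>j<k. c j) \<le> real k ^ 2"
  shows "(\<lambda>k. c k * protected_weight (Suc k)) sums
    eval_fps (toll_gf (\<lambda>t. \<Sum>j<protection_number t. c j)) rho"
proof -
  let ?\<phi> = "\<lambda>t. \<Sum>j<protection_number t. c j"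
  let ?f = "\<lambda>k t. c k * protected_at_least (Suc k) t"
  obtain A where A: "\<And>w. (\<And>k. 0 \<le> w k) \<Longrightarrow> (\<And>k. w k \<le> real k ^ 2) \<Longrightarrow>
    slow_toll (\<lambda>t. w (protection_number t)) A"
    using slow_toll_protection_number by blast
  interpret slow_toll ?\<phi> A
    by (rule A[of "\<lambda>m. \<Sum>j<m. c j"]) (auto intro: w sum_nonneg)
  have sums: "(\<lambda>k. ?f k t) sums ?\<phi> t" for t
  proof -
    have "(\<lambda>k. ?f k t) sums (\<Sum>k<protection_number t. ?f k t)"
      by (rule sums_finite) auto
    then show ?thesis by simp
  qed
  have toll_f: "toll_gf (?f k) $ n = c k * toll_gf (protected_at_least (Suc k)) $ n" for k n
    unfolding toll_gf_nth additive_cmult by (simp add: sum_distrib_left distrib_left)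
  have row: "(\<lambda>k. toll_gf (?f k) $ n * rho ^ n) sums (toll_gf ?\<phi> $ n * rho ^ n)" for n
  proof -
    have "(\<lambda>k. toll_gf (?f k) $ n) sums (toll_gf ?\<phi> $ n)"
      unfolding toll_gf_nth
      by (cases "odd n") (auto intro!: sums_add sums_sum sums_additive sums)
    then show ?thesis by (rule sums_mult2)
  qed
  have col: "(\<lambda>n. toll_gf (?f k) $ n * rho ^ n) sums (c k * protected_weight (Suc k))" for k
  proof -
    obtain A where "slow_toll (protected_at_least (Suc k)) A" using slow_toll_protected_at_least by blast
    from sums_mult[OF abs_conv_sums[OF slow_toll.abs_conv_toll_gf[OF this]], of "c k"]
    show ?thesis unfolding protected_weight_Suc toll_f by (simp add: mult_ac)
  qed
  have "(\<lambda>k. c k * protected_weight (Suc k)) sums (\<Sum>n. toll_gf ?\<phi> $ n * rho ^ n)"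
  proof (rule sums_exchange_nonneg[OF _ row col])
    show "0 \<le> toll_gf (?f k) $ n * rho ^ n" for k n
      using w(1) rho_pos by (intro mult_nonneg_nonneg toll_gf_nonneg) auto
    show "summable (\<lambda>n. toll_gf ?\<phi> $ n * rho ^ n)"
      by (rule sums_summable[OF abs_conv_sums[OF abs_conv_toll_gf]])
  qed
  then show ?thesis by (simp add: eval_fps_def)
qed

text \<open>
  The left-hand side is \<open>T(\<rho>) - 1 + \<rho>\<^sup>3 T'(\<rho>\<^sup>2)\<close>, because 1-protected means internal. On the right,
  \<open>a\<^sup>2 \<rho> / 2 = - Q'(\<rho>) / 2 = 1 + \<rho> T(\<rho>\<^sup>2) + \<rho>\<^sup>3 T'(\<rho>\<^sup>2)\<close>. The two agree by \<open>\<rho> T(\<rho>) = 1\<close> and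
  \<open>Q(\<rho>) = 0\<close>.
\<close>

lemma protected_weight_1: "protected_weight 1 = (sqrt (rho * Q_slope) / rho) ^ 2 * rho / 2"
proof -
  have rT: "rho * eval_fps gf_T (rho ^ 2) = 1 / rho - 2"
    using Q_real_rho rho_pos unfolding Q_real_def by (simp add: field_simps power2_eq_square)
  have T1: "eval_fps (gf_Tk 1) rho = 1 / rho - 1"
  proof -
    have "eval_fps gf_T rho = 1 + eval_fps (gf_Tk 1) rho"
      by (rule eval_gf_T_eq_1_plus[OF abs_conv_gf_T_rho])
    then show ?thesis using rho_gf_T_rho rho_pos by (simp add: field_simps)
  qed
  have "gf_Sk 1 = fps_X * (fps_deriv gf_T :: real fps)"
    unfolding gf_Sk_eq
  proof (rule fps_ext)
    fix n
    show "tree_gf (additive (protected_at_least 1)) $ n = (fps_X * fps_deriv gf_T) $ n"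
      unfolding tree_gf_additive_protected_1_nth by (cases n) simp_all
  qed
  then have S1: "eval_fps (gf_Sk 1) (rho ^ 2) = rho ^ 2 * eval_fps (fps_deriv gf_T) (rho ^ 2)"
    using abs_conv_fps_deriv_gf_T[of "rho ^ 2"] rho_square_less by (simp add: eval_fps_mult')
  have "(sqrt (rho * Q_slope) / rho) ^ 2 * rho / 2 = Q_slope / 2"
    using rho_pos Q_slope_pos by (simp add: power_divide power2_eq_square)
  also have "\<dots> = 1 + rho * eval_fps gf_T (rho ^ 2) + rho ^ 3 * eval_fps (fps_deriv gf_T) (rho ^ 2)"
    by (simp add: Q_slope_def)
  finally show ?thesis
    unfolding protected_weight_def T1 S1 rT by (simp add: power2_eq_square power3_eq_cube)
qed

lemma protected_weight_1_pos: "0 < protected_weight 1"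
  unfolding protected_weight_1 using rho_pos Q_slope_pos by simp

text \<open>
  The constant of the renewal asymptotics is common to numerator and denominator and cancels.
\<close>

lemma additive_mean_limit:
  assumes "slow_toll \<phi> A"
  shows "(\<lambda>n. tree_gf (additive \<phi>) $ n / (real n * gf_T $ n)) \<longlonglongrightarrow>
    eval_fps (toll_gf \<phi>) rho / protected_weight 1"
proof -
  obtain c where c: "c \<noteq> 0" "(\<lambda>n. sqrt (real n + 1) * (renewal $ n * rho ^ n)) \<longlonglongrightarrow> c"
    by (rule renewal_asymptotics)
  obtain A1 where "slow_toll (protected_at_least 1) A1"
    using slow_toll_protected_at_least[of 0] by auto
  from slow_toll.tree_gf_additive_asymptotics[OF this c(2)]
  have "(\<lambda>n. sqrt (real n + 1) * (real n * gf_T $ n * rho ^ n)) \<longlonglongrightarrow> c * protected_weight 1"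
    unfolding tree_gf_additive_protected_1_nth using protected_weight_Suc[of 0] by simp
  from tendsto_divide[OF slow_toll.tree_gf_additive_asymptotics[OF assms c(2)] this]
  have "(\<lambda>n. (sqrt (real n + 1) * (tree_gf (additive \<phi>) $ n * rho ^ n)) /
      (sqrt (real n + 1) * (real n * gf_T $ n * rho ^ n))) \<longlonglongrightarrow>
      (c * eval_fps (toll_gf \<phi>) rho) / (c * protected_weight 1)"
    using c(1) protected_weight_1_pos by simp
  moreover have "(sqrt (real n + 1) * (tree_gf (additive \<phi>) $ n * rho ^ n)) /
      (sqrt (real n + 1) * (real n * gf_T $ n * rho ^ n)) =
      tree_gf (additive \<phi>) $ n / (real n * gf_T $ n)" for n
  proof -
    have "sqrt (real n + 1) \<noteq> 0" "rho ^ n \<noteq> 0" using rho_pos by auto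
    then show ?thesis by simp
  qed
  ultimately show ?thesis using c(1) by simp
qed

section \<open>Functional equations at real points\<close>

abbreviation (input) T :: "real \<Rightarrow> real" where "T \<equiv> eval_fps gf_T"

abbreviation (input) Tk :: "nat \<Rightarrow> real \<Rightarrow> real" where "Tk k \<equiv> eval_fps (gf_Tk k)"

abbreviation (input) Sk :: "nat \<Rightarrow> real \<Rightarrow> real" where "Sk k \<equiv> eval_fps (gf_Sk k)"

lemma eval_fps_nonneg:
  fixes f :: "real fps"
  assumes "abs_conv f x" "0 \<le> x" "\<And>n. 0 \<le> f $ n"
  shows "0 \<le> eval_fps f x"
  unfolding eval_fps_def using assms by (intro suminf_nonneg abs_conv_sums[THEN sums_summable]) auto

text \<open>
  Without a constant term, \<open>x\<^bsup>2n\<^esup> \<le> x \<sqdot> x\<^sup>n\<close> holds for every exponent that occurs.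
\<close>

lemma eval_fps_square_le:
  fixes f :: "real fps"
  assumes "abs_conv f x" "0 \<le> x" "x \<le> 1" "\<And>n. 0 \<le> f $ n" "f $ 0 = 0"
  shows "eval_fps f (x ^ 2) \<le> x * eval_fps f x"
proof -
  have sq: "x ^ 2 \<le> x" using assms by (simp add: power2_eq_square mult_left_le)
  then have conv: "abs_conv f (x ^ 2)" using assms by (intro abs_conv_mono[OF assms(1)]) simp
  have le: "f $ n * (x ^ 2) ^ n \<le> x * (f $ n * x ^ n)" for n
  proof (cases n)
    case (Suc m)
    have "(x ^ 2) ^ n = x ^ m * x * x ^ n" by (simp add: Suc power2_eq_square power_mult_distrib)
    also have "\<dots> \<le> 1 * x * x ^ n" using assms by (intro mult_right_mono power_le_one) auto
    finally have "f $ n * (x ^ 2) ^ n \<le> f $ n * (1 * x * x ^ n)" using assms by (intro mult_left_mono) auto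
    then show ?thesis by (simp add: mult_ac)
  qed (simp add: assms)
  show ?thesis
    using sums_le[OF le abs_conv_sums[OF conv] sums_mult[OF abs_conv_sums[OF assms(1)]]] .
qed

lemma Tk_Suc:
  assumes "0 \<le> x" "x \<le> rho"
  shows "Tk (Suc k) x = x / 2 * (Tk k x ^ 2 + Tk k (x ^ 2))"
proof -
  have "abs_conv (gf_T :: real fps) x" "abs_conv (gf_T :: real fps) (x ^ 2)"
    using abs_conv_gf_T[of x] abs_conv_gf_T[of "x ^ 2"] norm_power2_le_rho[of x] assms by auto
  note conv = this[THEN abs_conv_gf_Tk]
  have "eval_fps (2 * gf_Tk (Suc k)) x = eval_fps (fps_X * (gf_Tk k ^ 2 + (gf_Tk k oo fps_X ^ 2))) x"
    by (simp only: gf_Tk_Suc)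
  then show ?thesis
    by (simp add: conv eval_fps_mult' eval_fps_add' abs_conv_mult abs_conv_add
        abs_conv_compose_square eval_fps_compose_square power2_eq_square[of "gf_Tk k"]
        power2_eq_square[of "Tk k x"])
qed

lemma Tk_nonneg:
  assumes "0 \<le> x" "x \<le> rho"
  shows "0 \<le> Tk k x"
  using assms by (intro eval_fps_nonneg abs_conv_gf_Tk abs_conv_gf_T) (auto simp: gf_Tk_def)

lemma Tk_square_le:
  assumes "0 \<le> x" "x \<le> rho"
  shows "Tk (Suc k) (x ^ 2) \<le> x * Tk (Suc k) x"
proof (rule eval_fps_square_le)
  show "abs_conv (gf_Tk (Suc k)) x" using assms by (intro abs_conv_gf_Tk abs_conv_gf_T) auto
  show "x \<le> 1" using assms rho_le_half by simp
  show "gf_Tk (Suc k) $ 0 = (0 :: real)" by (simp add: gf_Tk_def binary_trees_0)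
qed (use assms in \<open>auto simp: gf_Tk_def\<close>)

text \<open>
  The pairs of twins are among the ordered pairs.
\<close>

lemma Tk_square_le_square:
  assumes "0 \<le> x" "x \<le> rho"
  shows "Tk k (x ^ 2) \<le> Tk k x ^ 2"
proof -
  have "abs_conv (gf_T :: real fps) x" "abs_conv (gf_T :: real fps) (x ^ 2)"
    using abs_conv_gf_T[of x] abs_conv_gf_T[of "x ^ 2"] norm_power2_le_rho[of x] assms by auto
  note conv = this[THEN abs_conv_gf_Tk]
  let ?f = "gf_Tk k :: real fps"
  have le: "(?f oo fps_X ^ 2) $ n * x ^ n \<le> (?f * ?f) $ n * x ^ n" for n
  proof (intro mult_right_mono)
    have nonneg: "0 \<le> ?f $ i * ?f $ (n - i)" for i by (simp add: gf_Tk_def)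
    show "(?f oo fps_X ^ 2) $ n \<le> (?f * ?f) $ n"
    proof (cases "even n")
      case True
      then obtain m where m: "n = 2 * m" by (rule evenE)
      have "?f $ m \<le> ?f $ m * ?f $ m"
      proof -
        let ?c = "card {t \<in> binary_trees m. k \<le> protection_number t}"
        have "?c \<le> ?c * ?c" by (cases ?c) auto
        then have "real ?c \<le> real (?c * ?c)" by (simp only: of_nat_le_iff)
        then show ?thesis by (simp add: gf_Tk_def)
      qed
      also have "\<dots> = (\<Sum>i\<in>{m}. ?f $ i * ?f $ (n - i))" by (simp add: m)
      also have "\<dots> \<le> (?f * ?f) $ n"
        unfolding fps_mult_nth by (rule sum_mono2) (use nonneg m in auto)
      finally show ?thesis using True by (simp add: fps_nth_compose_X_power m)
    qed (auto simp: fps_nth_compose_X_power fps_mult_nth nonneg intro!: sum_nonneg)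
  qed (use assms in simp)
  have "Tk k (x ^ 2) = eval_fps (?f oo fps_X ^ 2) x"
    using conv by (simp add: eval_fps_compose_square)
  also have "\<dots> \<le> eval_fps (?f * ?f) x"
    using sums_le[OF le abs_conv_sums abs_conv_sums] conv abs_conv_compose_square abs_conv_mult by blast
  also have "\<dots> = Tk k x ^ 2" using conv by (simp add: eval_fps_mult' power2_eq_square)
  finally show ?thesis .
qed

lemma abs_conv_gf_Sk:
  assumes "\<bar>x\<bar> \<le> rho ^ 2" shows "abs_conv (gf_Sk (Suc k) :: real fps) x"
  using slow_toll_protected_at_least[of k] slow_toll.abs_conv_tree_gf_additive assms
  unfolding gf_Sk_eq by blast

lemma Sk_nonneg:
  assumes "0 \<le> x" "x \<le> rho ^ 2" shows "0 \<le> Sk (Suc k) x"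
  using assms by (intro eval_fps_nonneg abs_conv_gf_Sk) (auto simp: gf_Sk_def sum_nonneg)

lemma square_le_rho_square: "0 \<le> x \<Longrightarrow> x \<le> rho ^ 2 \<Longrightarrow> x ^ 2 \<le> rho ^ 2"
  using rho_square_less rho_pos by (intro power_mono) auto

lemma Sk_eq:
  assumes "0 \<le> x" "x \<le> rho ^ 2"
  shows "Sk (Suc k) x * (1 - x * T x) = Tk (Suc k) x + x * Sk (Suc k) (x ^ 2)"
proof -
  let ?F = "gf_Sk (Suc k) :: real fps"
  have x: "\<bar>x\<bar> \<le> rho" "\<bar>x\<bar> \<le> rho ^ 2" "\<bar>x ^ 2\<bar> \<le> rho ^ 2"
    using assms rho_square_less square_le_rho_square[OF assms] by auto
  have T: "abs_conv gf_T x" using x by (intro abs_conv_gf_T) simp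
  note conv = T abs_conv_gf_Tk[OF T, of "Suc k"] abs_conv_gf_Sk[OF x(2), of k] abs_conv_gf_Sk[OF x(3), of k]
  have "?F = gf_Tk (Suc k) + fps_X * (gf_T * ?F + (?F oo fps_X ^ 2))"
    unfolding gf_Sk_eq gf_Tk_eq by (rule tree_gf_additive)
  then have "eval_fps ?F x = eval_fps (gf_Tk (Suc k) + fps_X * (gf_T * ?F + (?F oo fps_X ^ 2))) x"
    by simp
  also have "\<dots> = Tk (Suc k) x + x * (T x * Sk (Suc k) x + Sk (Suc k) (x ^ 2))"
    by (simp add: conv eval_fps_mult' eval_fps_add' abs_conv_mult abs_conv_add
        abs_conv_compose_square eval_fps_compose_square)
  finally show ?thesis by (simp add: algebra_simps)
qed

lemma Sk_square_le:
  assumes "0 \<le> x" "x \<le> rho ^ 2"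
  shows "Sk (Suc k) (x ^ 2) \<le> x * Sk (Suc k) x"
proof (rule eval_fps_square_le)
  show "abs_conv (gf_Sk (Suc k)) x" using assms by (intro abs_conv_gf_Sk) auto
  show "x \<le> 1" using assms rho_le_half rho_square_less by simp
  show "gf_Sk (Suc k) $ 0 = (0 :: real)"
    by (simp add: gf_Sk_def binary_trees_0 num_protected_def)
qed (use assms in \<open>auto simp: gf_Sk_def sum_nonneg\<close>)

section \<open>Propagation of enclosures from \<open>x\<^sup>2\<close> to \<open>x\<close>\<close>

lemma square_enclosure:
  fixes x :: real
  assumes "x \<in> {l..u}" "y = x ^ 2" "0 \<le> l" "l' \<le> l * l" "u * u \<le> u'"
  shows "y \<in> {l'..u'}"
proof -
  have "l ^ 2 \<le> x ^ 2" "x ^ 2 \<le> u ^ 2" using assms by (auto intro!: power_mono)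
  then show ?thesis
    unfolding assms(2) atLeastAtMost_iff using assms(4,5)[folded power2_eq_square] by (meson order.trans)
qed

lemma T_crude_enclosure:
  assumes "0 \<le> x" "x \<le> 1/4" shows "T x \<in> {1..4}"
proof -
  have x: "x \<le> rho" using assms rho_bounds by simp
  have "T x \<le> T rho" using assms x by (intro eval_gf_T_mono abs_conv_gf_T_rho)
  also have "T rho = 1 / rho" using rho_gf_T_rho rho_pos by (simp add: nonzero_eq_divide_eq mult.commute)
  also have "1 / rho \<le> 4" using rho_bounds rho_pos by (simp add: field_simps)
  finally show ?thesis
    using eval_gf_T_ge_1[OF assms(1)] abs_conv_gf_T[of x] assms x by simp
qed

text \<open>
  At \<open>x\<close> the value \<open>T(x)\<close> is the smaller root of \<open>1 + x/2 (y\<^sup>2 + T(x\<^sup>2)) - y\<close>, whose two roots are symmetric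
  about \<open>1/x\<close>. So a number is an upper bound if the quadratic is nonpositive there, and a number up
  to \<open>1/x\<close> is a lower bound if the quadratic is nonnegative there. No square root is evaluated.
\<close>

lemma T_enclosure:
  assumes x: "x \<in> {xl..xu}" "x \<le> rho" and Ty: "T y \<in> {bl..bu}" and y_eq: "y = x ^ 2"
    and xl: "0 \<le> xl" and l: "0 \<le> l" "l \<le> 1 + xl / 2 * (l * l + bl)" "xu * l \<le> 1" and bl: "0 \<le> bl"
    and u: "0 \<le> u" "1 + xu / 2 * (u * u + bu) \<le> u"
  shows "T x \<in> {l..u}"
proof -
  note y = y_eq Ty and l = l[folded power2_eq_square] and u = u[folded power2_eq_square]
  have x0: "0 \<le> x" using x xl by simp
  have conv: "abs_conv (gf_T :: real fps) x" "abs_conv (gf_T :: real fps) (x ^ 2)"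
    using abs_conv_gf_T[of x] abs_conv_gf_T[of "x ^ 2"] norm_power2_le_rho[of x] x0 x by auto
  have bu: "0 \<le> bu" using y(2) bl by simp
  have "1 + x / 2 * (u ^ 2 + bu) \<le> 1 + xu / 2 * (u ^ 2 + bu)"
    using x u bu by (intro add_left_mono mult_right_mono) auto
  then have "1 + x / 2 * (u ^ 2 + bu) \<le> u" using u(2) by linarith
  moreover have "partial_T N (x ^ 2) \<le> bu" for N
    using partial_T_le_eval[of "x ^ 2" N] conv y by simp
  ultimately have "partial_T N x \<le> u" for N
    using partial_T_le[OF x0 _ u(1)] by blast
  then have upper: "T x \<le> u" by (intro abs_conv_gf_T_if_bounded(2) x0)
  have "l \<le> T x"
  proof (rule ccontr)
    assume "\<not> l \<le> T x"
    then have less: "0 < l - T x" by simp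
    have "xl / 2 * (l ^ 2 + bl) \<le> x / 2 * (l ^ 2 + bl)"
      using x bl by (intro mult_right_mono) auto
    also have "\<dots> \<le> x / 2 * (l ^ 2 + T y)" using x0 y by (intro mult_left_mono) auto
    finally have "l \<le> 1 + x / 2 * (l ^ 2 + T y)" using l(2) by linarith
    moreover have "T x = 1 + x / 2 * (T x ^ 2 + T y)"
      using eval_gf_T_rec[OF conv] y(1) by (simp add: field_simps)
    ultimately have "l - T x \<le> x / 2 * (l ^ 2 - T x ^ 2)"
      by (simp add: algebra_simps)
    also have "\<dots> = (l - T x) * ((x * l + x * T x) / 2)" by (simp add: power2_eq_square field_simps)
    finally have "(l - T x) * 1 \<le> (l - T x) * ((x * l + x * T x) / 2)" by simp
    then have "1 \<le> (x * l + x * T x) / 2" using less by (rule mult_left_le_imp_le)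
    then have mean: "2 \<le> x * l + x * T x" by simp
    have x_l: "x * l \<le> 1" using mult_right_mono[of x xu l] x l by simp
    have "x \<noteq> 0" using mean by auto
    then have "x * T x < x * l" using less x0 by (intro mult_strict_left_mono) auto
    with mean x_l show False by linarith
  qed
  with upper show ?thesis by simp
qed

lemma Tk_enclosure:
  assumes x: "x \<in> {xl..xu}" "x \<le> rho" and y: "Tk k y \<in> {bl..bu}" and a: "Tk k x \<in> {al..au}"
    and eqs: "y = x ^ 2" "m = Suc k" and nonneg: "0 \<le> xl" "0 \<le> bl" "0 \<le> al"
    and lu: "l \<le> xl / 2 * (al * al + bl)" "xu / 2 * (au * au + bu) \<le> u"
  shows "Tk m x \<in> {l..u}"
proof -
  have "xl / 2 * (al ^ 2 + bl) \<le> x / 2 * (Tk k x ^ 2 + Tk k y)"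
    using x y a nonneg by (intro mult_mono add_mono power_mono) auto
  moreover have "x / 2 * (Tk k x ^ 2 + Tk k y) \<le> xu / 2 * (au ^ 2 + bu)"
    using x y a nonneg by (intro mult_mono add_mono power_mono) auto
  ultimately show ?thesis using lu[folded power2_eq_square] Tk_Suc[of x k] x eqs nonneg by simp
qed

lemma Tk_1_enclosure:
  assumes "T x \<in> {l..u}" "x \<le> rho" "0 \<le> x" "l' = l - 1" "u' = u - 1"
  shows "Tk 1 x \<in> {l'..u'}"
  using eval_gf_T_eq_1_plus[of x] abs_conv_gf_T[of x] assms by simp

lemma Sk_enclosure_aux:
  fixes S :: real
  assumes x: "x \<in> {xl..xu}" "0 \<le> xl" and t: "t \<in> {ta..tb}" "0 \<le> ta"
    and S: "0 \<le> S" and less: "xu * tb < 1"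
    and l: "l * (1 - xl * ta) \<le> S * (1 - x * t)" and u: "S * (1 - x * t) \<le> u * (1 - xu * tb)"
  shows "S \<in> {l..u}"
proof -
  have xt: "xl * ta \<le> x * t" "x * t \<le> xu * tb" using x t by (auto intro!: mult_mono)
  have "S * (1 - x * t) \<le> S * (1 - xl * ta)" using xt S by (intro mult_left_mono) auto
  then have "l * (1 - xl * ta) \<le> S * (1 - xl * ta)" using l by linarith
  then have "l \<le> S" using xt less by (auto dest: mult_right_le_imp_le)
  moreover have "S * (1 - xu * tb) \<le> S * (1 - x * t)" using xt S by (intro mult_left_mono) auto
  then have "S * (1 - xu * tb) \<le> u * (1 - xu * tb)" using u by linarith
  then have "S \<le> u" using less by (auto dest: mult_right_le_imp_le)
  ultimately show ?thesis by simp
qed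

lemma Sk_enclosure:
  assumes x: "x \<in> {xl..xu}" "x \<le> rho ^ 2" and t: "T x \<in> {ta..tb}"
    and a: "Tk m x \<in> {al..au}" and Sy: "Sk m y \<in> {bl..bu}"
    and eqs: "y = x ^ 2" "0 < m" and nonneg: "0 \<le> xl" "0 \<le> ta" "0 \<le> bl" and less: "xu * tb < 1"
    and l: "l * (1 - xl * ta) \<le> al + xl * bl" and u: "au + xu * bu \<le> u * (1 - xu * tb)"
  shows "Sk m x \<in> {l..u}"
proof (rule Sk_enclosure_aux[OF x(1) nonneg(1) t nonneg(2) _ less])
  obtain k where m: "m = Suc k" using eqs(2) by (cases m) auto
  have x0: "0 \<le> x" using x nonneg by simp
  show "0 \<le> Sk m x" unfolding m using x0 x(2) by (rule Sk_nonneg)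
  have "xl * bl \<le> x * Sk m y" "x * Sk m y \<le> xu * bu"
    using x Sy nonneg by (auto intro!: mult_mono)
  then show "l * (1 - xl * ta) \<le> Sk m x * (1 - x * T x)"
    "Sk m x * (1 - x * T x) \<le> u * (1 - xu * tb)"
    using Sk_eq[OF x0 x(2), of k] a l u unfolding m eqs(1) by auto
qed

text \<open>
  Here \<open>S\<^sub>k(x\<^sup>2)\<close> is eliminated by \<open>0 \<le> S\<^sub>k(x\<^sup>2) \<le> x S\<^sub>k(x)\<close>, which costs a relative error of about \<open>x\<^sup>2\<close> and
  ends the descent at a small argument.
\<close>

lemma Sk_last_enclosure:
  assumes x: "x \<in> {xl..xu}" "x \<le> rho ^ 2" and t: "T x \<in> {ta..tb}"
    and a: "Tk m x \<in> {al..au}" and m0: "0 < m" and nonneg: "0 \<le> xl" "0 \<le> ta"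
    and less: "xu * tb + xu * xu < 1"
    and l: "l * (1 - xl * ta) \<le> al" and u: "au \<le> u * (1 - xu * tb - xu * xu)"
  shows "Sk m x \<in> {l..u}"
proof -
  obtain k where m: "m = Suc k" using m0 by (cases m) auto
  note Sk_eq = Sk_eq[of x k, folded m]
  note less = less[folded power2_eq_square] and u = u[folded power2_eq_square]
  have x0: "0 \<le> x" using x nonneg by simp
  let ?S = "Sk m x"
  have S: "0 \<le> ?S" unfolding m using x0 x(2) by (rule Sk_nonneg)
  have S2: "0 \<le> Sk m (x ^ 2)" using square_le_rho_square[OF x0 x(2)] unfolding m by (intro Sk_nonneg) auto
  have "x * Sk m (x ^ 2) \<le> x * (x * ?S)" unfolding m using x0 x(2) by (intro mult_left_mono Sk_square_le)
  then have le: "?S * (1 - x * T x) \<le> au + x ^ 2 * ?S"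
    unfolding Sk_eq[OF x0 x(2)] using a by (simp add: power2_eq_square)
  have "0 \<le> x * Sk m (x ^ 2)" using x0 S2 by simp
  then have ge: "l * (1 - xl * ta) \<le> ?S * (1 - x * T x)"
    unfolding Sk_eq[OF x0 x(2)] using a l by simp
  have xt: "x * T x \<le> xu * tb" "x ^ 2 \<le> xu ^ 2" using x t nonneg by (auto intro!: mult_mono power_mono)
  have "?S * (1 - xu * tb - xu ^ 2) \<le> ?S * (1 - x * T x - x ^ 2)"
    using xt S by (intro mult_left_mono) auto
  also have "\<dots> \<le> au" using le by (simp add: algebra_simps)
  also have "\<dots> \<le> u * (1 - xu * tb - xu ^ 2)" by (rule u)
  finally have upper: "?S \<le> u" using less by (auto dest: mult_right_le_imp_le)
  have less': "xu * tb < 1" using less zero_le_power2[of xu] by linarith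
  have "?S \<in> {l..?S * (1 - x * T x) / (1 - xu * tb)}"
    by (rule Sk_enclosure_aux[OF x(1) nonneg(1) t nonneg(2) S less' ge]) (use less' in simp)
  with upper show ?thesis by simp
qed

section \<open>Numerical enclosures\<close>

text \<open>
  The bounds for \<open>\<rho>\<close> and its powers, and for the series at them, have 15 significant digits, rounded
  outwards. This leaves an error of about \<open>2 / 10^12\<close> in the variance. The variance differs from the
  decimal that it is compared with by about \<open>3.3 / 10^11\<close>, so the allowed distance \<open>5 / 10^11\<close> leaves ample room.
\<close>

lemma power_enclosures:
  fixes x :: real
  assumes "x \<in> {0.402697503671431..0.402697503671452}"
  shows "x ^ 2 \<in> {0.162165279463202..0.16216527946322}"
    and "x ^ 4 \<in> {0.0262975778633784..0.0262975778633843}"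
    and "x ^ 8 \<in> {0.000691562601480449..0.00069156260148076}"
    and "x ^ 16 \<in> {478258831766406 / 10 ^ 21..478258831766837 / 10 ^ 21}"
    and "x ^ 32 \<in> {228731510162567 / 10 ^ 27..22873151016298 / 10 ^ 26}"
    and "x ^ 64 \<in> {523181037412484 / 10 ^ 40..523181037414375 / 10 ^ 40}"
proof -
  show e1: "x ^ 2 \<in> {0.162165279463202..0.16216527946322}"
    by (rule square_enclosure[OF assms]) simp_all
  show e2: "x ^ 4 \<in> {0.0262975778633784..0.0262975778633843}"
    by (rule square_enclosure[OF e1]) simp_all
  show e3: "x ^ 8 \<in> {0.000691562601480449..0.00069156260148076}"
    by (rule square_enclosure[OF e2]) simp_all
  show e4: "x ^ 16 \<in> {478258831766406 / 10 ^ 21..478258831766837 / 10 ^ 21}"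
    by (rule square_enclosure[OF e3]) simp_all
  show e5: "x ^ 32 \<in> {228731510162567 / 10 ^ 27..22873151016298 / 10 ^ 26}"
    by (rule square_enclosure[OF e4]) simp_all
  show e6: "x ^ 64 \<in> {523181037412484 / 10 ^ 40..523181037414375 / 10 ^ 40}"
    by (rule square_enclosure[OF e5]) simp_all
qed

lemma T_enclosures:
  assumes x: "x \<in> {0.402697503671431..0.402697503671452}"
  shows "T (x ^ 2) \<in> {1.20004105256861..1.20004105256865}"
    and "T (x ^ 4) \<in> {1.02702702739576..1.02702702739578}"
    and "T (x ^ 8) \<in> {1.00069204152249..1.0006920415225}"
    and "T (x ^ 16) \<in> {1.00000047825906..1.00000047825907}"
    and "T (x ^ 32) \<in> {1.00000000000022..1.00000000000058}"
proof -
  note p = power_enclosures[OF x]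
  have le: "x ^ 2 \<le> rho" "x ^ 4 \<le> rho" "x ^ 8 \<le> rho" "x ^ 16 \<le> rho" "x ^ 32 \<le> rho"
    using p rho_bounds by simp_all
  have t6: "T (x ^ 64) \<in> {1..4}"
    using p(6) by (intro T_crude_enclosure) simp_all
  show t5: "T (x ^ 32) \<in> {1.00000000000022..1.00000000000058}"
    by (rule T_enclosure[OF p(5) le(5) t6]) simp_all
  show t4: "T (x ^ 16) \<in> {1.00000047825906..1.00000047825907}"
    by (rule T_enclosure[OF p(4) le(4) t5]) simp_all
  show t3: "T (x ^ 8) \<in> {1.00069204152249..1.0006920415225}"
    by (rule T_enclosure[OF p(3) le(3) t4]) simp_all
  show t2: "T (x ^ 4) \<in> {1.02702702739576..1.02702702739578}"
    by (rule T_enclosure[OF p(2) le(2) t3]) simp_all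
  show t1: "T (x ^ 2) \<in> {1.20004105256861..1.20004105256865}"
    by (rule T_enclosure[OF p(1) le(1) t2]) simp_all
qed

text \<open>
  The discriminant is decreasing, vanishes at \<open>\<rho>\<close>, and changes sign between the two bounds.
\<close>

lemma rho_enclosure: "rho \<in> {0.402697503671431..0.402697503671452}"
proof -
  define l u :: real where "l = 0.402697503671431" and "u = 0.402697503671452"
  have u0: "0 \<le> u" by (simp add: u_def)
  have lu: "l \<in> {l..u}" "u \<in> {l..u}" by (simp_all add: l_def u_def)
  have sq: "l ^ 2 < rho" "u ^ 2 < rho"
    using rho_bounds by (simp_all add: l_def u_def power2_eq_square)
  have "T (l ^ 2) \<le> 1.20004105256865" "1.20004105256861 \<le> T (u ^ 2)"
    using T_enclosures(1)[OF lu(1)[unfolded l_def u_def]] T_enclosures(1)[OF lu(2)[unfolded l_def u_def]]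
    by (simp_all add: l_def u_def)
  then have "l ^ 2 * T (l ^ 2) \<le> l ^ 2 * 1.20004105256865" "u ^ 2 * 1.20004105256861 \<le> u ^ 2 * T (u ^ 2)"
    by (intro mult_left_mono; simp)+
  then have Q: "0 < Q_real l" "Q_real u < 0"
    by (simp_all add: Q_real_def l_def u_def power2_eq_square)
  have "l < rho"
  proof (rule ccontr)
    assume "\<not> l < rho"
    then have "Q_real l \<le> Q_real rho"
      using Q_real_strict_antimono[of rho l] sq rho_pos by (cases "rho = l") auto
    with Q Q_real_rho show False by simp
  qed
  moreover have "rho < u"
  proof (rule ccontr)
    assume "\<not> rho < u"
    then have "Q_real rho \<le> Q_real u"
      using Q_real_strict_antimono[of u rho] rho_square_less u0 by (cases "rho = u") auto
    with Q Q_real_rho show False by simp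
  qed
  ultimately show ?thesis by (simp add: l_def u_def)
qed

lemma rho_power_le: "rho ^ 2 \<le> rho" "rho ^ 4 \<le> rho" "rho ^ 8 \<le> rho" "rho ^ 16 \<le> rho"
  "rho ^ 4 \<le> rho ^ 2" "rho ^ 8 \<le> rho ^ 2" "rho ^ 16 \<le> rho ^ 2"
proof -
  note p = power_enclosures[OF rho_enclosure]
  show "rho ^ 2 \<le> rho" "rho ^ 4 \<le> rho" "rho ^ 8 \<le> rho" "rho ^ 16 \<le> rho"
    "rho ^ 4 \<le> rho ^ 2" "rho ^ 8 \<le> rho ^ 2" "rho ^ 16 \<le> rho ^ 2"
    using p rho_enclosure by simp_all
qed

lemma T_rho_enclosure: "T rho \<in> {2.48325353617257..2.48325353617271}"
proof -
  have "T rho = 1 / rho" using rho_gf_T_rho rho_pos by (simp add: nonzero_eq_divide_eq mult.commute)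
  then show ?thesis using rho_enclosure by (simp add: pos_le_divide_eq pos_divide_le_eq)
qed

text \<open>
  The levels decrease doubly exponentially, and faster at higher powers of \<open>\<rho>\<close>; only the values that
  influence the relevant digits appear.
\<close>

lemma Tk_enclosures:
  shows "Tk 1 (rho) \<in> {1.48325353617257..1.48325353617271}"
    and "Tk 1 (rho ^ 2) \<in> {0.20004105256861..0.20004105256865}"
    and "Tk 1 (rho ^ 4) \<in> {0.02702702739576..0.02702702739578}"
    and "Tk 1 (rho ^ 8) \<in> {0.00069204152249..0.0006920415225}"
    and "Tk 1 (rho ^ 16) \<in> {47825906 / 10 ^ 14..47825907 / 10 ^ 14}"
    and "Tk 2 (rho) \<in> {0.48325353617258..0.483253536172698}"
    and "Tk 2 (rho ^ 2) \<in> {0.00543605991151248..0.00543605991151601}"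
    and "Tk 2 (rho ^ 4) \<in> {187041750335161 / 10 ^ 19..187041750336661 / 10 ^ 19}"
    and "Tk 2 (rho ^ 8) \<in> {330975128309064 / 10 ^ 24..330975131771813 / 10 ^ 24}"
    and "Tk 3 (rho) \<in> {0.0481163193072759..0.0481163193073022}"
    and "Tk 3 (rho ^ 2) \<in> {391263648783575 / 10 ^ 20..391263648785147 / 10 ^ 20}"
    and "Tk 3 (rho ^ 4) \<in> {895197546862209 / 10 ^ 26..895197551422884 / 10 ^ 26}"
    and "Tk 4 (rho) \<in> {0.000466946444731909..0.000466946444732447}"
    and "Tk 4 (rho ^ 2) \<in> {196712157783599 / 10 ^ 26..196712158154411 / 10 ^ 26}"
    and "Tk 5 (rho) \<in> {439022730045925 / 10 ^ 22..439022730046968 / 10 ^ 22}"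
proof -
  note x = rho_enclosure power_enclosures[OF rho_enclosure]
  note t = T_rho_enclosure T_enclosures[OF rho_enclosure]
  show t1_0: "Tk 1 (rho) \<in> {1.48325353617257..1.48325353617271}"
    by (rule Tk_1_enclosure[OF t(1) order.refl]) (use rho_pos in simp_all)
  show t1_1: "Tk 1 (rho ^ 2) \<in> {0.20004105256861..0.20004105256865}"
    by (rule Tk_1_enclosure[OF t(2) rho_power_le(1)]) (use rho_pos in simp_all)
  show t1_2: "Tk 1 (rho ^ 4) \<in> {0.02702702739576..0.02702702739578}"
    by (rule Tk_1_enclosure[OF t(3) rho_power_le(2)]) (use rho_pos in simp_all)
  show t1_3: "Tk 1 (rho ^ 8) \<in> {0.00069204152249..0.0006920415225}"
    by (rule Tk_1_enclosure[OF t(4) rho_power_le(3)]) (use rho_pos in simp_all)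
  show t1_4: "Tk 1 (rho ^ 16) \<in> {47825906 / 10 ^ 14..47825907 / 10 ^ 14}"
    by (rule Tk_1_enclosure[OF t(5) rho_power_le(4)]) (use rho_pos in simp_all)
  show t2_0: "Tk 2 (rho) \<in> {0.48325353617258..0.483253536172698}"
    by (rule Tk_enclosure[OF x(1) order.refl t1_1 t1_0]) simp_all
  show t2_1: "Tk 2 (rho ^ 2) \<in> {0.00543605991151248..0.00543605991151601}"
    by (rule Tk_enclosure[OF x(2) rho_power_le(1) t1_2 t1_1]) simp_all
  show t2_2: "Tk 2 (rho ^ 4) \<in> {187041750335161 / 10 ^ 19..187041750336661 / 10 ^ 19}"
    by (rule Tk_enclosure[OF x(3) rho_power_le(2) t1_3 t1_2]) simp_all
  show t2_3: "Tk 2 (rho ^ 8) \<in> {330975128309064 / 10 ^ 24..330975131771813 / 10 ^ 24}"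
    by (rule Tk_enclosure[OF x(4) rho_power_le(3) t1_4 t1_3]) simp_all
  show t3_0: "Tk 3 (rho) \<in> {0.0481163193072759..0.0481163193073022}"
    by (rule Tk_enclosure[OF x(1) order.refl t2_1 t2_0]) simp_all
  show t3_1: "Tk 3 (rho ^ 2) \<in> {391263648783575 / 10 ^ 20..391263648785147 / 10 ^ 20}"
    by (rule Tk_enclosure[OF x(2) rho_power_le(1) t2_2 t2_1]) simp_all
  show t3_2: "Tk 3 (rho ^ 4) \<in> {895197546862209 / 10 ^ 26..895197551422884 / 10 ^ 26}"
    by (rule Tk_enclosure[OF x(3) rho_power_le(2) t2_3 t2_2]) simp_all
  show t4_0: "Tk 4 (rho) \<in> {0.000466946444731909..0.000466946444732447}"
    by (rule Tk_enclosure[OF x(1) order.refl t3_1 t3_0]) simp_all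
  show t4_1: "Tk 4 (rho ^ 2) \<in> {196712157783599 / 10 ^ 26..196712158154411 / 10 ^ 26}"
    by (rule Tk_enclosure[OF x(2) rho_power_le(1) t3_2 t3_1]) simp_all
  show t5_0: "Tk 5 (rho) \<in> {439022730045925 / 10 ^ 22..439022730046968 / 10 ^ 22}"
    by (rule Tk_enclosure[OF x(1) order.refl t4_1 t4_0]) simp_all
qed

lemma Sk_enclosures:
  shows "Sk 1 (rho ^ 16) \<in> {478259288731838 / 10 ^ 21..478259298731953 / 10 ^ 21}"
    and "Sk 1 (rho ^ 8) \<in> {0.000692521106367838..0.000692521106377853}"
    and "Sk 1 (rho ^ 4) \<in> {0.0277959613313447..0.0277959613313658}"
    and "Sk 1 (rho ^ 2) \<in> {0.253973007705484..0.253973007705548}"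
    and "Sk 2 (rho ^ 8) \<in> {331204335351936 / 10 ^ 24..331204497328256 / 10 ^ 24}"
    and "Sk 2 (rho ^ 4) \<in> {192233748651389 / 10 ^ 19..192233748652976 / 10 ^ 19}"
    and "Sk 2 (rho ^ 2) \<in> {0.00675342810158988..0.00675342810159455}"
    and "Sk 3 (rho ^ 4) \<in> {92004645900511 / 10 ^ 25..920700860124761 / 10 ^ 26}"
    and "Sk 3 (rho ^ 2) \<in> {485803604959008 / 10 ^ 20..485803605092741 / 10 ^ 20}"
    and "Sk 4 (rho ^ 2) \<in> {244243080712131 / 10 ^ 26..252487238067048 / 10 ^ 26}"
proof -
  note x = power_enclosures[OF rho_enclosure]
  note t = T_enclosures[OF rho_enclosure]
  note le = order.refl[of "rho ^ 2"] rho_power_le(5-)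
  show s1_4: "Sk 1 (rho ^ 16) \<in> {478259288731838 / 10 ^ 21..478259298731953 / 10 ^ 21}"
    by (rule Sk_last_enclosure[OF x(4) le(4) t(4) Tk_enclosures(5)]) simp_all
  show s1_3: "Sk 1 (rho ^ 8) \<in> {0.000692521106367838..0.000692521106377853}"
    by (rule Sk_enclosure[OF x(3) le(3) t(3) Tk_enclosures(4) s1_4]) simp_all
  show s1_2: "Sk 1 (rho ^ 4) \<in> {0.0277959613313447..0.0277959613313658}"
    by (rule Sk_enclosure[OF x(2) le(2) t(2) Tk_enclosures(3) s1_3]) simp_all
  show s1_1: "Sk 1 (rho ^ 2) \<in> {0.253973007705484..0.253973007705548}"
    by (rule Sk_enclosure[OF x(1) le(1) t(1) Tk_enclosures(2) s1_2]) simp_all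
  show s2_3: "Sk 2 (rho ^ 8) \<in> {331204335351936 / 10 ^ 24..331204497328256 / 10 ^ 24}"
    by (rule Sk_last_enclosure[OF x(3) le(3) t(3) Tk_enclosures(9)]) simp_all
  show s2_2: "Sk 2 (rho ^ 4) \<in> {192233748651389 / 10 ^ 19..192233748652976 / 10 ^ 19}"
    by (rule Sk_enclosure[OF x(2) le(2) t(2) Tk_enclosures(8) s2_3]) simp_all
  show s2_1: "Sk 2 (rho ^ 2) \<in> {0.00675342810158988..0.00675342810159455}"
    by (rule Sk_enclosure[OF x(1) le(1) t(1) Tk_enclosures(7) s2_2]) simp_all
  show s3_2: "Sk 3 (rho ^ 4) \<in> {92004645900511 / 10 ^ 25..920700860124761 / 10 ^ 26}"
    by (rule Sk_last_enclosure[OF x(2) le(2) t(2) Tk_enclosures(12)]) simp_all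
  show s3_1: "Sk 3 (rho ^ 2) \<in> {485803604959008 / 10 ^ 20..485803605092741 / 10 ^ 20}"
    by (rule Sk_enclosure[OF x(1) le(1) t(1) Tk_enclosures(11) s3_2]) simp_all
  show s4_1: "Sk 4 (rho ^ 2) \<in> {244243080712131 / 10 ^ 26..252487238067048 / 10 ^ 26}"
    by (rule Sk_last_enclosure[OF x(1) le(1) t(1) Tk_enclosures(14)]) simp_all
qed

section \<open>The limits of the moments to ten decimals\<close>

lemma protected_weight_enclosure:
  assumes r: "rho \<in> {rl..ru}" and t: "Tk k rho \<in> {ta..tb}" and s: "Sk k (rho ^ 2) \<in> {sa..sb}"
    and nonneg: "0 \<le> rl" "0 \<le> sa" and lu: "l \<le> ta + rl * sa" "tb + ru * sb \<le> u"
  shows "protected_weight k \<in> {l..u}"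
proof -
  have "rl * sa \<le> rho * Sk k (rho ^ 2)" "rho * Sk k (rho ^ 2) \<le> ru * sb"
    using r s nonneg by (auto intro!: mult_mono)
  then show ?thesis using t lu by (simp add: protected_weight_def)
qed

lemma protected_weight_nonneg: "0 \<le> protected_weight (Suc k)"
  unfolding protected_weight_def using rho_pos by (intro add_nonneg_nonneg mult_nonneg_nonneg Tk_nonneg Sk_nonneg) auto

text \<open>
  The factor \<open>1 - y T(y) - y\<^sup>2\<close> at \<open>y = \<rho>\<^sup>2\<close> is about \<open>0.78\<close>, hence at least \<open>1/2\<close>.
\<close>

lemma Sk_rho_square_le: "Sk (Suc k) (rho ^ 2) \<le> 2 * Tk (Suc k) (rho ^ 2)"
proof -
  let ?y = "rho ^ 2" and ?S = "Sk (Suc k) (rho ^ 2)"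
  have y: "0 \<le> ?y" "?y \<le> rho ^ 2" by simp_all
  have yb: "?y \<le> 1/5" "T ?y \<le> 3/2"
    using power_enclosures(1)[OF rho_enclosure] T_enclosures(1)[OF rho_enclosure] by simp_all
  have "?y * T ?y \<le> 1/5 * (3/2)"
    using yb eval_gf_T_ge_1[OF y(1)] abs_conv_gf_T_real[of ?y] rho_square_less by (intro mult_mono) auto
  moreover have "?y * ?y \<le> 1/5 * (1/5)" using yb by (intro mult_mono) auto
  ultimately have "1/2 \<le> 1 - ?y * T ?y - ?y * ?y" by linarith
  then have "?S * (1/2) \<le> ?S * (1 - ?y * T ?y - ?y * ?y)"
    by (rule mult_left_mono) (rule Sk_nonneg[OF y])
  also have "\<dots> = ?S * (1 - ?y * T ?y) - ?y * (?y * ?S)"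
    by (simp only: right_diff_distrib mult_ac)
  also have "\<dots> \<le> Tk (Suc k) ?y"
    unfolding Sk_eq[OF y] using mult_left_mono[OF Sk_square_le[OF y, of k] y(1)] by simp
  finally show ?thesis by simp
qed

lemma protected_weight_le: "protected_weight (Suc k) \<le> 2 * Tk (Suc k) rho"
proof -
  have "rho * Sk (Suc k) (rho ^ 2) \<le> rho * (2 * (rho * Tk (Suc k) rho))"
    using Sk_rho_square_le[of k] Tk_square_le[of rho k] rho_pos by (intro mult_left_mono) auto
  also have "\<dots> = (2 * rho ^ 2) * Tk (Suc k) rho" by (simp add: power2_eq_square)
  also have "\<dots> \<le> 1 * Tk (Suc k) rho"
    using power_enclosures(1)[OF rho_enclosure] rho_pos by (intro mult_right_mono Tk_nonneg) auto
  finally show ?thesis by (simp add: protected_weight_def)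
qed

lemma Tk_5_rho_le: "Tk 5 rho \<le> 5 / 10 ^ 8"
  using Tk_enclosures(15) by simp

text \<open>
  Squaring at each step turns the bound at level 5 into a geometric one with a tiny ratio.
\<close>

lemma Tk_rho_decay: "Tk (5 + j) rho \<le> 5 / 10 ^ 8 * (1 / 10 ^ 7) ^ j"
proof (induction j)
  case 0
  then show ?case using Tk_5_rho_le by simp
next
  case (Suc j)
  let ?t = "Tk (5 + j) rho"
  have t0: "0 \<le> ?t" using rho_pos by (intro Tk_nonneg) auto
  have "(1 / 10 ^ 7) ^ j \<le> (1 :: real)" by (rule power_le_one) auto
  then have t1: "?t \<le> 1 / 10 ^ 7" using Suc.IH by simp
  have "Tk (5 + Suc j) rho = rho / 2 * (?t ^ 2 + Tk (5 + j) (rho ^ 2))"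
    using Tk_Suc[of rho "5 + j"] rho_pos by simp
  also have "\<dots> \<le> rho / 2 * (?t ^ 2 + ?t ^ 2)"
    using rho_pos by (intro mult_left_mono add_left_mono Tk_square_le_square) auto
  also have "\<dots> = rho * (?t * ?t)" by (simp add: power2_eq_square)
  also have "\<dots> \<le> 1 * (?t * ?t)" using rho_bounds by (intro mult_right_mono) auto
  also have "\<dots> \<le> 1 * (?t * (1 / 10 ^ 7))" using t0 t1 by (intro mult_left_mono) auto
  also have "\<dots> \<le> (5 / 10 ^ 8 * (1 / 10 ^ 7) ^ j) * (1 / 10 ^ 7)" using Suc.IH by simp
  finally show ?case by simp
qed

text \<open>
  Five levels suffice, for the mean as well as for the second moment: the weights grow only linearly
  and the remaining levels decrease geometrically.
\<close>

lemma weighted_sum_enclosure: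
  assumes sums: "(\<lambda>k. c k * protected_weight (Suc k)) sums M"
    and c: "\<And>k. 0 \<le> c k" "\<And>k. c k \<le> 2 * real k + 1"
  shows "M - (\<Sum>k<5. c k * protected_weight (Suc k)) \<in> {0..3 / 10 ^ 13}"
proof -
  let ?f = "\<lambda>j. c (j + 5) * protected_weight (Suc (j + 5))"
  have tail: "?f sums (M - (\<Sum>k<5. c k * protected_weight (Suc k)))"
    using sums_iff_shift[of "\<lambda>k. c k * protected_weight (Suc k)" 5] sums by simp
  have nonneg: "0 \<le> ?f j" for j by (intro mult_nonneg_nonneg c protected_weight_nonneg)
  (* the ratio 1/2 is generous, and the series on the right sums to the bound in the claim *)
  have le: "?f j \<le> 15 / 10 ^ 14 * (1 / 2) ^ j" for j
  proof -
    have "real j + 1 \<le> 2 ^ j"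
    proof (induction j)
      case (Suc j)
      then show ?case using one_le_power[of "2::real" j] by simp
    qed simp
    (* 2 (j + 5) + 1 = 2 j + 11 *)
    then have "c (j + 5) \<le> 11 * 2 ^ j" using c(2)[of "j + 5"] by simp
    moreover have "protected_weight (Suc (j + 5)) \<le> 2 * (5 / 10 ^ 8 * (1 / 10 ^ 7) ^ Suc j)"
      using protected_weight_le[of "j + 5"] Tk_rho_decay[of "Suc j"] by (simp add: add_ac)
    ultimately have "?f j \<le> (11 * 2 ^ j) * (2 * (5 / 10 ^ 8 * (1 / 10 ^ 7) ^ Suc j))"
      by (intro mult_mono protected_weight_nonneg) auto
    also have "\<dots> = 11 / 10 ^ 14 * (2 ^ j * (1 / 10 ^ 7) ^ j)" by simp
    also have "\<dots> = 11 / 10 ^ 14 * (2 / 10 ^ 7) ^ j" by (simp only: power_mult_distrib[symmetric]) simp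
    also have "\<dots> \<le> 15 / 10 ^ 14 * (1 / 2) ^ j" by (intro mult_mono power_mono) auto
    finally show ?thesis .
  qed
  have "(\<lambda>j. 15 / 10 ^ 14 * (1 / 2) ^ j) sums (15 / 10 ^ 14 * (1 / (1 - 1 / 2 :: real)))"
    by (intro sums_mult geometric_sums) simp
  from sums_le[OF le tail this] have "M - (\<Sum>k<5. c k * protected_weight (Suc k)) \<le> 3 / 10 ^ 13" by simp
  moreover have "0 \<le> M - (\<Sum>k<5. c k * protected_weight (Suc k))"
    using sums_le[OF nonneg sums_zero tail] .
  ultimately show ?thesis by simp
qed

lemma real_le_square: "real k \<le> real k ^ 2"
  by (cases k) (simp_all add: power2_eq_square algebra_simps)

lemma mean_sums: "(\<lambda>k. protected_weight (Suc k)) sums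
    eval_fps (toll_gf (\<lambda>t. real (protection_number t))) rho"
proof -
  have "(\<Sum>j<k. 1) \<le> real k ^ 2" for k
    using real_le_square[of k] by simp
  from eval_toll_gf_as_sum_over_levels[of "\<lambda>_. 1", OF _ this] show ?thesis by simp
qed

lemma second_moment_sums: "(\<lambda>k. (2 * real k + 1) * protected_weight (Suc k)) sums
    eval_fps (toll_gf (\<lambda>t. real (protection_number t) ^ 2)) rho"
proof -
  have sum: "(\<Sum>j<k. 2 * real j + 1) = real k ^ 2" for k
    by (induction k) (simp_all add: power2_eq_square algebra_simps)
  show ?thesis
    using eval_toll_gf_as_sum_over_levels[of "\<lambda>k. 2 * real k + 1"] unfolding sum by simp
qed

text \<open>
  At level 5 the total \<open>S\<^sub>5(\<rho>\<^sup>2)\<close> is so small that crude bounds replace its enclosure.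
\<close>

lemma protected_weight_enclosures:
  shows "protected_weight 1 \<in> {1.58552783237549..1.58552783237567}"
    and "protected_weight 2 \<in> {0.485973124810314..0.485973124810435}"
    and "protected_weight 3 \<in> {0.0481182756262658..0.0481182756262927}"
    and "protected_weight 4 \<in> {0.000466946445715469..0.000466946445749207}"
    and "protected_weight 5 \<in> {439022730045925 / 10 ^ 22..439023030046968 / 10 ^ 22}"
proof -
  show "protected_weight 1 \<in> {1.58552783237549..1.58552783237567}"
    by (rule protected_weight_enclosure[OF rho_enclosure Tk_enclosures(1) Sk_enclosures(4)]) simp_all
  show "protected_weight 2 \<in> {0.485973124810314..0.485973124810435}"
    by (rule protected_weight_enclosure[OF rho_enclosure Tk_enclosures(6) Sk_enclosures(7)]) simp_all
  show "protected_weight 3 \<in> {0.0481182756262658..0.0481182756262927}"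
    by (rule protected_weight_enclosure[OF rho_enclosure Tk_enclosures(10) Sk_enclosures(9)]) simp_all
  show "protected_weight 4 \<in> {0.000466946445715469..0.000466946445749207}"
    by (rule protected_weight_enclosure[OF rho_enclosure Tk_enclosures(13) Sk_enclosures(10)]) simp_all
  (* at level 5 an error far below 1 / 10 ^ 12 is harmless, so a crude bound on the next square is enough *)
  have "Tk 4 (rho ^ 4) \<le> rho ^ 2 * Tk 4 (rho ^ 2)"
    using Tk_square_le[of "rho ^ 2" 3] rho_power_le(1) by (simp flip: power_mult)
  also have "\<dots> \<le> 1 / 5 * (2 / 10 ^ 12)"
    using power_enclosures(1)[OF rho_enclosure] Tk_enclosures(14) by (intro mult_mono) auto
  finally have "Tk 4 (rho ^ 4) \<in> {0..4 / 10 ^ 13}"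
    using Tk_nonneg[of "rho ^ 4" 4] rho_power_le(2) by simp
  then have "Tk 5 (rho ^ 2) \<in> {0..37 / 10 ^ 15}"
    by (rule Tk_enclosure[OF power_enclosures(1)[OF rho_enclosure] rho_power_le(1) _ Tk_enclosures(14)]) simp_all
  then have "Sk 5 (rho ^ 2) \<in> {0..74 / 10 ^ 15}"
    using Sk_rho_square_le[of 4] Sk_nonneg[of "rho ^ 2" 4] by simp
  then show "protected_weight 5 \<in> {439022730045925 / 10 ^ 22..439023030046968 / 10 ^ 22}"
    by (rule protected_weight_enclosure[OF rho_enclosure Tk_enclosures(15)]) simp_all
qed

text \<open>
  Multiplied by the positive denominator, both bounds are linear in the level weights.
\<close>

lemma mean_enclosure:
  "eval_fps (toll_gf (\<lambda>t. real (protection_number t))) rho / protected_weight 1 \<in> {1.3371485380886..1.3371485380893}"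
proof -
  let ?M = "eval_fps (toll_gf (\<lambda>t. real (protection_number t))) rho"
  note w = protected_weight_enclosures[unfolded atLeastAtMost_iff]
  have tail: "?M - (\<Sum>k<5. 1 * protected_weight (Suc k)) \<in> {0..3 / 10 ^ 13}"
    by (rule weighted_sum_enclosure) (use mean_sums in simp_all)
  have "(\<Sum>k<5. 1 * protected_weight (Suc k)) = protected_weight 1 + protected_weight 2 +
      protected_weight 3 + protected_weight 4 + protected_weight 5"
    by (simp add: eval_nat_numeral)
  then have "1.3371485380886 * protected_weight 1 \<le> ?M" "?M \<le> 1.3371485380893 * protected_weight 1"
    using tail w by simp_all
  then show ?thesis
    using protected_weight_1_pos by (simp add: pos_le_divide_eq pos_divide_le_eq)
qed

lemma second_moment_enclosure:
  "eval_fps (toll_gf (\<lambda>t. real (protection_number t) ^ 2)) rho / protected_weight 1 \<in> {2.0733206557797..2.073320655781}"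
proof -
  let ?M = "eval_fps (toll_gf (\<lambda>t. real (protection_number t) ^ 2)) rho"
  note w = protected_weight_enclosures[unfolded atLeastAtMost_iff]
  have tail: "?M - (\<Sum>k<5. (2 * real k + 1) * protected_weight (Suc k)) \<in> {0..3 / 10 ^ 13}"
    by (rule weighted_sum_enclosure) (use second_moment_sums in simp_all)
  have "(\<Sum>k<5. (2 * real k + 1) * protected_weight (Suc k)) = protected_weight 1 + 3 * protected_weight 2 +
      5 * protected_weight 3 + 7 * protected_weight 4 + 9 * protected_weight 5"
    by (simp add: eval_nat_numeral)
  then have "2.0733206557797 * protected_weight 1 \<le> ?M" "?M \<le> 2.073320655781 * protected_weight 1"
    using tail w by simp_all
  then show ?thesis
    using protected_weight_1_pos by (simp add: pos_le_divide_eq pos_divide_le_eq)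
qed

lemma abs_diff_le_if_enclosed:
  fixes q :: real
  assumes "q \<in> {l..u}" "c - e \<le> l" "u \<le> c + e"
  shows "\<bar>q - c\<bar> \<le> e"
  using assms by (simp add: abs_le_iff)

lemma mean_numeric:
  "\<bar>eval_fps (toll_gf (\<lambda>t. real (protection_number t))) rho / protected_weight 1 - 1.3371485381\<bar> \<le> 5 / 10 ^ 11"
  by (rule abs_diff_le_if_enclosed[OF mean_enclosure]) simp_all

lemma variance_numeric:
  "\<bar>eval_fps (toll_gf (\<lambda>t. real (protection_number t) ^ 2)) rho / protected_weight 1 -
    (eval_fps (toll_gf (\<lambda>t. real (protection_number t))) rho / protected_weight 1) ^ 2 - 0.2853544429\<bar> \<le> 5 / 10 ^ 11"
proof -
  have "(eval_fps (toll_gf (\<lambda>t. real (protection_number t))) rho / protected_weight 1) ^ 2 \<in>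
      {1.3371485380886 * 1.3371485380886..1.3371485380893 * 1.3371485380893}"
    by (rule square_enclosure[OF mean_enclosure refl]) simp_all
  then show ?thesis using second_moment_enclosure by (simp add: abs_le_iff)
qed


section \<open>Moments of the protection number of a random vertex\<close>

lemma sum_mset_eq_sum_count:
  fixes f :: "'a \<Rightarrow> real"
  shows "(\<Sum>x\<in>#M. f x) = (\<Sum>x\<in>set_mset M. f x * real (count M x))"
proof -
  have "(\<Sum>x\<in>#M. f x) = (\<Sum>x\<in>A. f x * real (count M x))" if "finite A" "set_mset M \<subseteq> A" for A
    using that(2)
  proof (induction M)
    case (add a M)
    have "(\<Sum>x\<in>A. f x * real (count (add_mset a M) x)) =
        (\<Sum>x\<in>A. f x * real (count M x) + (if x = a then f x else 0))"
      by (intro sum.cong refl) (simp add: algebra_simps)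
    also have "\<dots> = (\<Sum>x\<in>A. f x * real (count M x)) + f a"
      using that(1) add.prems by (simp add: sum.distrib)
    finally show ?case using add by simp
  qed simp
  then show ?thesis by simp
qed

lemma expectation_pmf_of_multiset:
  fixes f :: "'a \<Rightarrow> real"
  assumes "M \<noteq> {#}"
  shows "measure_pmf.expectation (pmf_of_multiset M) f = (\<Sum>x\<in>#M. f x) / size M"
  using assms
  by (subst integral_measure_pmf_real[of "set_mset M"])
     (simp_all add: sum_mset_eq_sum_count sum_divide_distrib)

text \<open>
  Leaves have protection number 0, so a function that vanishes at 0 may be summed over all vertices.
\<close>

lemma sum_internal_subtrees:
  fixes f :: "nat \<Rightarrow> real"
  assumes "f 0 = 0"
  shows "(\<Sum>s\<in>#internal_subtrees t. f (protection_number s)) = additive (\<lambda>s. f (protection_number s)) t"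
proof -
  have leaf: "protection_number s = 0" if "children s = {#}" for s
    using that by (cases s) simp
  have "(\<Sum>s\<in>#filter_mset (\<lambda>s. children s \<noteq> {#}) M. f (protection_number s)) =
      (\<Sum>s\<in>#M. f (protection_number s))" for M
    by (induction M) (auto simp: leaf assms)
  then show ?thesis by (simp add: internal_subtrees_def additive_def)
qed

text \<open>
  All trees of size \<open>n\<close> have the same number \<open>n\<close> of internal vertices, so choosing a tree and then one
  of its internal vertices is uniform over all such pairs.
\<close>

lemma expectation_Y:
  fixes f :: "nat \<Rightarrow> real"
  assumes "f 0 = 0" "0 < n"
  shows "measure_pmf.expectation (Y_pmf n) f =
    tree_gf (additive (\<lambda>t. f (protection_number t))) $ n / (real n * gf_T $ n)"
proof -
  have nonempty: "internal_subtrees t \<noteq> {#}" if "t \<in> binary_trees n" for t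
    using that assms(2) by (auto simp: binary_trees_def)
  have "measure_pmf.expectation (Y_pmf n) f =
      (\<Sum>t\<in>binary_trees n. measure_pmf.expectation
        (map_pmf protection_number (pmf_of_multiset (internal_subtrees t))) f /\<^sub>R real (card (binary_trees n)))"
    unfolding Y_pmf_def
    by (rule pmf_expectation_bind_pmf_of_set)
       (auto simp: binary_trees_nonempty finite_binary_trees nonempty)
  also have "\<dots> = (\<Sum>t\<in>binary_trees n. additive (\<lambda>s. f (protection_number s)) t / (real n * gf_T $ n))"
  proof (intro sum.cong refl)
    fix t assume t: "t \<in> binary_trees n"
    then have "tree_size t = n" by (simp add: binary_trees_def)
    then show "measure_pmf.expectation (map_pmf protection_number (pmf_of_multiset (internal_subtrees t))) f
        /\<^sub>R real (card (binary_trees n)) = additive (\<lambda>s. f (protection_number s)) t / (real n * gf_T $ n)"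
      by (simp add: expectation_pmf_of_multiset[OF nonempty[OF t]] sum_internal_subtrees assms
          gf_T_nth divide_inverse)
  qed
  finally show ?thesis by (simp add: tree_gf_nth sum_divide_distrib)
qed

lemma finite_set_Y_pmf:
  assumes "0 < n" shows "finite (set_pmf (Y_pmf n))"
proof -
  have "internal_subtrees t \<noteq> {#}" if "t \<in> binary_trees n" for t
    using that assms by (auto simp: binary_trees_def)
  then show ?thesis unfolding Y_pmf_def by (auto simp: binary_trees_nonempty finite_binary_trees)
qed

lemma expectation_Y_limit:
  fixes f :: "nat \<Rightarrow> real"
  assumes "\<And>k. 0 \<le> f k" "\<And>k. f k \<le> real k ^ 2"
  shows "(\<lambda>n. measure_pmf.expectation (Y_pmf n) f) \<longlonglongrightarrow>
    eval_fps (toll_gf (\<lambda>t. f (protection_number t))) rho / protected_weight 1"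
proof -
  obtain A where "\<And>w. (\<And>k. 0 \<le> w k) \<Longrightarrow> (\<And>k. w k \<le> real k ^ 2) \<Longrightarrow>
    slow_toll (\<lambda>t. w (protection_number t)) A"
    using slow_toll_protection_number by blast
  then have "slow_toll (\<lambda>t. f (protection_number t)) A" using assms by blast
  note lim = additive_mean_limit[OF this]
  have f0: "f 0 = 0" using assms[of 0] by simp
  have "\<forall>\<^sub>F n in sequentially. tree_gf (additive (\<lambda>t. f (protection_number t))) $ n / (real n * gf_T $ n) =
      measure_pmf.expectation (Y_pmf n) f"
    using eventually_gt_at_top[of 0] by eventually_elim (rule expectation_Y[of f, OF f0, symmetric])
  from lim this show ?thesis by (rule Lim_transform_eventually)
qed

lemma variance_Y_limit:
  assumes mean: "(\<lambda>n. measure_pmf.expectation (Y_pmf n) real) \<longlonglongrightarrow> \<mu>"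
    and second: "(\<lambda>n. measure_pmf.expectation (Y_pmf n) (\<lambda>k. real k ^ 2)) \<longlonglongrightarrow> m"
  shows "(\<lambda>n. measure_pmf.variance (Y_pmf n) real) \<longlonglongrightarrow> m - \<mu> ^ 2"
proof -
  have "\<forall>\<^sub>F n in sequentially. measure_pmf.expectation (Y_pmf n) (\<lambda>k. real k ^ 2) -
      (measure_pmf.expectation (Y_pmf n) real) ^ 2 = measure_pmf.variance (Y_pmf n) real"
    using eventually_gt_at_top[of 0]
  proof eventually_elim
    case (elim n)
    then show ?case
      by (intro measure_pmf.variance_eq[symmetric] integrable_measure_pmf_finite finite_set_Y_pmf)
  qed
  moreover have "(\<lambda>n. measure_pmf.expectation (Y_pmf n) (\<lambda>k. real k ^ 2) -
      (measure_pmf.expectation (Y_pmf n) real) ^ 2) \<longlonglongrightarrow> m - \<mu> ^ 2"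
    by (intro tendsto_intros mean second)
  ultimately show ?thesis by (rule Lim_transform_eventually[rotated])
qed

theorem theorem6:
  shows "(\<exists>a>0. square_root_expansion a \<and>
            summable (\<lambda>k. rho * eval_fps (gf_Sk (Suc k)) (rho ^ 2) + eval_fps (gf_Tk (Suc k)) rho) \<and>
            (let \<mu> = 2 / (a ^ 2 * rho) *
                   (\<Sum>k. rho * eval_fps (gf_Sk (Suc k)) (rho ^ 2) + eval_fps (gf_Tk (Suc k)) rho)
             in (\<lambda>n. measure_pmf.expectation (Y_pmf n) real) \<longlonglongrightarrow> \<mu> \<and>
                \<bar>\<mu> - 1.3371485381\<bar> \<le> 5 / 10 ^ 11)) \<and>
         (\<exists>v. (\<lambda>n. measure_pmf.variance (Y_pmf n) real) \<longlonglongrightarrow> v \<and>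
            \<bar>v - 0.2853544429\<bar> \<le> 5 / 10 ^ 11)"
proof -
  define a where "a = sqrt (rho * Q_slope) / rho"
  define M where "M = eval_fps (toll_gf (\<lambda>t. real (protection_number t))) rho"
  define M2 where "M2 = eval_fps (toll_gf (\<lambda>t. real (protection_number t) ^ 2)) rho"
  let ?W = "protected_weight 1"
  have sums: "(\<lambda>k. rho * eval_fps (gf_Sk (Suc k)) (rho ^ 2) + eval_fps (gf_Tk (Suc k)) rho) sums M"
    using mean_sums by (simp add: M_def protected_weight_def add.commute)
  have "0 < a" unfolding a_def using rho_pos Q_slope_pos by simp
  have mean: "(\<lambda>n. measure_pmf.expectation (Y_pmf n) real) \<longlonglongrightarrow> M / ?W"
    unfolding M_def by (rule expectation_Y_limit) (use real_le_square in auto)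
  have second: "(\<lambda>n. measure_pmf.expectation (Y_pmf n) (\<lambda>k. real k ^ 2)) \<longlonglongrightarrow> M2 / ?W"
    unfolding M2_def by (rule expectation_Y_limit) auto
  have \<mu>: "2 / (a ^ 2 * rho) *
      (\<Sum>k. rho * eval_fps (gf_Sk (Suc k)) (rho ^ 2) + eval_fps (gf_Tk (Suc k)) rho) = M / ?W"
  proof -
    have W: "?W = a ^ 2 * rho / 2" unfolding a_def by (rule protected_weight_1)
    show ?thesis unfolding sums_unique[OF sums, symmetric] W by simp
  qed
  show ?thesis
    unfolding Let_def
  proof (rule conjI)
    show "\<exists>a>0. square_root_expansion a \<and>
        summable (\<lambda>k. rho * eval_fps (gf_Sk (Suc k)) (rho ^ 2) + eval_fps (gf_Tk (Suc k)) rho) \<and>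
        (\<lambda>n. measure_pmf.expectation (Y_pmf n) real) \<longlonglongrightarrow> 2 / (a ^ 2 * rho) *
          (\<Sum>k. rho * eval_fps (gf_Sk (Suc k)) (rho ^ 2) + eval_fps (gf_Tk (Suc k)) rho) \<and>
        \<bar>2 / (a ^ 2 * rho) *
          (\<Sum>k. rho * eval_fps (gf_Sk (Suc k)) (rho ^ 2) + eval_fps (gf_Tk (Suc k)) rho) -
          1.3371485381\<bar> \<le> 5 / 10 ^ 11"
    proof (intro exI[of _ a] conjI)
      show "0 < a" by fact
      show "square_root_expansion a" unfolding a_def by (rule square_root_expansion_gf_T)
      show "summable (\<lambda>k. rho * eval_fps (gf_Sk (Suc k)) (rho ^ 2) + eval_fps (gf_Tk (Suc k)) rho)"
        using sums by (rule sums_summable)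
    qed (unfold \<mu>, rule mean, unfold M_def, rule mean_numeric)
    show "\<exists>v. (\<lambda>n. measure_pmf.variance (Y_pmf n) real) \<longlonglongrightarrow> v \<and>
        \<bar>v - 0.2853544429\<bar> \<le> 5 / 10 ^ 11"
      using variance_Y_limit[OF mean second] variance_numeric unfolding M_def M2_def by blast
  qed
qed

end
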